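(* Let $(\mathcal{A},\mathcal{G},\alpha)$ be a discrete dynamical system and assume that $\mathcal{A}$ has a contractive approximate unit consisting of selfadjoint operators. If $\mathcal{A}$ is hyperrigid, then $$\mathrm{C}^*_{\text{env}}\big(\mathcal{A}\rtimes_{\mathrm{C}^*_{\text{env}}(\mathcal{A}),\alpha}\mathcal{G}\big)\;\simeq\;\mathrm{C}^*_{\text{env}}(\mathcal{A})\rtimes_\alpha\mathcal{G}.$$
   Context: All operator algebras (not necessarily selfadjoint) are assumed to be approximately unital, i.e. to have a contractive approximate unit. All groups are discrete. The symbol $\simeq$ denotes $*$-isomorphism of $\mathrm{C}^*$-algebras. A $\mathrm{C}^*$-cover $(\mathcal{C},j)$ of an operator algebra $\mathcal{A}$ is a $\mathrm{C}^*$-algebra $\mathcal{C}$ with a completely isometric homomorphism $j:\mathcal{A}\to\mathcal{C}$ such that $\mathcal{C}=\mathrm{C}^*(j(\mathcal{A}))$. The $\mathrm{C}^*$-envelope $\mathrm{C}^*_{\text{env}}(\mathcal{A})=(\mathrm{C}^*_{\text{env}}(\mathcal{A}),j)$ is the $\mathrm{C}^*$-cover such that for any $\mathrm{C}^*$-cover $(\mathcal{C},i)$ of $\mathcal{A}$ there is a $*$-epimorphism $\varphi:\mathcal{C}\to\mathrm{C}^*_{\text{env}}(\mathcal{A})$ with $\varphi\circ i=j$. A discrete dynamical system $(\mathcal{A},\mathcal{G},\alpha)$ consists of an approximately unital operator algebra $\mathcal{A}$, a discrete group $\mathcal{G}$, and a group homomorphism $\alpha:\mathcal{G}\to\operatorname{Aut}\mathcal{A}$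 into the completely isometric automorphisms of $\mathcal{A}$. The action extends uniquely to an action of $\mathcal{G}$, again denoted $\alpha$, on $\mathrm{C}^*_{\text{env}}(\mathcal{A})$ by $*$-automorphisms, i.e. $\alpha_s\circ j=j\circ\alpha_s$. The relative full crossed product $\mathcal{A}\rtimes_{\mathrm{C}^*_{\text{env}}(\mathcal{A}),\alpha}\mathcal{G}$ is the norm-closed subalgebra of the full $\mathrm{C}^*$-crossed product $\mathrm{C}^*_{\text{env}}(\mathcal{A})\rtimes_\alpha\mathcal{G}$ generated by all finite sums $\sum_{g\in\mathcal{G}}a_gu_g$, with $a_g\in\mathcal{A}$ (identified with $j(\mathcal{A})$) and $u_g$ the universal unitaries implementing $\alpha_g$. A dilation of a completely contractive map $\pi:\mathcal{A}\to B(\mathcal{H})$ is a completely contractive map $\rho:\mathcal{A}\to B(\mathcal{K})$, $\mathcal{K}\supseteq\mathcal{H}$, with $P_{\mathcal{H}}\rho(\cdot)|_{\mathcal{H}}=\pi$ (if $\mathcal{A}$ is unital and one works in the unital category, $\pi$ and $\rho$ are required to be unital). A completely contractive map $\pi$ is maximal if for every dilation $\rho$ of $\pi$, $\rho(\mathcal{A})$ reduces $\overline{\pi(\mathcal{A})\mathcal{H}}$ (in the unital case: $\rho(\mathcal{A})$ reduces $\mathcal{H}$). $\mathcal{A}$ is hyperrigid if the restriction to $\mathcal{A}$ of every non-degenerate $*$-representation of $\mathrm{C}^*_{\text{env}}(\mathcal{A})$ is a maximal map. *)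

theory Defs
  imports "HOL-Analysis.Analysis" "HOL-Algebra.Group"
begin

section \<open>Complex Hilbert spaces\<close>

class complex_vector = real_vector +
  fixes scaleC :: "complex \<Rightarrow> 'a \<Rightarrow> 'a"  (infixr "*\<^sub>C" 75)
  assumes scaleC_add_right: "c *\<^sub>C (x + y) = c *\<^sub>C x + c *\<^sub>C y"
    and scaleC_add_left: "(c + d) *\<^sub>C x = c *\<^sub>C x + d *\<^sub>C x"
    and scaleC_scaleC: "c *\<^sub>C d *\<^sub>C x = (c * d) *\<^sub>C x"
    and scaleC_one: "1 *\<^sub>C x = x"
    and scaleR_scaleC: "r *\<^sub>R x = complex_of_real r *\<^sub>C x"

global_interpretation complex_vector: vector_space "scaleC :: complex \<Rightarrow> 'a \<Rightarrow> 'a::complex_vector"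
  defines csubspace = complex_vector.subspace
    and cspan = complex_vector.span
  by unfold_locales (simp_all add: scaleC_add_right scaleC_add_left scaleC_scaleC scaleC_one)

class chilbert_space = complex_vector + real_inner + complete_space +
  fixes cinner :: "'a \<Rightarrow> 'a \<Rightarrow> complex"
  assumes cinner_commute: "cinner x y = cnj (cinner y x)"
    and cinner_add_left: "cinner (x + y) z = cinner x z + cinner y z"
    and cinner_scaleC_left: "cinner (c *\<^sub>C x) y = c * cinner x y"
    and Re_cinner: "Re (cinner x y) = inner x y"

lemma cinner_self: "cinner x x = complex_of_real ((norm x)\<^sup>2)"
  for x :: "'a::chilbert_space"
proof (rule complex_eqI)
  show "Re (cinner x x) = Re (complex_of_real ((norm x)\<^sup>2))"
    by (simp add: Re_cinner power2_norm_eq_inner)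
  have "Im (cinner x x) = Im (cnj (cinner x x))"
    using cinner_commute[of x x] by simp
  then show "Im (cinner x x) = Im (complex_of_real ((norm x)\<^sup>2))"
    by simp
qed

lemma norm_scaleC: "norm (c *\<^sub>C x) = cmod c * norm x"
  for x :: "'a::chilbert_space"
proof -
  have "cinner (c *\<^sub>C x) (c *\<^sub>C x) = c * cnj c * cinner x x"
    by (metis cinner_commute cinner_scaleC_left complex_cnj_mult mult.assoc)
  then have "(norm (c *\<^sub>C x))\<^sup>2 = (cmod c * norm x)\<^sup>2"
    by (simp only: cinner_self complex_norm_square[symmetric] power_mult_distrib
        of_real_mult[symmetric] of_real_eq_iff)
  then show ?thesis
    by (simp add: power2_eq_iff_nonneg)
qed

lemma bounded_linear_scaleC: "bounded_linear (\<lambda>x :: 'a::chilbert_space. c *\<^sub>C x)"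
proof (rule bounded_linear_intro[where K = "cmod c"])
  fix r :: real and x :: 'a
  show "c *\<^sub>C r *\<^sub>R x = r *\<^sub>R c *\<^sub>C x"
    by (simp add: scaleR_scaleC scaleC_scaleC mult.commute)
qed (simp_all add: scaleC_add_right norm_scaleC mult.commute)

instantiation blinfun :: (real_normed_vector, chilbert_space) complex_vector
begin

definition scaleC_blinfun :: "complex \<Rightarrow> 'a \<Rightarrow>\<^sub>L 'b \<Rightarrow> 'a \<Rightarrow>\<^sub>L 'b" where
  "scaleC_blinfun c T = Blinfun (\<lambda>x. c *\<^sub>C blinfun_apply T x)"

lemma blinfun_apply_scaleC: "blinfun_apply (c *\<^sub>C T) x = c *\<^sub>C blinfun_apply T x"
  for T :: "'a \<Rightarrow>\<^sub>L 'b"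
  unfolding scaleC_blinfun_def
  by (subst bounded_linear_Blinfun_apply)
    (auto intro: bounded_linear_compose[OF bounded_linear_scaleC] blinfun.bounded_linear_right)

instance
  by standard
    (auto intro!: blinfun_eqI simp: blinfun_apply_scaleC blinfun.bilinear_simps
      scaleC_add_right scaleC_add_left scaleC_scaleC scaleC_one scaleR_scaleC)

end

subsection \<open>The Hilbert space of square-summable families\<close>

typedef 'i ell2 = "{f :: 'i \<Rightarrow> complex. (\<lambda>i. (cmod (f i))\<^sup>2) summable_on UNIV}"
  by (rule exI[of _ "\<lambda>_. 0"]) simp

setup_lifting type_definition_ell2

lemma sq_summable_mult:
  assumes "(\<lambda>i. (cmod (f i))\<^sup>2) summable_on UNIV" "(\<lambda>i. (cmod (g i))\<^sup>2) summable_on UNIV"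
  shows "(\<lambda>i. f i * cnj (g i)) summable_on UNIV"
proof (rule abs_summable_summable, rule summable_on_comparison_test)
  show "(\<lambda>i. (cmod (f i))\<^sup>2 + (cmod (g i))\<^sup>2) summable_on UNIV"
    by (rule summable_on_add[OF assms])
  fix i
  have "2 * (cmod (f i) * cmod (g i)) \<le> (cmod (f i))\<^sup>2 + (cmod (g i))\<^sup>2"
    using sum_squares_bound[of "cmod (f i)" "cmod (g i)"] by simp
  moreover have "0 \<le> cmod (f i) * cmod (g i)"
    by simp
  ultimately show "norm (f i * cnj (g i)) \<le> (cmod (f i))\<^sup>2 + (cmod (g i))\<^sup>2"
    unfolding norm_mult complex_mod_cnj by linarith
qed simp

lemma sq_summable_add:
  assumes "(\<lambda>i. (cmod (f i))\<^sup>2) summable_on UNIV" "(\<lambda>i. (cmod (g i))\<^sup>2) summable_on UNIV"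
  shows "(\<lambda>i. (cmod (f i + g i))\<^sup>2) summable_on UNIV"
proof (rule summable_on_comparison_test)
  show "(\<lambda>i. 2 * (cmod (f i))\<^sup>2 + 2 * (cmod (g i))\<^sup>2) summable_on UNIV"
    by (intro summable_on_add summable_on_cmult_right assms)
  fix i
  have "(cmod (f i + g i))\<^sup>2 \<le> (cmod (f i) + cmod (g i))\<^sup>2"
    by (simp add: norm_triangle_ineq power_mono)
  also have "\<dots> \<le> 2 * (cmod (f i))\<^sup>2 + 2 * (cmod (g i))\<^sup>2"
    using sum_squares_bound[of "cmod (f i)" "cmod (g i)"] by (simp add: power2_sum)
  finally show "(cmod (f i + g i))\<^sup>2 \<le> 2 * (cmod (f i))\<^sup>2 + 2 * (cmod (g i))\<^sup>2" .
qed simp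

lemma sq_summable_mult_left:
  assumes "(\<lambda>i. (cmod (f i))\<^sup>2) summable_on UNIV"
  shows "(\<lambda>i. (cmod (c * f i))\<^sup>2) summable_on UNIV"
  using summable_on_cmult_right[OF assms, of "(cmod c)\<^sup>2"] by (simp add: norm_mult power_mult_distrib)

instantiation ell2 :: (type) complex_vector
begin

lift_definition zero_ell2 :: "'a ell2" is "\<lambda>_. 0" by simp
lift_definition plus_ell2 :: "'a ell2 \<Rightarrow> 'a ell2 \<Rightarrow> 'a ell2" is "\<lambda>f g i. f i + g i"
  by (rule sq_summable_add)
lift_definition uminus_ell2 :: "'a ell2 \<Rightarrow> 'a ell2" is "\<lambda>f i. - f i" by simp
lift_definition minus_ell2 :: "'a ell2 \<Rightarrow> 'a ell2 \<Rightarrow> 'a ell2" is "\<lambda>f g i. f i - g i"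
  using sq_summable_add[of _ "\<lambda>i. - g i" for g] by simp
lift_definition scaleC_ell2 :: "complex \<Rightarrow> 'a ell2 \<Rightarrow> 'a ell2" is "\<lambda>c f i. c * f i"
  by (rule sq_summable_mult_left)
lift_definition scaleR_ell2 :: "real \<Rightarrow> 'a ell2 \<Rightarrow> 'a ell2" is "\<lambda>r f i. complex_of_real r * f i"
  by (rule sq_summable_mult_left)

instance
  by standard (transfer; simp add: fun_eq_iff algebra_simps)+

end

instantiation ell2 :: (type) real_inner
begin

lift_definition inner_ell2 :: "'a ell2 \<Rightarrow> 'a ell2 \<Rightarrow> real" is
  "\<lambda>f g. Re (\<Sum>\<^sub>\<infinity>i. f i * cnj (g i))" .
definition norm_ell2 :: "'a ell2 \<Rightarrow> real" where "norm_ell2 f = sqrt (inner f f)"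
definition sgn_ell2 :: "'a ell2 \<Rightarrow> 'a ell2" where "sgn_ell2 f = inverse (norm f) *\<^sub>R f"
definition dist_ell2 :: "'a ell2 \<Rightarrow> 'a ell2 \<Rightarrow> real" where "dist_ell2 f g = norm (f - g)"
definition uniformity_ell2 :: "('a ell2 \<times> 'a ell2) filter" where
  "uniformity_ell2 = (INF e\<in>{0<..}. principal {(f, g). dist f g < e})"
definition open_ell2 :: "'a ell2 set \<Rightarrow> bool" where
  "open_ell2 U \<longleftrightarrow> (\<forall>f\<in>U. \<forall>\<^sub>F (f', g) in uniformity. f' = f \<longrightarrow> g \<in> U)"

lemma inner_ell2_self:
  "inner f f = (\<Sum>\<^sub>\<infinity>i. (cmod (Rep_ell2 f i))\<^sup>2)" for f :: "'a ell2"
proof -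
  have s: "(\<lambda>i. Rep_ell2 f i * cnj (Rep_ell2 f i)) summable_on UNIV"
    using Rep_ell2[of f] by (intro sq_summable_mult) auto
  show ?thesis
    unfolding inner_ell2.rep_eq using infsum_Re[OF s]
    by (simp add: complex_norm_square[symmetric])
qed

instance
proof
  fix f g h :: "'a ell2" and r :: real
  have sm: "(\<lambda>i. Rep_ell2 f i * cnj (Rep_ell2 g i)) summable_on UNIV" for f g :: "'a ell2"
    using Rep_ell2[of f] Rep_ell2[of g] by (intro sq_summable_mult) auto
  have sq: "(\<lambda>i. (cmod (Rep_ell2 f i))\<^sup>2) summable_on UNIV" for f :: "'a ell2"
    using Rep_ell2[of f] by simp
  show "inner f g = inner g f"
  proof -
    have "(\<Sum>\<^sub>\<infinity>i. Rep_ell2 f i * cnj (Rep_ell2 g i)) = cnj (\<Sum>\<^sub>\<infinity>i. Rep_ell2 g i * cnj (Rep_ell2 f i))"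
      by (simp add: infsum_cnj[symmetric] mult.commute del: infsum_cnj)
    then show ?thesis
      unfolding inner_ell2.rep_eq by simp
  qed
  show "inner (f + g) h = inner f h + inner g h"
    unfolding inner_ell2.rep_eq plus_ell2.rep_eq
    by (simp add: distrib_right infsum_add[OF sm sm])
  show "inner (r *\<^sub>R f) g = r * inner f g"
    unfolding inner_ell2.rep_eq scaleR_ell2.rep_eq
    by (simp add: mult.assoc infsum_cmult_right[OF sm])
  show "0 \<le> inner f f"
    unfolding inner_ell2_self by (rule infsum_nonneg) simp
  show "(inner f f = 0) = (f = 0)"
  proof
    assume "inner f f = 0"
    then have "(cmod (Rep_ell2 f i))\<^sup>2 = 0" for i
      using nonneg_infsum_le_0D[OF _ sq, of f i] by (simp add: inner_ell2_self)
    then show "f = 0"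
      by (simp add: Rep_ell2_inject[symmetric] zero_ell2.rep_eq fun_eq_iff)
  qed (simp add: inner_ell2_self zero_ell2.rep_eq)
qed (simp_all only: norm_ell2_def sgn_ell2_def dist_ell2_def uniformity_ell2_def open_ell2_def)

end

lemma norm_ell2_sq: "(norm f)\<^sup>2 = (\<Sum>\<^sub>\<infinity>i. (cmod (Rep_ell2 f i))\<^sup>2)" for f :: "'i ell2"
  by (simp add: power2_norm_eq_inner inner_ell2_self)

lemma sum_le_norm_ell2_sq:
  assumes "finite F"
  shows "(\<Sum>i\<in>F. (cmod (Rep_ell2 f i))\<^sup>2) \<le> (norm f)\<^sup>2"
  unfolding norm_ell2_sq
  by (rule finite_sum_le_infsum) (use Rep_ell2[of f] assms in auto)

lemma cmod_Rep_ell2_le: "cmod (Rep_ell2 f i) \<le> norm f"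
  using sum_le_norm_ell2_sq[of "{i}" f] by (simp add: abs_le_square_iff[symmetric])

lemma ell2_complete:
  fixes X :: "nat \<Rightarrow> 'i ell2"
  assumes "Cauchy X"
  shows "convergent X"
proof -
  let ?x = "\<lambda>n i. Rep_ell2 (X n) i"
  have "Cauchy (\<lambda>n. ?x n i)" for i
  proof (rule metric_CauchyI)
    fix e :: real assume "0 < e"
    then obtain M where M: "dist (X m) (X n) < e" if "m \<ge> M" "n \<ge> M" for m n
      using metric_CauchyD[OF assms] by blast
    have "dist (?x m i) (?x n i) \<le> dist (X m) (X n)" for m n
      using cmod_Rep_ell2_le[of "X m - X n" i] by (simp add: dist_norm minus_ell2.rep_eq)
    then show "\<exists>M. \<forall>m\<ge>M. \<forall>n\<ge>M. dist (?x m i) (?x n i) < e"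
      using M by (meson le_less_trans)
  qed
  then have "\<forall>i. \<exists>a. (\<lambda>n. ?x n i) \<longlonglongrightarrow> a"
    by (simp add: Cauchy_convergent_iff convergent_def)
  then obtain l where l: "(\<lambda>n. ?x n i) \<longlonglongrightarrow> l i" for i
    using choice[of "\<lambda>i a. (\<lambda>n. ?x n i) \<longlonglongrightarrow> a"] by blast
  have key: "\<exists>M. \<forall>n\<ge>M. \<forall>F. finite F \<longrightarrow> (\<Sum>i\<in>F. (cmod (?x n i - l i))\<^sup>2) \<le> e\<^sup>2"
    if "0 < e" for e :: real
  proof -
    obtain M where M: "dist (X m) (X n) < e" if "m \<ge> M" "n \<ge> M" for m n
      using metric_CauchyD[OF assms \<open>0 < e\<close>] by blast
    have "(\<Sum>i\<in>F. (cmod (?x n i - l i))\<^sup>2) \<le> e\<^sup>2" if n: "n \<ge> M" and F: "finite F" for n F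
    proof (rule LIMSEQ_le_const2)
      show "(\<lambda>m. \<Sum>i\<in>F. (cmod (?x n i - ?x m i))\<^sup>2) \<longlonglongrightarrow> (\<Sum>i\<in>F. (cmod (?x n i - l i))\<^sup>2)"
        by (intro tendsto_intros l)
      have "(\<Sum>i\<in>F. (cmod (?x n i - ?x m i))\<^sup>2) \<le> e\<^sup>2" if "m \<ge> M" for m
      proof -
        have "(\<Sum>i\<in>F. (cmod (?x n i - ?x m i))\<^sup>2) \<le> (norm (X n - X m))\<^sup>2"
          using sum_le_norm_ell2_sq[OF F, of "X n - X m"] by (simp add: minus_ell2.rep_eq)
        also have "\<dots> \<le> e\<^sup>2"
          using M[OF n that] by (simp add: dist_norm power_mono less_imp_le)
        finally show ?thesis .
      qed
      then show "\<exists>N. \<forall>m\<ge>N. (\<Sum>i\<in>F. (cmod (?x n i - ?x m i))\<^sup>2) \<le> e\<^sup>2"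
        by blast
    qed
    then show ?thesis by blast
  qed
  have summ: "(\<lambda>i. (cmod (?x n i - l i))\<^sup>2) summable_on UNIV"
    if "\<forall>F. finite F \<longrightarrow> (\<Sum>i\<in>F. (cmod (?x n i - l i))\<^sup>2) \<le> e\<^sup>2" for n and e :: real
    by (rule nonneg_bdd_above_summable_on) (use that in \<open>auto simp: bdd_above_def\<close>)
  obtain M where M: "\<forall>F. finite F \<longrightarrow> (\<Sum>i\<in>F. (cmod (?x M i - l i))\<^sup>2) \<le> 1\<^sup>2"
    using key[of 1] by auto
  have "(\<lambda>i. (cmod (?x M i + - (?x M i - l i)))\<^sup>2) summable_on UNIV"
    by (rule sq_summable_add) (use Rep_ell2[of "X M"] summ[OF M] in \<open>auto simp: norm_minus_commute\<close>)
  then have l_in: "Rep_ell2 (Abs_ell2 l) = l"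
    by (simp add: Abs_ell2_inverse)
  have "X \<longlonglongrightarrow> Abs_ell2 l"
  proof (rule LIMSEQ_I)
    fix e :: real assume "0 < e"
    then obtain N where N: "\<forall>n\<ge>N. \<forall>F. finite F \<longrightarrow> (\<Sum>i\<in>F. (cmod (?x n i - l i))\<^sup>2) \<le> (e/2)\<^sup>2"
      using key[of "e/2"] by auto
    have "norm (X n - Abs_ell2 l) < e" if "n \<ge> N" for n
    proof -
      have "(norm (X n - Abs_ell2 l))\<^sup>2 = (\<Sum>\<^sub>\<infinity>i. (cmod (?x n i - l i))\<^sup>2)"
        by (simp add: norm_ell2_sq minus_ell2.rep_eq l_in)
      also have "\<dots> \<le> (e/2)\<^sup>2"
        using N that by (intro infsum_le_finite_sums summ[of n "e/2"]) auto
      finally have "norm (X n - Abs_ell2 l) \<le> e/2"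
        using \<open>0 < e\<close> by (simp add: power2_le_iff_abs_le)
      then show ?thesis
        using \<open>0 < e\<close> by simp
    qed
    then show "\<exists>N. \<forall>n\<ge>N. norm (X n - Abs_ell2 l) < e" by blast
  qed
  then show ?thesis
    by (auto simp: convergent_def)
qed

instantiation ell2 :: (type) chilbert_space
begin

lift_definition cinner_ell2 :: "'a ell2 \<Rightarrow> 'a ell2 \<Rightarrow> complex" is
  "\<lambda>f g. \<Sum>\<^sub>\<infinity>i. f i * cnj (g i)" .

instance
proof
  fix f g h :: "'a ell2" and c :: complex
  have sm: "(\<lambda>i. Rep_ell2 f i * cnj (Rep_ell2 g i)) summable_on UNIV" for f g :: "'a ell2"
    using Rep_ell2[of f] Rep_ell2[of g] by (intro sq_summable_mult) auto
  show "cinner f g = cnj (cinner g f)"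
    unfolding cinner_ell2.rep_eq
    by (simp add: infsum_cnj[symmetric] mult.commute del: infsum_cnj)
  show "cinner (f + g) h = cinner f h + cinner g h"
    unfolding cinner_ell2.rep_eq plus_ell2.rep_eq
    by (simp add: distrib_right infsum_add[OF sm sm])
  show "cinner (c *\<^sub>C f) g = c * cinner f g"
    unfolding cinner_ell2.rep_eq scaleC_ell2.rep_eq
    by (simp add: mult.assoc infsum_cmult_right[OF sm])
  show "Re (cinner f g) = inner f g"
    unfolding cinner_ell2.rep_eq inner_ell2.rep_eq ..
qed (rule ell2_complete)

end

section \<open>Operator algebras\<close>

type_synonym 'h op = "'h \<Rightarrow>\<^sub>L 'h"

text \<open>
  \<open>bops H\<close> is \<open>B(H)\<close> for a closed subspace \<open>H\<close> of the ambient Hilbert space: an operator on \<open>H\<close>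
  is identified with its extension by zero to the orthogonal complement.  The library type
  \<^typ>\<open>'h op\<close> contains all bounded real-linear maps, hence the first condition.
  In particular \<open>bops UNIV\<close> is the algebra of all bounded operators on \<^typ>\<open>'h\<close>.
\<close>

definition bops :: "'h::chilbert_space set \<Rightarrow> 'h op set" where
  "bops H = {T. (\<forall>c x. blinfun_apply T (c *\<^sub>C x) = c *\<^sub>C blinfun_apply T x) \<and>
                range (blinfun_apply T) \<subseteq> H \<and>
                (\<forall>x. (\<forall>y\<in>H. cinner x y = 0) \<longrightarrow> blinfun_apply T x = 0)}"

definition adj :: "'h::chilbert_space op \<Rightarrow> 'h op" where
  "adj T = (THE S. \<forall>x y. cinner (blinfun_apply T x) y = cinner x (blinfun_apply S y))"

definition unitary_op :: "'h::chilbert_space op \<Rightarrow> bool" where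
  "unitary_op u \<longleftrightarrow> u \<in> bops UNIV \<and> adj u o\<^sub>L u = id_blinfun \<and> u o\<^sub>L adj u = id_blinfun"

definition operator_algebra :: "'h::chilbert_space op set \<Rightarrow> bool" where
  "operator_algebra A \<longleftrightarrow>
     A \<subseteq> bops UNIV \<and> csubspace A \<and> (\<forall>a\<in>A. \<forall>b\<in>A. a o\<^sub>L b \<in> A) \<and> closed A"

definition cstar_algebra :: "'h::chilbert_space op set \<Rightarrow> bool" where
  "cstar_algebra C \<longleftrightarrow> operator_algebra C \<and> (\<forall>c\<in>C. adj c \<in> C)"

definition opalg_generated :: "'h::chilbert_space op set \<Rightarrow> 'h op set" where
  "opalg_generated S = \<Inter>{A. operator_algebra A \<and> S \<subseteq> A}"

definition cstar_generated :: "'h::chilbert_space op set \<Rightarrow> 'h op set" where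
  "cstar_generated S = \<Inter>{C. cstar_algebra C \<and> S \<subseteq> C}"

text \<open>
  Nets are rendered as proper filters: the net \<open>(e\<^sub>\<lambda>)\<close> corresponds to the filter generated by
  its tails.
\<close>

definition contractive_approx_unit :: "'h::chilbert_space op set \<Rightarrow> 'h op filter \<Rightarrow> bool" where
  "contractive_approx_unit A F \<longleftrightarrow>
     F \<noteq> bot \<and> (\<forall>\<^sub>F e in F. e \<in> A \<and> norm e \<le> 1) \<and>
     (\<forall>a\<in>A. ((\<lambda>e. e o\<^sub>L a) \<longlongrightarrow> a) F \<and> ((\<lambda>e. a o\<^sub>L e) \<longlongrightarrow> a) F)"

definition approx_unital :: "'h::chilbert_space op set \<Rightarrow> bool" where
  "approx_unital A \<longleftrightarrow> (\<exists>F. contractive_approx_unit A F)"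

subsection \<open>Completely contractive maps\<close>

text \<open>The norm of the operator matrix \<open>(x\<^sub>i\<^sub>j)\<close>, \<open>i, j < n\<close>, acting on the \<open>n\<close>-fold sum of the space.\<close>

definition opmat_norm :: "nat \<Rightarrow> (nat \<Rightarrow> nat \<Rightarrow> 'h::chilbert_space op) \<Rightarrow> real" where
  "opmat_norm n x =
     (SUP \<xi> \<in> {\<xi> :: nat \<Rightarrow> 'h. (\<Sum>i<n. (norm (\<xi> i))\<^sup>2) \<le> 1}.
        sqrt (\<Sum>i<n. (norm (\<Sum>j<n. blinfun_apply (x i j) (\<xi> j)))\<^sup>2))"

definition clinear_on :: "'a::complex_vector set \<Rightarrow> ('a \<Rightarrow> 'b::complex_vector) \<Rightarrow> bool" where
  "clinear_on S f \<longleftrightarrow>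
     (\<forall>x\<in>S. \<forall>y\<in>S. f (x + y) = f x + f y) \<and> (\<forall>c. \<forall>x\<in>S. f (c *\<^sub>C x) = c *\<^sub>C f x)"

definition completely_contractive ::
  "'h::chilbert_space op set \<Rightarrow> ('h op \<Rightarrow> 'k::chilbert_space op) \<Rightarrow> bool" where
  "completely_contractive A \<phi> \<longleftrightarrow> clinear_on A \<phi> \<and>
     (\<forall>n x. (\<forall>i<n. \<forall>j<n. x i j \<in> A) \<longrightarrow> opmat_norm n (\<lambda>i j. \<phi> (x i j)) \<le> opmat_norm n x)"

definition completely_isometric ::
  "'h::chilbert_space op set \<Rightarrow> ('h op \<Rightarrow> 'k::chilbert_space op) \<Rightarrow> bool" where
  "completely_isometric A \<phi> \<longleftrightarrow> clinear_on A \<phi> \<and>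
     (\<forall>n x. (\<forall>i<n. \<forall>j<n. x i j \<in> A) \<longrightarrow> opmat_norm n (\<lambda>i j. \<phi> (x i j)) = opmat_norm n x)"

definition algebra_hom ::
  "'h::chilbert_space op set \<Rightarrow> ('h op \<Rightarrow> 'k::chilbert_space op) \<Rightarrow> bool" where
  "algebra_hom A \<phi> \<longleftrightarrow> clinear_on A \<phi> \<and> (\<forall>a\<in>A. \<forall>b\<in>A. \<phi> (a o\<^sub>L b) = \<phi> a o\<^sub>L \<phi> b)"

definition star_hom ::
  "'h::chilbert_space op set \<Rightarrow> ('h op \<Rightarrow> 'k::chilbert_space op) \<Rightarrow> bool" where
  "star_hom C \<phi> \<longleftrightarrow> algebra_hom C \<phi> \<and> (\<forall>c\<in>C. \<phi> (adj c) = adj (\<phi> c))"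

definition star_isomorphic ::
  "'h::chilbert_space op set \<Rightarrow> 'k::chilbert_space op set \<Rightarrow> bool" where
  "star_isomorphic C D \<longleftrightarrow> (\<exists>\<phi>. star_hom C \<phi> \<and> bij_betw \<phi> C D)"

subsection \<open>Covers and the envelope\<close>

definition cstar_cover ::
  "'h::chilbert_space op set \<Rightarrow> 'k::chilbert_space op set \<Rightarrow> ('h op \<Rightarrow> 'k op) \<Rightarrow> bool" where
  "cstar_cover A C j \<longleftrightarrow>
     cstar_algebra C \<and> algebra_hom A j \<and> completely_isometric A j \<and> j ` A \<subseteq> C \<and>
     C = cstar_generated (j ` A)"

text \<open>
  HOL has no quantification over types, so ``every Hilbert space'' has to be read relative to a
  universe: the type argument \<open>TYPE('u)\<close> is a Hilbert space in which the covers (below, the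
  representations) under consideration live.  Nothing is lost as soon as \<open>'u\<close> has dimension at
  least the cardinality of \<open>A\<close>, because \<open>A \<noteq> 0\<close> is a Banach space, whence every cover of \<open>A\<close>
  has the cardinality of \<open>A\<close> and a faithful representation of at most that dimension.
\<close>

definition cstar_envelope ::
  "'u::chilbert_space itself \<Rightarrow> 'h::chilbert_space op set \<Rightarrow>
   'k::chilbert_space op set \<Rightarrow> ('h op \<Rightarrow> 'k op) \<Rightarrow> bool" where
  "cstar_envelope _ A E j \<longleftrightarrow> cstar_cover A E j \<and>
     (\<forall>(C :: 'u op set) i. cstar_cover A C i \<longrightarrow>
        (\<exists>\<phi>. star_hom C \<phi> \<and> \<phi> ` C = E \<and> (\<forall>a\<in>A. \<phi> (i a) = j a)))"

subsection \<open>Maximal maps and hyperrigidity\<close>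

definition closed_csubspace :: "'h::chilbert_space set \<Rightarrow> bool" where
  "closed_csubspace H \<longleftrightarrow> csubspace H \<and> closed H"

definition essential_space ::
  "'a set \<Rightarrow> ('a \<Rightarrow> 'h::chilbert_space op) \<Rightarrow> 'h set \<Rightarrow> 'h set" where
  "essential_space A \<pi> H = closure (cspan {blinfun_apply (\<pi> a) x | a x. a \<in> A \<and> x \<in> H})"

text \<open>
  The inclusion of \<open>H\<close> into the larger space \<open>K\<close> is an isometry \<open>V\<close>, so that
  \<open>P\<^sub>H \<rho>(a)|\<^sub>H = \<pi>(a)\<close> becomes \<open>V\<^sup>* \<rho>(a) V = \<pi>(a)\<close>, tested on inner products.
\<close>

definition dilation ::
  "'a::chilbert_space op set \<Rightarrow> 'h::chilbert_space set \<Rightarrow> ('a op \<Rightarrow> 'h op) \<Rightarrow>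
   'k::chilbert_space set \<Rightarrow> ('h \<Rightarrow> 'k) \<Rightarrow> ('a op \<Rightarrow> 'k op) \<Rightarrow> bool" where
  "dilation A H \<pi> K V \<rho> \<longleftrightarrow>
     closed_csubspace K \<and> completely_contractive A \<rho> \<and> \<rho> ` A \<subseteq> bops K \<and>
     clinear_on H V \<and> (\<forall>x\<in>H. V x \<in> K \<and> norm (V x) = norm x) \<and>
     (\<forall>a\<in>A. \<forall>x\<in>H. \<forall>y\<in>H.
        cinner (blinfun_apply (\<rho> a) (V x)) (V y) = cinner (blinfun_apply (\<pi> a) x) y)"

definition reduces :: "'k::chilbert_space op set \<Rightarrow> 'k set \<Rightarrow> bool" where
  "reduces S M \<longleftrightarrow> (\<forall>T\<in>S. blinfun_apply T ` M \<subseteq> M \<and> blinfun_apply (adj T) ` M \<subseteq> M)"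

definition maximal_map ::
  "'u::chilbert_space itself \<Rightarrow> 'a::chilbert_space op set \<Rightarrow> 'h::chilbert_space set \<Rightarrow>
   ('a op \<Rightarrow> 'h op) \<Rightarrow> bool" where
  "maximal_map _ A H \<pi> \<longleftrightarrow>
     closed_csubspace H \<and> completely_contractive A \<pi> \<and> \<pi> ` A \<subseteq> bops H \<and>
     (\<forall>(K :: 'u set) V \<rho>. dilation A H \<pi> K V \<rho> \<longrightarrow> reduces (\<rho> ` A) (V ` essential_space A \<pi> H))"

definition nondegenerate_star_rep ::
  "'k::chilbert_space op set \<Rightarrow> 'h::chilbert_space set \<Rightarrow> ('k op \<Rightarrow> 'h op) \<Rightarrow> bool" where
  "nondegenerate_star_rep C H \<pi> \<longleftrightarrow>
     closed_csubspace H \<and> star_hom C \<pi> \<and> \<pi> ` C \<subseteq> bops H \<and> essential_space C \<pi> H = H"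

text \<open>
  Here \<open>(E, j)\<close> is the envelope of \<open>A\<close>, and \<open>'u\<close> is again a universe.  A representation of \<open>E\<close> is
  a direct sum of cyclic ones, and the space of a dilation of a map on \<open>H\<close> may be cut down to
  the reducing subspace generated by \<open>H\<close>, so any dimension that is infinite and at least the
  cardinality of \<open>E\<close> suffices.
\<close>

definition hyperrigid ::
  "'u::chilbert_space itself \<Rightarrow> 'h::chilbert_space op set \<Rightarrow>
   'k::chilbert_space op set \<Rightarrow> ('h op \<Rightarrow> 'k op) \<Rightarrow> bool" where
  "hyperrigid _ A E j \<longleftrightarrow>
     (\<forall>(H :: 'u set) \<pi>. nondegenerate_star_rep E H \<pi> \<longrightarrow> maximal_map TYPE('u) A H (\<lambda>a. \<pi> (j a)))"

section \<open>Dynamical systems and crossed products\<close>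

definition completely_isometric_automorphism ::
  "'h::chilbert_space op set \<Rightarrow> ('h op \<Rightarrow> 'h op) \<Rightarrow> bool" where
  "completely_isometric_automorphism A \<phi> \<longleftrightarrow>
     algebra_hom A \<phi> \<and> completely_isometric A \<phi> \<and> bij_betw \<phi> A A"

definition dynamical_system ::
  "'h::chilbert_space op set \<Rightarrow> ('g, 'm) monoid_scheme \<Rightarrow> ('g \<Rightarrow> 'h op \<Rightarrow> 'h op) \<Rightarrow> bool" where
  "dynamical_system A G \<alpha> \<longleftrightarrow>
     operator_algebra A \<and> approx_unital A \<and> group G \<and>
     (\<forall>s\<in>carrier G. completely_isometric_automorphism A (\<alpha> s)) \<and>
     (\<forall>s\<in>carrier G. \<forall>t\<in>carrier G. \<forall>a\<in>A. \<alpha> (s \<otimes>\<^bsub>G\<^esub> t) a = \<alpha> s (\<alpha> t a))"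

definition cstar_action ::
  "'k::chilbert_space op set \<Rightarrow> ('g, 'm) monoid_scheme \<Rightarrow> ('g \<Rightarrow> 'k op \<Rightarrow> 'k op) \<Rightarrow> bool" where
  "cstar_action E G \<beta> \<longleftrightarrow>
     (\<forall>s\<in>carrier G. star_hom E (\<beta> s) \<and> bij_betw (\<beta> s) E E) \<and>
     (\<forall>s\<in>carrier G. \<forall>t\<in>carrier G. \<forall>a\<in>E. \<beta> (s \<otimes>\<^bsub>G\<^esub> t) a = \<beta> s (\<beta> t a))"

text \<open>
  \<open>\<pi>\<close> is allowed to be degenerate.  This does not affect the universal norm, since the essential
  space of \<open>\<pi>\<close> reduces \<open>U\<close>, and it makes the covariant representations on smaller spaces
  available on \<^typ>\<open>'r\<close> in the form \<open>(\<pi> \<oplus> 0, U \<oplus> 1)\<close>.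
\<close>

definition covariant_rep ::
  "'k::chilbert_space op set \<Rightarrow> ('g, 'm) monoid_scheme \<Rightarrow> ('g \<Rightarrow> 'k op \<Rightarrow> 'k op) \<Rightarrow>
   ('k op \<Rightarrow> 'r::chilbert_space op) \<times> ('g \<Rightarrow> 'r op) \<Rightarrow> bool" where
  "covariant_rep E G \<beta> = (\<lambda>(\<pi>, U).
     star_hom E \<pi> \<and> \<pi> ` E \<subseteq> bops UNIV \<and>
     (\<forall>s\<in>carrier G. unitary_op (U s)) \<and>
     (\<forall>s\<in>carrier G. \<forall>t\<in>carrier G. U (s \<otimes>\<^bsub>G\<^esub> t) = U s o\<^sub>L U t) \<and>
     (\<forall>s\<in>carrier G. \<forall>a\<in>E. U s o\<^sub>L \<pi> a o\<^sub>L adj (U s) = \<pi> (\<beta> s a)))"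

text \<open>
  The direct sum \<open>\<Oplus>\<^sub>s\<^sub>\<in>\<^sub>S T\<^sub>s\<close> of a uniformly bounded family of operators on \<open>\<ell>\<^sup>2('u)\<close>, acting on
  \<open>\<ell>\<^sup>2('s \<times> 'u) = \<Oplus>\<^sub>s \<ell>\<^sup>2('u)\<close> and vanishing on the summands with \<open>s \<notin> S\<close>.
\<close>

definition direct_sum_op :: "'s set \<Rightarrow> ('s \<Rightarrow> 'u ell2 op) \<Rightarrow> ('s \<times> 'u) ell2 op" where
  "direct_sum_op S T = Blinfun (\<lambda>\<psi>. Abs_ell2 (\<lambda>(s, i).
     if s \<in> S then Rep_ell2 (blinfun_apply (T s) (Abs_ell2 (\<lambda>i. Rep_ell2 \<psi> (s, i)))) i else 0))"

type_synonym ('k, 'g, 'u) cov_pair = "('k op \<Rightarrow> 'u ell2 op) \<times> ('g \<Rightarrow> 'u ell2 op)"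

text \<open>The space of the universal covariant representation, the sum of all those on \<open>\<ell>\<^sup>2('u)\<close>.\<close>

type_synonym ('k, 'g, 'u) cov_space = "(('k, 'g, 'u) cov_pair \<times> 'u) ell2"

definition universal_rep ::
  "'u itself \<Rightarrow> 'k::chilbert_space op set \<Rightarrow> ('g, 'm) monoid_scheme \<Rightarrow> ('g \<Rightarrow> 'k op \<Rightarrow> 'k op) \<Rightarrow>
   'k op \<Rightarrow> ('k, 'g, 'u) cov_space op" where
  "universal_rep _ E G \<beta> a = direct_sum_op {p. covariant_rep E G \<beta> p} (\<lambda>(\<pi>, U). \<pi> a)"

definition universal_unitary ::
  "'u itself \<Rightarrow> 'k::chilbert_space op set \<Rightarrow> ('g, 'm) monoid_scheme \<Rightarrow> ('g \<Rightarrow> 'k op \<Rightarrow> 'k op) \<Rightarrow>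
   'g \<Rightarrow> ('k, 'g, 'u) cov_space op" where
  "universal_unitary _ E G \<beta> s = direct_sum_op {p. covariant_rep E G \<beta> p} (\<lambda>(\<pi>, U). U s)"

text \<open>
  The completion of the finite sums \<open>\<Sum> a\<^sub>g u\<^sub>g\<close>, \<open>a\<^sub>g \<in> E\<close>, in the norm
  \<open>sup \<parallel>\<Sum> \<pi>(a\<^sub>g) U\<^sub>g\<parallel>\<close> over all covariant representations \<open>(\<pi>, U)\<close>.  The covariant representations
  on \<open>\<ell>\<^sup>2('u)\<close> give this supremum whenever \<open>'u\<close> is infinite and of at least the cardinalities of
  \<open>E\<close> and of \<open>G\<close>, the bound for cyclic representations.
\<close>

definition full_crossed_product ::
  "'u itself \<Rightarrow> 'k::chilbert_space op set \<Rightarrow> ('g, 'm) monoid_scheme \<Rightarrow> ('g \<Rightarrow> 'k op \<Rightarrow> 'k op) \<Rightarrow>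
   ('k, 'g, 'u) cov_space op set" where
  "full_crossed_product u E G \<beta> = closure
     {\<Sum>g\<in>F. universal_rep u E G \<beta> (a g) o\<^sub>L universal_unitary u E G \<beta> g
       | F a. finite F \<and> F \<subseteq> carrier G \<and> a ` F \<subseteq> E}"

definition relative_crossed_product ::
  "'u itself \<Rightarrow> 'h::chilbert_space op set \<Rightarrow> ('h op \<Rightarrow> 'k op) \<Rightarrow>
   'k::chilbert_space op set \<Rightarrow> ('g, 'm) monoid_scheme \<Rightarrow> ('g \<Rightarrow> 'k op \<Rightarrow> 'k op) \<Rightarrow>
   ('k, 'g, 'u) cov_space op set" where
  "relative_crossed_product u A j E G \<beta> = opalg_generated
     {\<Sum>g\<in>F. universal_rep u E G \<beta> (j (a g)) o\<^sub>L universal_unitary u E G \<beta> g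
       | F a. finite F \<and> F \<subseteq> carrier G \<and> a ` F \<subseteq> A}"

end

theory Submission
  imports Defs "HOL-Library.Function_Algebras"
begin

text \<open>
  The inclusion of the relative crossed product \<open>\<B>\<close> into \<open>\<C> = C\<^sup>*\<^sub>e\<^sub>n\<^sub>v(A) \<rtimes> G\<close> is a
  \<open>C\<^sup>*\<close>-cover, so there is an epimorphism \<open>\<phi>\<close> of \<open>\<C>\<close> onto the envelope \<open>F\<close> of \<open>\<B>\<close>, and it has to
  be shown that every covariant representation \<open>\<sigma> = \<pi> \<rtimes> U\<close> kills the kernel of \<open>\<phi>\<close>.  As \<open>\<phi>\<close> is
  completely isometric on \<open>\<B>\<close>, Hahn-Banach extends \<open>\<phi>(b) \<mapsto> \<sigma>(b)\<close> from \<open>\<phi>(\<B>)\<close> to a completely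
  positive map \<open>\<Psi>\<close> on all operators (Arveson), which is studied through the semi-inner product
  \<open>\<langle>x \<otimes> \<xi>, y \<otimes> \<eta>\<rangle> = \<langle>\<Psi>(y\<^sup>*x) \<xi>, \<eta>\<rangle>\<close> of its Stinespring space.  Compressing to the space of \<open>\<pi>\<close> plus one
  further dimension yields a dilation of \<open>\<pi>|\<^sub>A\<close>; hyperrigidity makes it reduce, so \<open>\<Psi> \<circ> \<phi> = \<sigma>\<close> holds
  multiplicatively on \<open>C\<^sup>*\<^sub>e\<^sub>n\<^sub>v(A)\<close>.  For \<open>b = a u\<^sub>g\<close> the elements \<open>b\<^sup>*b\<close> and \<open>b b\<^sup>*\<close> lie in
  \<open>C\<^sup>*\<^sub>e\<^sub>n\<^sub>v(A)\<close>, which puts \<open>b\<close> and \<open>b\<^sup>*\<close> into the multiplicative domain of \<open>\<Psi>\<close> as well.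
  Hence \<open>\<Psi> \<circ> \<phi> = \<sigma>\<close> on \<open>\<C>\<close>, and \<open>\<phi>\<close> is injective.
\<close>

subsection \<open>Complex Hilbert spaces\<close>

text \<open>Maximality is tested only against dilations inside the universe \<open>'u ell2\<close>,
  whereas the Stinespring space of \<Psi> would be a completed quotient on another type. One extra
  dimension is enough because the failure of multiplicativity at an element a of A and a vector x is
  a single vector, the difference of \<phi>(a)x and \<pi>(a)x. An infinite \<open>'u\<close> has
  room for one more basis vector, and everything else is done on representatives, with null vectors
  of a semi-inner product in place of a quotient. Two further obstacles shape the proof. The
  algebras need not contain a unit, so a formal unit is carried along as a separate scalar and is
  sent to the projection onto the essential space M of the representation; an approximate unit moves
  the estimates back into the algebra. And \<pi> may be degenerate, so all statements are made
  relative to M. Multiplicativity is propagated in the form \<phi>(c)V = V\<sigma>(c), with V the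
  canonical map into the Stinespring space.\<close>

lemma scaleC_zero [simp]: "c *\<^sub>C (0::'a::complex_vector) = 0"
  by simp

lemma scaleC_minus_left [simp]: "(- c) *\<^sub>C x = - (c *\<^sub>C x)"
  and scaleC_minus_right [simp]: "c *\<^sub>C (- x) = - (c *\<^sub>C x)"
  and scaleC_diff_left: "(c - d) *\<^sub>C x = c *\<^sub>C x - d *\<^sub>C x"
  and scaleC_diff_right: "c *\<^sub>C (x - y) = c *\<^sub>C x - c *\<^sub>C y"
  by (simp_all add: complex_vector.scale_minus_left complex_vector.scale_minus_right
      complex_vector.scale_left_diff_distrib complex_vector.scale_right_diff_distrib)

lemmas scaleC_sum_right = complex_vector.scale_sum_right
lemmas scaleC_sum_left = complex_vector.scale_sum_left

context
  fixes x y z :: "'a::chilbert_space"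
begin

lemma cinner_add_right: "cinner x (y + z) = cinner x y + cinner x z"
  by (metis cinner_add_left cinner_commute complex_cnj_add)

lemma cinner_scaleC_right: "cinner x (c *\<^sub>C y) = cnj c * cinner x y"
  by (metis cinner_scaleC_left cinner_commute complex_cnj_mult)

lemma cinner_zero_left [simp]: "cinner 0 x = 0"
  using cinner_scaleC_left[of 0 0 x] by simp

lemma cinner_zero_right [simp]: "cinner x 0 = 0"
  using cinner_commute[of x 0] by simp

lemma cinner_minus_left [simp]: "cinner (- x) y = - cinner x y"
  using cinner_scaleC_left[of "-1" x y] by simp

lemma cinner_minus_right [simp]: "cinner x (- y) = - cinner x y"
  using cinner_scaleC_right[of "-1"] by simp

end

lemma cinner_diff_left: "cinner (x - y) z = cinner x z - cinner y z"
  and cinner_diff_right: "cinner x (y - z) = cinner x y - cinner x z"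
  for x y z :: "'a::chilbert_space"
  using cinner_add_left[of x "- y" z] cinner_add_right[of x y "- z"] by simp_all

lemma cinner_sum_left: "cinner (\<Sum>i\<in>I. f i) y = (\<Sum>i\<in>I. cinner (f i) y)"
  and cinner_sum_right: "cinner y (\<Sum>i\<in>I. f i) = (\<Sum>i\<in>I. cinner y (f i))"
  for y :: "'a::chilbert_space"
  by (induction I rule: infinite_finite_induct) (simp_all add: cinner_add_left cinner_add_right)

lemma Im_cinner: "Im (cinner x y) = inner x (\<i> *\<^sub>C y)"
  for x y :: "'a::chilbert_space"
  by (simp flip: Re_cinner add: cinner_scaleC_right)

lemma cinner_eq_Complex: "cinner x y = Complex (inner x y) (inner x (\<i> *\<^sub>C y))"
  for x y :: "'a::chilbert_space"
  by (simp add: complex_eq_iff Re_cinner Im_cinner)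

lemma inner_scaleC: "inner (c *\<^sub>C x) y = inner x (cnj c *\<^sub>C y)"
  for x y :: "'a::chilbert_space"
  by (simp flip: Re_cinner add: cinner_scaleC_right cinner_scaleC_left)

lemma norm_cinner_le: "cmod (cinner x y) \<le> norm x * norm y"
  for x y :: "'a::chilbert_space"
proof -
  \<comment> \<open>A phase that makes \<open>c * cinner x y\<close> real and nonnegative; the value
    1 in the zero case keeps its modulus 1.\<close>
  define c where "c = (if cinner x y = 0 then 1 else cnj (cinner x y) / cmod (cinner x y))"
  have "cmod c = 1" by (simp add: c_def norm_divide)
  have "c * cinner x y = cmod (cinner x y)"
    by (simp add: c_def mult.commute[of _ "cinner x y"] complex_norm_square[symmetric] power2_eq_square)
  then have "cmod (cinner x y) = Re (cinner (c *\<^sub>C x) y)"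
    by (simp add: cinner_scaleC_left)
  also have "\<dots> \<le> norm (c *\<^sub>C x) * norm y"
    by (simp add: Re_cinner norm_cauchy_schwarz)
  finally show ?thesis by (simp add: norm_scaleC \<open>cmod c = 1\<close>)
qed

lemma cinner_ext: "(\<And>y. cinner x y = cinner x' y) \<Longrightarrow> x = x'"
  for x :: "'a::chilbert_space"
  by (metis Re_cinner cinner_diff_left inner_eq_zero_iff right_minus_eq zero_complex.sel(1))

lemma cinner_ext': "(\<And>y. cinner y x = cinner y x') \<Longrightarrow> x = x'"
  for x :: "'a::chilbert_space"
  by (rule cinner_ext) (metis cinner_commute)

lemmas tendsto_scaleC_right = bounded_linear.tendsto[OF bounded_linear_scaleC]

lemma norm_diff_sq: "(norm (x - y))\<^sup>2 = (norm x)\<^sup>2 - 2 * inner x y + (norm y)\<^sup>2"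
  and norm_add_sq: "(norm (x + y))\<^sup>2 = (norm x)\<^sup>2 + 2 * inner x y + (norm y)\<^sup>2"
  for x y :: "'a::real_inner"
  by (simp_all add: power2_norm_eq_inner inner_diff inner_add inner_commute)

lemma csubspaceD:
  assumes "csubspace M"
  shows "0 \<in> M" "x \<in> M \<Longrightarrow> y \<in> M \<Longrightarrow> x + y \<in> M" "x \<in> M \<Longrightarrow> c *\<^sub>C x \<in> M"
    "x \<in> M \<Longrightarrow> - x \<in> M" "x \<in> M \<Longrightarrow> y \<in> M \<Longrightarrow> x - y \<in> M" "x \<in> M \<Longrightarrow> r *\<^sub>R x \<in> M"
  using assms complex_vector.subspace_neg[OF assms] complex_vector.subspace_diff[OF assms]
  unfolding complex_vector.subspace_def by (auto simp: scaleR_scaleC)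

lemma csubspaceI:
  assumes "0 \<in> M" "\<And>x y. x \<in> M \<Longrightarrow> y \<in> M \<Longrightarrow> x + y \<in> M" "\<And>c x. x \<in> M \<Longrightarrow> c *\<^sub>C x \<in> M"
  shows "csubspace M"
  using assms unfolding complex_vector.subspace_def by auto

lemma csubspace_sum: "csubspace M \<Longrightarrow> (\<And>i. i \<in> I \<Longrightarrow> f i \<in> M) \<Longrightarrow> (\<Sum>i\<in>I. f i) \<in> M"
  by (induction I rule: infinite_finite_induct) (auto dest: csubspaceD)

section \<open>Orthogonal projections and the Riesz representation theorem\<close>

text \<open>The parallelogram law makes a minimising sequence Cauchy: the midpoint of two
  near-optimal points lies in \<open>M\<close> and so cannot be nearer to \<open>x\<close> than the
  distance \<open>d\<close>.\<close>

lemma exists_nearest_point: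
  fixes x :: "'a::chilbert_space"
  assumes M: "csubspace M" "closed M"
  obtains y where "y \<in> M" "\<And>z. z \<in> M \<Longrightarrow> norm (x - y) \<le> norm (x - z)"
proof -
  have ne: "M \<noteq> {}" using csubspaceD(1)[OF M(1)] by auto
  define d where "d = infdist x M"
  have dle: "d \<le> norm (x - z)" if "z \<in> M" for z
    using infdist_le[OF that] by (simp add: d_def dist_norm)
  have d0: "0 \<le> d" by (simp add: d_def infdist_nonneg)
  have "\<exists>z\<in>M. norm (x - z) < d + e" if "e > 0" for e
    using ne that cInf_lessD[of "{dist x a |a. a \<in> M}" "d + e"]
    by (auto simp: d_def infdist_def dist_norm image_def Setcompr_eq_image)
  then have "\<exists>z\<in>M. norm (x - z) < d + 1 / Suc n" for n
    by simp
  then obtain Y where Y: "\<And>n. Y n \<in> M" "\<And>n. norm (x - Y n) < d + 1 / Suc n"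
    by metis
  have lim: "(\<lambda>n. norm (x - Y n)) \<longlonglongrightarrow> d"
  proof (rule tendsto_sandwich[OF _ _ tendsto_const])
    show "(\<lambda>n. d + 1 / Suc n) \<longlonglongrightarrow> d"
      using tendsto_add[OF tendsto_const LIMSEQ_inverse_real_of_nat, of d]
      by (simp add: inverse_eq_divide add.commute)
  qed (use dle Y in \<open>auto intro!: always_eventually less_imp_le simp del: of_nat_Suc\<close>)
  have par: "(norm (Y m - Y n))\<^sup>2 \<le> 2 * (norm (x - Y m))\<^sup>2 + 2 * (norm (x - Y n))\<^sup>2 - 4 * d\<^sup>2" for m n
  proof -
    let ?z = "(1/2) *\<^sub>R (Y m + Y n)"
    have "?z \<in> M" by (intro csubspaceD[OF M(1)] Y)
    then have "d\<^sup>2 \<le> (norm (x - ?z))\<^sup>2" using dle d0 by (simp add: power_mono)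
    moreover have "(norm (Y m - Y n))\<^sup>2 = 2 * (norm (x - Y m))\<^sup>2 + 2 * (norm (x - Y n))\<^sup>2 - 4 * (norm (x - ?z))\<^sup>2"
      by (simp add: power2_norm_eq_inner inner_diff inner_add inner_commute algebra_simps)
    ultimately show ?thesis by simp
  qed
  have "Cauchy Y"
  proof (rule metric_CauchyI)
    fix e :: real assume "e > 0"
    have "(\<lambda>n. (norm (x - Y n))\<^sup>2) \<longlonglongrightarrow> d\<^sup>2" by (intro tendsto_intros lim)
    moreover have "e\<^sup>2 / 4 > 0" using \<open>e > 0\<close> by simp
    ultimately obtain N where N: "\<And>n. n \<ge> N \<Longrightarrow> dist ((norm (x - Y n))\<^sup>2) (d\<^sup>2) < e\<^sup>2 / 4"
      unfolding lim_sequentially by blast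
    have "dist (Y m) (Y n) < e" if "m \<ge> N" "n \<ge> N" for m n
    proof -
      have "(norm (x - Y m))\<^sup>2 < d\<^sup>2 + e\<^sup>2 / 4" "(norm (x - Y n))\<^sup>2 < d\<^sup>2 + e\<^sup>2 / 4"
        using N[OF that(1)] N[OF that(2)] unfolding dist_real_def by arith+
      then have "(norm (Y m - Y n))\<^sup>2 < e\<^sup>2" using par[of m n] by argo
      then show ?thesis using \<open>e > 0\<close> by (simp add: dist_norm power2_less_imp_less)
    qed
    then show "\<exists>M. \<forall>m\<ge>M. \<forall>n\<ge>M. dist (Y m) (Y n) < e" by blast
  qed
  then obtain y where y: "Y \<longlonglongrightarrow> y" using Cauchy_convergent convergent_def by blast
  have "y \<in> M" using M(2) Y(1) y closed_sequentially by blast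
  moreover have "norm (x - y) = d"
    using LIMSEQ_unique[OF _ lim] tendsto_norm[OF tendsto_diff[OF tendsto_const y]] by blast
  ultimately show ?thesis using dle that by metis
qed

lemma exists_orthogonal_projection:
  fixes x :: "'a::chilbert_space"
  assumes M: "closed_csubspace M"
  shows "\<exists>y\<in>M. \<forall>z\<in>M. cinner (x - y) z = 0"
proof -
  have M': "csubspace M" "closed M" using M by (auto simp: closed_csubspace_def)
  obtain y where y: "y \<in> M" "\<And>z. z \<in> M \<Longrightarrow> norm (x - y) \<le> norm (x - z)"
    using exists_nearest_point[OF M'] by blast
  have r: "inner (x - y) z = 0" if "z \<in> M" for z
  proof (cases "z = 0")
    case False
    \<comment> \<open>The minimiser of a quadratic polynomial: at this value the squared distance
      drops by \<open>(inner (x - y) z)\<^sup>2 / (norm z)\<^sup>2\<close>, which minimality of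
      \<open>y\<close> forces to be zero.\<close>
    define t where "t = inner (x - y) z / (norm z)\<^sup>2"
    have "(norm (x - y))\<^sup>2 \<le> (norm ((x - y) - t *\<^sub>R z))\<^sup>2"
      using y(2)[of "y + t *\<^sub>R z"] csubspaceD[OF M'(1)] y(1) that
      by (simp add: diff_diff_add power_mono)
    also have "\<dots> = (norm (x - y))\<^sup>2 - 2 * t * inner (x - y) z + t\<^sup>2 * (norm z)\<^sup>2"
      by (simp add: norm_diff_sq power_mult_distrib)
    also have "\<dots> = (norm (x - y))\<^sup>2 - (inner (x - y) z)\<^sup>2 / (norm z)\<^sup>2"
      using False by (simp add: t_def power2_eq_square)
    finally show ?thesis using False by (simp add: divide_le_0_iff)
  qed simp
  \<comment> \<open>The imaginary part is the real inner product with
    \<open>\<i> *\<^sub>C z\<close>, again an element of \<open>M\<close>.\<close>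
  have "cinner (x - y) z = 0" if "z \<in> M" for z
    using r[OF that] r[OF csubspaceD(3)[OF M'(1) that]] by (simp add: cinner_eq_Complex complex_eq_iff)
  then show ?thesis using y(1) by blast
qed

definition proj :: "'a::chilbert_space set \<Rightarrow> 'a \<Rightarrow> 'a" where
  "proj M x = (SOME y. y \<in> M \<and> (\<forall>z\<in>M. cinner (x - y) z = 0))"

context
  fixes M :: "'a::chilbert_space set"
  assumes M: "closed_csubspace M"
begin

lemma proj_in [simp]: "proj M x \<in> M"
  and proj_orth: "z \<in> M \<Longrightarrow> cinner (x - proj M x) z = 0"
  using someI_ex[OF exists_orthogonal_projection[OF M, of x, unfolded Bex_def]]
  by (auto simp: proj_def)

lemma proj_unique: "y \<in> M \<Longrightarrow> (\<And>z. z \<in> M \<Longrightarrow> cinner (x - y) z = 0) \<Longrightarrow> proj M x = y"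
proof -
  assume y: "y \<in> M" "\<And>z. z \<in> M \<Longrightarrow> cinner (x - y) z = 0"
  let ?d = "proj M x - y"
  have "?d \<in> M" using y(1) M by (auto simp: closed_csubspace_def intro: csubspaceD)
  then have "cinner ?d ?d = 0"
    using proj_orth[of ?d x] y(2)[of ?d] by (simp add: cinner_diff_left)
  then show ?thesis by (simp add: cinner_self)
qed

lemma proj_id: "x \<in> M \<Longrightarrow> proj M x = x"
  by (rule proj_unique) auto

lemma proj_zero: "(\<And>z. z \<in> M \<Longrightarrow> cinner x z = 0) \<Longrightarrow> proj M x = 0"
  by (rule proj_unique) (use M in \<open>auto simp: closed_csubspace_def intro: csubspaceD\<close>)

lemma proj_add: "proj M (x + y) = proj M x + proj M y"
proof (rule proj_unique)
  show "proj M x + proj M y \<in> M" using M by (auto simp: closed_csubspace_def intro: csubspaceD)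
  show "cinner (x + y - (proj M x + proj M y)) z = 0" if "z \<in> M" for z
    using proj_orth[OF that, of x] proj_orth[OF that, of y] by (simp add: cinner_diff_left cinner_add_left)
qed

lemma proj_scaleC: "proj M (c *\<^sub>C x) = c *\<^sub>C proj M x"
proof (rule proj_unique)
  show "c *\<^sub>C proj M x \<in> M" using M by (auto simp: closed_csubspace_def intro: csubspaceD)
  show "cinner (c *\<^sub>C x - c *\<^sub>C proj M x) z = 0" if "z \<in> M" for z
    using proj_orth[OF that, of x] by (simp add: cinner_diff_left cinner_scaleC_left)
qed

lemma cinner_proj_in: "z \<in> M \<Longrightarrow> cinner (proj M x) z = cinner x z"
  using proj_orth[of z x] by (simp add: cinner_diff_left)

lemma cinner_proj: "cinner (proj M x) y = cinner x (proj M y)"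
  by (metis cinner_commute cinner_proj_in proj_in)

lemma norm_proj_le: "norm (proj M x) \<le> norm x"
proof (cases "proj M x = 0")
  case False
  have "(norm (proj M x))\<^sup>2 = inner x (proj M x)"
    using cinner_proj_in[of "proj M x" x] by (simp add: power2_norm_eq_inner flip: Re_cinner)
  also have "\<dots> \<le> norm x * norm (proj M x)" by (rule norm_cauchy_schwarz)
  finally show ?thesis using False by (simp add: power2_eq_square)
qed simp

end

text \<open>The orthogonal complement of the kernel is the line through \<open>w\<close>, the
  component of a vector outside the kernel; \<open>f w *\<^sub>C x - f x *\<^sub>C w\<close> lies in
  the kernel, and pairing it with \<open>w\<close> solves for \<open>f x\<close>.\<close>

lemma riesz_representation:
  fixes f :: "'a::chilbert_space \<Rightarrow> complex"
  assumes add: "\<And>x y. f (x + y) = f x + f y" and scale: "\<And>c x. f (c *\<^sub>C x) = c * f x"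
    and bound: "\<And>x. cmod (f x) \<le> K * norm x"
  obtains g where "\<And>x. f x = cinner x g"
proof (cases "\<forall>x. f x = 0")
  case True
  then show ?thesis using that[of 0] by simp
next
  case False
  then obtain u where u: "f u \<noteq> 0" by blast
  have bl: "bounded_linear f"
    by (rule bounded_linear_intro[where K = K])
      (auto simp: add scale scaleR_scaleC scaleR_conv_of_real bound mult.commute)
  let ?M = "{x. f x = 0}"
  have "closed ?M"
    by (intro closed_Collect_eq linear_continuous_on bl continuous_on_const)
  then have M: "closed_csubspace ?M"
    unfolding closed_csubspace_def using scale[of 0 0] by (auto intro!: csubspaceI simp: add scale)
  define w where "w = u - proj ?M u"
  have fw: "f w \<noteq> 0" and w0: "w \<noteq> 0"
  proof -
    have "f u = f w + f (proj ?M u)" by (simp add: w_def flip: add)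
    then show "f w \<noteq> 0" using proj_in[OF M, of u] u by simp
    then show "w \<noteq> 0" using scale[of 0 0] by auto
  qed
  have orth: "cinner w z = 0" if "f z = 0" for z
    using proj_orth[OF M, of z u] that by (simp add: w_def)
  show ?thesis
  proof (rule that)
    fix x
    have "f (f w *\<^sub>C x + - f x *\<^sub>C w) = 0" using add scale by (metis add.right_inverse mult.commute mult_minus_left)
    then have "cinner w (f w *\<^sub>C x - f x *\<^sub>C w) = 0" by (intro orth) simp
    then have "cinner (f w *\<^sub>C x - f x *\<^sub>C w) w = 0" by (metis cinner_commute complex_cnj_zero)
    then have "f w * cinner x w = f x * cinner w w" by (simp add: cinner_diff_left cinner_scaleC_left)
    moreover have "cinner w w \<noteq> 0" using w0 by (simp add: cinner_self)
    ultimately have "f x = cinner x w * (f w / cinner w w)"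
      by (simp add: divide_simps mult.commute)
    then show "f x = cinner x (cnj (f w / cinner w w) *\<^sub>C w)"
      by (simp add: cinner_scaleC_right)
  qed
qed

subsection \<open>Adjoints\<close>

lemma bops_scaleC: "T \<in> bops M \<Longrightarrow> blinfun_apply T (c *\<^sub>C x) = c *\<^sub>C blinfun_apply T x"
  by (simp add: bops_def)

text \<open>Only 0 is orthogonal to the whole space, so for \<open>UNIV\<close> the range and
  support conditions are void and complex linearity remains.\<close>

lemma bops_UNIV: "T \<in> bops UNIV \<longleftrightarrow> (\<forall>c x. blinfun_apply T (c *\<^sub>C x) = c *\<^sub>C blinfun_apply T x)"
proof -
  have "x = 0" if "\<forall>y. cinner x y = 0" for x :: 'a
    by (rule cinner_ext) (use that in auto)
  then have "blinfun_apply T x = 0" if "\<forall>y\<in>UNIV. cinner x y = 0" for x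
    using that by (metis UNIV_I blinfun.zero_right)
  then show ?thesis unfolding bops_def by blast
qed

text \<open>\<open>adj\<close> is a definite description, about which nothing is known before
  existence is settled. Riesz gives the value at each \<open>y\<close>; boundedness comes from
  testing with \<open>S y\<close> itself.\<close>

lemma adj_exists:
  fixes T :: "'a::chilbert_space op"
  assumes "T \<in> bops UNIV"
  shows "\<exists>S. \<forall>x y. cinner (blinfun_apply T x) y = cinner x (blinfun_apply S y)"
proof -
  have "\<exists>g. \<forall>x. cinner (blinfun_apply T x) y = cinner x g" for y
  proof -
    have "cmod (cinner (blinfun_apply T x) y) \<le> (norm T * norm y) * norm x" for x
      using norm_cinner_le[of "blinfun_apply T x" y] mult_right_mono[OF norm_blinfun[of T x] norm_ge_zero[of y]]
      by (simp add: mult_ac)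
    then show ?thesis
      using riesz_representation[of "\<lambda>x. cinner (blinfun_apply T x) y"] assms
      by (metis bops_UNIV blinfun.add_right cinner_add_left cinner_scaleC_left)
  qed
  then obtain S where S: "\<And>x y. cinner (blinfun_apply T x) y = cinner x (S y)" by metis
  have "norm (S y) \<le> norm y * norm T" for y
  proof (cases "S y = 0")
    case False
    have "(norm (S y))\<^sup>2 = inner (blinfun_apply T (S y)) y"
      using S[of "S y" y] by (simp add: power2_norm_eq_inner flip: Re_cinner)
    also have "\<dots> \<le> norm (blinfun_apply T (S y)) * norm y" by (rule norm_cauchy_schwarz)
    also have "\<dots> \<le> (norm T * norm (S y)) * norm y" by (intro mult_right_mono norm_blinfun) auto
    finally show ?thesis using False by (simp add: power2_eq_square mult_ac)
  qed simp
  then have "bounded_linear S"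
    by (intro bounded_linear_intro[where K = "norm T"] cinner_ext')
      (simp_all flip: S add: cinner_add_right cinner_scaleC_right scaleR_scaleC)
  then have "\<forall>x y. cinner (blinfun_apply T x) y = cinner x (blinfun_apply (Blinfun S) y)"
    using S by (simp add: bounded_linear_Blinfun_apply)
  then show ?thesis ..
qed

lemma adj_unique:
  fixes T :: "'a::chilbert_space op"
  assumes "\<And>x y. cinner (blinfun_apply T x) y = cinner x (blinfun_apply S y)"
  shows "adj T = S"
  unfolding adj_def
proof (rule the_equality)
  show "S' = S" if "\<forall>x y. cinner (blinfun_apply T x) y = cinner x (blinfun_apply S' y)" for S'
    by (rule blinfun_eqI, rule cinner_ext') (use assms that in simp)
qed (use assms in auto)

lemma cinner_adj_right:
  assumes "T \<in> bops UNIV"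
  shows "cinner x (blinfun_apply (adj T) y) = cinner (blinfun_apply T x) y"
  using adj_exists[OF assms] adj_unique by metis

lemma cinner_adj_left:
  assumes "T \<in> bops UNIV"
  shows "cinner (blinfun_apply (adj T) x) y = cinner x (blinfun_apply T y)"
  using cinner_adj_right[OF assms] by (metis cinner_commute)

lemma inner_adj_right:
  assumes "T \<in> bops UNIV"
  shows "inner x (blinfun_apply (adj T) y) = inner (blinfun_apply T x) y"
  using cinner_adj_right[OF assms] by (metis Re_cinner)

lemma inner_adj_left:
  assumes "T \<in> bops UNIV"
  shows "inner (blinfun_apply (adj T) x) y = inner x (blinfun_apply T y)"
  using cinner_adj_left[OF assms] by (metis Re_cinner)

lemma adj_in_bops: "T \<in> bops UNIV \<Longrightarrow> adj T \<in> bops UNIV"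
  unfolding bops_UNIV[of "adj T"]
  by (intro allI cinner_ext) (simp add: cinner_adj_left cinner_scaleC_left)

lemma adj_adj: "T \<in> bops UNIV \<Longrightarrow> adj (adj T) = T"
  by (rule adj_unique) (simp add: cinner_adj_left)

lemma adj_compose: "S \<in> bops UNIV \<Longrightarrow> T \<in> bops UNIV \<Longrightarrow> adj (S o\<^sub>L T) = adj T o\<^sub>L adj S"
  by (rule adj_unique) (simp add: cinner_adj_right)

lemma adj_add: "S \<in> bops UNIV \<Longrightarrow> T \<in> bops UNIV \<Longrightarrow> adj (S + T) = adj S + adj T"
  by (rule adj_unique) (simp add: cinner_adj_right blinfun.bilinear_simps cinner_add_left cinner_add_right)

lemma adj_scaleC: "T \<in> bops UNIV \<Longrightarrow> adj (c *\<^sub>C T) = cnj c *\<^sub>C adj T"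
  by (rule adj_unique) (simp add: cinner_adj_right blinfun_apply_scaleC cinner_scaleC_left cinner_scaleC_right)

lemma adj_zero [simp]: "adj 0 = 0"
  by (rule adj_unique) simp

lemma norm_adj_le: "T \<in> bops UNIV \<Longrightarrow> norm (adj T) \<le> norm T"
proof (rule norm_blinfun_bound)
  fix y assume T: "T \<in> bops UNIV"
  show "norm (blinfun_apply (adj T) y) \<le> norm T * norm y"
  proof (cases "blinfun_apply (adj T) y = 0")
    case False
    let ?z = "blinfun_apply (adj T) y"
    have "(norm ?z)\<^sup>2 = inner (blinfun_apply T ?z) y"
      using inner_adj_right[OF T, of ?z y] by (simp add: power2_norm_eq_inner)
    also have "\<dots> \<le> norm (blinfun_apply T ?z) * norm y" by (rule norm_cauchy_schwarz)
    also have "\<dots> \<le> (norm T * norm ?z) * norm y" by (intro mult_right_mono norm_blinfun) auto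
    finally show ?thesis using False by (simp add: power2_eq_square mult_ac)
  qed (simp add: zero_le_mult_iff)
qed simp

lemma norm_adj: "T \<in> bops UNIV \<Longrightarrow> norm (adj T) = norm T"
  using norm_adj_le[of T] norm_adj_le[of "adj T"] adj_adj[of T] adj_in_bops[of T] by simp

lemma csubspace_bops: "csubspace (bops UNIV :: 'a::chilbert_space op set)"
  by (rule csubspaceI)
    (simp_all add: bops_UNIV blinfun.bilinear_simps scaleC_add_right blinfun_apply_scaleC scaleC_scaleC mult.commute)

lemma bops_compose: "S \<in> bops UNIV \<Longrightarrow> T \<in> bops UNIV \<Longrightarrow> S o\<^sub>L T \<in> bops UNIV"
  by (simp add: bops_UNIV)

lemma adj_diff: "S \<in> bops UNIV \<Longrightarrow> T \<in> bops UNIV \<Longrightarrow> adj (S - T) = adj S - adj T"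
  by (rule adj_unique) (simp add: cinner_adj_right blinfun.bilinear_simps cinner_diff_left cinner_diff_right)

text \<open>\<open>adj\<close> is known to be additive and isometric on the complex-linear
  operators, so continuity is asserted within them.\<close>

lemma tendsto_adj:
  assumes "(f \<longlongrightarrow> T) F" "\<forall>\<^sub>F x in F. f x \<in> bops UNIV" "T \<in> bops UNIV"
  shows "((\<lambda>x. adj (f x)) \<longlongrightarrow> adj T) F"
proof (rule tendstoI)
  fix e :: real assume "e > 0"
  from tendstoD[OF assms(1) this] assms(2)
  show "\<forall>\<^sub>F x in F. dist (adj (f x)) (adj T) < e"
  proof eventually_elim
    case (elim x)
    then show ?case
      using norm_adj[OF csubspaceD(5)[OF csubspace_bops elim(2) assms(3)]] assms(3)
      by (simp add: dist_norm adj_diff)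
  qed
qed

lemma norm_scaleC_blinfun: "norm (c *\<^sub>C T) = cmod c * norm T"
  for T :: "'a::chilbert_space op"
proof -
  have le: "norm (c *\<^sub>C T) \<le> cmod c * norm T" for c and T :: "'a op"
  proof (rule norm_blinfun_bound)
    fix x show "norm (blinfun_apply (c *\<^sub>C T) x) \<le> cmod c * norm T * norm x"
      using mult_left_mono[OF norm_blinfun[of T x] norm_ge_zero[of c]]
      by (simp add: blinfun_apply_scaleC norm_scaleC mult.assoc)
  qed simp
  show ?thesis
  proof (cases "c = 0")
    case False
    have "norm T \<le> cmod (inverse c) * norm (c *\<^sub>C T)"
      using le[of "inverse c" "c *\<^sub>C T"] False by (simp add: scaleC_scaleC)
    then have "cmod c * norm T \<le> norm (c *\<^sub>C T)"
      using False by (simp add: norm_divide field_simps)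
    then show ?thesis using le[of c T] by simp
  qed simp
qed

lemma bounded_linear_scaleC_blinfun: "bounded_linear (\<lambda>T :: 'a::chilbert_space op. c *\<^sub>C T)"
  by (rule bounded_linear_intro[where K = "cmod c"])
    (simp_all add: scaleC_add_right scaleR_scaleC scaleC_scaleC norm_scaleC_blinfun mult.commute)

lemmas tendsto_scaleC_blinfun = bounded_linear.tendsto[OF bounded_linear_scaleC_blinfun]

lemmas tendsto_compose_left = bounded_linear.tendsto[OF bounded_bilinear.bounded_linear_left[OF bounded_bilinear_blinfun_compose]]
lemmas tendsto_compose = bounded_bilinear.tendsto[OF bounded_bilinear_blinfun_compose]

lemma closed_bops: "closed (bops UNIV :: 'a::chilbert_space op set)"
proof -
  have "(bops UNIV :: 'a op set) = (\<Inter>c. \<Inter>x. {T. blinfun_apply T (c *\<^sub>C x) = c *\<^sub>C blinfun_apply T x})"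
    by (auto simp: bops_UNIV)
  moreover have "closed {T :: 'a op. blinfun_apply T (c *\<^sub>C x) = c *\<^sub>C blinfun_apply T x}" for c x
    by (intro closed_Collect_eq linear_continuous_on blinfun.bounded_linear_left
        bounded_linear_compose[OF bounded_linear_scaleC])
  ultimately show ?thesis by (simp add: closed_INT)
qed

subsection \<open>Operator algebras and their homomorphisms\<close>

instance chilbert_space \<subseteq> banach ..

context
  fixes A :: "'h::chilbert_space op set"
  assumes A: "operator_algebra A"
begin

lemma operator_algebra_bops: "a \<in> A \<Longrightarrow> a \<in> bops UNIV"
  and operator_algebra_csubspace: "csubspace A"
  and operator_algebra_closed: "closed A"
  and operator_algebra_compose: "a \<in> A \<Longrightarrow> b \<in> A \<Longrightarrow> a o\<^sub>L b \<in> A"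
  using A by (auto simp: operator_algebra_def)

lemmas operator_algebra_closures = csubspaceD[OF operator_algebra_csubspace] operator_algebra_compose

end

lemma cstar_algebraD:
  assumes "cstar_algebra C"
  shows "operator_algebra C" "c \<in> C \<Longrightarrow> adj c \<in> C"
  using assms by (auto simp: cstar_algebra_def)

context
  fixes A :: "'h::chilbert_space op set" and \<phi> :: "'h op \<Rightarrow> 'k::chilbert_space op"
  assumes h: "algebra_hom A \<phi>" and A: "csubspace A"
begin

lemma algebra_hom_add: "a \<in> A \<Longrightarrow> b \<in> A \<Longrightarrow> \<phi> (a + b) = \<phi> a + \<phi> b"
  and algebra_hom_scaleC: "a \<in> A \<Longrightarrow> \<phi> (c *\<^sub>C a) = c *\<^sub>C \<phi> a"
  and algebra_hom_compose: "a \<in> A \<Longrightarrow> b \<in> A \<Longrightarrow> \<phi> (a o\<^sub>L b) = \<phi> a o\<^sub>L \<phi> b"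
  using h by (auto simp: algebra_hom_def clinear_on_def)

lemma algebra_hom_zero: "\<phi> 0 = 0"
  using algebra_hom_scaleC[OF csubspaceD(1)[OF A], of 0] by simp

lemma algebra_hom_diff: "a \<in> A \<Longrightarrow> b \<in> A \<Longrightarrow> \<phi> (a - b) = \<phi> a - \<phi> b"
  using algebra_hom_add[of a "- b"] algebra_hom_scaleC[of b "-1"] csubspaceD[OF A] by simp

lemma algebra_hom_scaleR: "a \<in> A \<Longrightarrow> \<phi> (r *\<^sub>R a) = r *\<^sub>R \<phi> a"
  by (simp add: scaleR_scaleC algebra_hom_scaleC)

lemma algebra_hom_sum: "(\<And>i. i \<in> I \<Longrightarrow> f i \<in> A) \<Longrightarrow> \<phi> (\<Sum>i\<in>I. f i) = (\<Sum>i\<in>I. \<phi> (f i))"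
  by (induction I rule: infinite_finite_induct)
    (auto simp: algebra_hom_zero algebra_hom_add csubspace_sum[OF A])

end

subsection \<open>Operator matrices\<close>

text \<open>The inequality \<open>opmat_norm n x \<le> r\<close> for nonnegative \<open>r\<close>,
  freed from the supremum and homogeneous in the vectors, so that bounds can be multiplied
  directly.\<close>

definition mat_bound :: "nat \<Rightarrow> (nat \<Rightarrow> nat \<Rightarrow> 'h::chilbert_space op) \<Rightarrow> real \<Rightarrow> bool" where
  "mat_bound n x r \<longleftrightarrow> (\<forall>\<xi>. (\<Sum>i<n. (norm (\<Sum>j<n. blinfun_apply (x i j) (\<xi> j)))\<^sup>2)
     \<le> r\<^sup>2 * (\<Sum>i<n. (norm (\<xi> i))\<^sup>2))"

lemma mat_boundD:
  "mat_bound n x r \<Longrightarrow> (\<Sum>i<n. (norm (\<Sum>j<n. blinfun_apply (x i j) (\<xi> j)))\<^sup>2)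
     \<le> r\<^sup>2 * (\<Sum>i<n. (norm (\<xi> i))\<^sup>2)"
  by (auto simp: mat_bound_def)

lemma mat_boundI_unit:
  assumes "\<And>\<xi>. (\<Sum>i<n. (norm (\<xi> i))\<^sup>2) = 1 \<Longrightarrow>
    (\<Sum>i<n. (norm (\<Sum>j<n. blinfun_apply (x i j) (\<xi> j)))\<^sup>2) \<le> r\<^sup>2"
  shows "mat_bound n x r"
  unfolding mat_bound_def
proof
  fix \<xi> :: "nat \<Rightarrow> 'a"
  define s where "s = (\<Sum>i<n. (norm (\<xi> i))\<^sup>2)"
  show "(\<Sum>i<n. (norm (\<Sum>j<n. blinfun_apply (x i j) (\<xi> j)))\<^sup>2) \<le> r\<^sup>2 * (\<Sum>i<n. (norm (\<xi> i))\<^sup>2)"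
  proof (cases "s = 0")
    case True
    then have "\<xi> i = 0" if "i < n" for i
      using that by (auto simp: s_def sum_nonneg_eq_0_iff)
    then show ?thesis by simp
  next
    case False
    then have s: "s > 0" using sum_nonneg[of "{..<n}" "\<lambda>i. (norm (\<xi> i))\<^sup>2"] by (auto simp: s_def order.order_iff_strict)
    let ?\<eta> = "\<lambda>i. (1 / sqrt s) *\<^sub>R \<xi> i"
    have "(\<Sum>i<n. (norm (?\<eta> i))\<^sup>2) = 1"
      using s by (simp add: power_mult_distrib power_divide flip: sum_divide_distrib) (simp add: s_def)
    then have "(\<Sum>i<n. (norm (\<Sum>j<n. blinfun_apply (x i j) (?\<eta> j)))\<^sup>2) \<le> r\<^sup>2" by (rule assms)
    moreover have "(\<Sum>j<n. blinfun_apply (x i j) (?\<eta> j)) = (1 / sqrt s) *\<^sub>R (\<Sum>j<n. blinfun_apply (x i j) (\<xi> j))" for i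
      by (simp add: blinfun.scaleR_right scaleR_sum_right)
    ultimately show ?thesis
      using s by (simp add: power_mult_distrib power_divide field_simps flip: sum_divide_distrib s_def)
  qed
qed

lemma opmat_norm_le:
  assumes "mat_bound n x r" "0 \<le> r"
  shows "opmat_norm n x \<le> r"
  unfolding opmat_norm_def
proof (rule cSUP_least)
  fix \<xi> :: "nat \<Rightarrow> 'a" assume "\<xi> \<in> {\<xi>. (\<Sum>i<n. (norm (\<xi> i))\<^sup>2) \<le> 1}"
  then have "r\<^sup>2 * (\<Sum>i<n. (norm (\<xi> i))\<^sup>2) \<le> r\<^sup>2 * 1" by (intro mult_left_mono) auto
  then show "sqrt (\<Sum>i<n. (norm (\<Sum>j<n. blinfun_apply (x i j) (\<xi> j)))\<^sup>2) \<le> r"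
    using mat_boundD[OF assms(1), of \<xi>] assms(2) by (intro real_le_lsqrt) (auto intro!: sum_nonneg)
qed (auto intro!: exI[of _ "\<lambda>_. 0"])

text \<open>Crude, but it shows that the supremum in \<open>opmat_norm\<close> is taken over a
  bounded set; the constant returns in \<open>matrix_positive\<close>, where its size does not
  matter.\<close>

lemma mat_bound_crude: "mat_bound n x (\<Sum>i<n. \<Sum>j<n. norm (x i j))"
  unfolding mat_bound_def
proof
  fix \<xi> :: "nat \<Rightarrow> 'a"
  define s where "s = (\<Sum>i<n. (norm (\<xi> i))\<^sup>2)"
  have s0: "0 \<le> s" by (simp add: s_def sum_nonneg)
  have le: "norm (\<xi> j) \<le> sqrt s" if "j < n" for j
  proof (rule real_le_rsqrt)
    show "(norm (\<xi> j))\<^sup>2 \<le> s"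
      unfolding s_def by (rule member_le_sum[of j]) (use that in auto)
  qed
  let ?c = "\<lambda>i. \<Sum>j<n. norm (x i j)"
  have "norm (\<Sum>j<n. blinfun_apply (x i j) (\<xi> j)) \<le> ?c i * sqrt s" for i
  proof -
    have "norm (\<Sum>j<n. blinfun_apply (x i j) (\<xi> j)) \<le> (\<Sum>j<n. norm (x i j) * sqrt s)"
    proof (rule sum_norm_le)
      fix j assume "j \<in> {..<n}"
      then show "norm (blinfun_apply (x i j) (\<xi> j)) \<le> norm (x i j) * sqrt s"
        using norm_blinfun[of "x i j" "\<xi> j"] mult_left_mono[OF le[of j] norm_ge_zero[of "x i j"]] by simp
    qed
    then show ?thesis by (simp add: sum_distrib_right)
  qed
  then have "(norm (\<Sum>j<n. blinfun_apply (x i j) (\<xi> j)))\<^sup>2 \<le> (?c i)\<^sup>2 * s" for i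
    using power_mono[of _ "?c i * sqrt s" 2] s0 by (fastforce simp: power_mult_distrib)
  then have "(\<Sum>i<n. (norm (\<Sum>j<n. blinfun_apply (x i j) (\<xi> j)))\<^sup>2) \<le> (\<Sum>i<n. (?c i)\<^sup>2) * s"
    by (simp add: sum_distrib_right sum_mono)
  also have "\<dots> \<le> (\<Sum>i<n. ?c i)\<^sup>2 * s"
  proof (intro mult_right_mono s0)
    have c0: "0 \<le> ?c i" for i by (simp add: sum_nonneg)
    have "(\<Sum>i<n. (?c i)\<^sup>2) \<le> (\<Sum>i<n. ?c i * (\<Sum>i<n. ?c i))"
      unfolding power2_eq_square
      by (intro sum_mono mult_left_mono c0 member_le_sum) (use c0 in auto)
    then show "(\<Sum>i<n. (?c i)\<^sup>2) \<le> (\<Sum>i<n. ?c i)\<^sup>2"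
      by (simp add: sum_distrib_right power2_eq_square)
  qed
  finally show "(\<Sum>i<n. (norm (\<Sum>j<n. blinfun_apply (x i j) (\<xi> j)))\<^sup>2)
      \<le> (\<Sum>i<n. ?c i)\<^sup>2 * (\<Sum>i<n. (norm (\<xi> i))\<^sup>2)"
    by (simp add: s_def)
qed

lemma mat_bound_opmat_norm: "mat_bound n x (opmat_norm n x)"
  and opmat_norm_nonneg: "0 \<le> opmat_norm n x"
proof -
  let ?S = "{\<xi> :: nat \<Rightarrow> 'a. (\<Sum>i<n. (norm (\<xi> i))\<^sup>2) \<le> 1}"
  let ?f = "\<lambda>\<xi>. sqrt (\<Sum>i<n. (norm (\<Sum>j<n. blinfun_apply (x i j) (\<xi> j)))\<^sup>2)"
  let ?K = "\<Sum>i<n. \<Sum>j<n. norm (x i j)"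
  have "?f \<xi> \<le> ?K" if "\<xi> \<in> ?S" for \<xi>
  proof (rule real_le_lsqrt)
    have "?K\<^sup>2 * (\<Sum>i<n. (norm (\<xi> i))\<^sup>2) \<le> ?K\<^sup>2 * 1" using that by (intro mult_left_mono) auto
    then show "(\<Sum>i<n. (norm (\<Sum>j<n. blinfun_apply (x i j) (\<xi> j)))\<^sup>2) \<le> ?K\<^sup>2"
      using mat_boundD[OF mat_bound_crude[of n x], of \<xi>] by simp
  qed (auto intro!: sum_nonneg)
  then have bdd: "bdd_above (?f ` ?S)" by (auto simp: bdd_above_def)
  have le: "?f \<xi> \<le> opmat_norm n x" if "\<xi> \<in> ?S" for \<xi>
    unfolding opmat_norm_def using that by (rule cSUP_upper[OF _ bdd])
  have "?f (\<lambda>_. 0) \<le> opmat_norm n x" by (rule le) simp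
  then show n0: "0 \<le> opmat_norm n x" by simp
  show "mat_bound n x (opmat_norm n x)"
  proof (rule mat_boundI_unit)
    fix \<xi> :: "nat \<Rightarrow> 'a" assume "(\<Sum>i<n. (norm (\<xi> i))\<^sup>2) = 1"
    then have "?f \<xi> \<le> opmat_norm n x" by (intro le) simp
    then have "(?f \<xi>)\<^sup>2 \<le> (opmat_norm n x)\<^sup>2" by (intro power_mono) (auto intro!: sum_nonneg)
    then show "(\<Sum>i<n. (norm (\<Sum>j<n. blinfun_apply (x i j) (\<xi> j)))\<^sup>2) \<le> (opmat_norm n x)\<^sup>2"
      by (simp add: sum_nonneg)
  qed
qed

lemma mat_bound_mono: "mat_bound n x r \<Longrightarrow> 0 \<le> r \<Longrightarrow> r \<le> s \<Longrightarrow> mat_bound n x s"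
  unfolding mat_bound_def
  by (meson mult_right_mono order_trans power_mono sum_nonneg zero_le_power2)

lemma mat_bound_mult:
  assumes "mat_bound n x r" "mat_bound n y s"
  shows "mat_bound n (\<lambda>i j. \<Sum>k<n. x i k o\<^sub>L y k j) (r * s)"
  unfolding mat_bound_def
proof
  fix \<xi> :: "nat \<Rightarrow> 'a"
  have "(\<Sum>j<n. blinfun_apply (\<Sum>k<n. x i k o\<^sub>L y k j) (\<xi> j))
      = (\<Sum>k<n. blinfun_apply (x i k) (\<Sum>j<n. blinfun_apply (y k j) (\<xi> j)))" for i
    by (simp add: blinfun.sum_left blinfun.sum_right) (rule sum.swap)
  then have "(\<Sum>i<n. (norm (\<Sum>j<n. blinfun_apply (\<Sum>k<n. x i k o\<^sub>L y k j) (\<xi> j)))\<^sup>2)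
      \<le> r\<^sup>2 * (\<Sum>k<n. (norm (\<Sum>j<n. blinfun_apply (y k j) (\<xi> j)))\<^sup>2)"
    using mat_boundD[OF assms(1), of "\<lambda>k. \<Sum>j<n. blinfun_apply (y k j) (\<xi> j)"] by simp
  also have "\<dots> \<le> r\<^sup>2 * (s\<^sup>2 * (\<Sum>j<n. (norm (\<xi> j))\<^sup>2))"
    by (intro mult_left_mono mat_boundD assms) auto
  finally show "(\<Sum>i<n. (norm (\<Sum>j<n. blinfun_apply (\<Sum>k<n. x i k o\<^sub>L y k j) (\<xi> j)))\<^sup>2)
      \<le> (r * s)\<^sup>2 * (\<Sum>j<n. (norm (\<xi> j))\<^sup>2)"
    by (simp add: power_mult_distrib mult.assoc)
qed

lemma mat_bound_entry:
  assumes "mat_bound n x r" "0 \<le> r" "i < n" "j < n"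
  shows "norm (x i j) \<le> r"
proof (rule norm_blinfun_bound[OF assms(2)])
  fix \<zeta> :: 'a
  let ?\<xi> = "\<lambda>k :: nat. if k = j then \<zeta> else 0"
  have e: "(\<Sum>k<n. blinfun_apply (x i k) (?\<xi> k)) = blinfun_apply (x i j) \<zeta>" for i
    using assms(4) by (simp add: if_distrib[of "blinfun_apply _"] blinfun.zero_right cong: if_cong)
  have "(norm (blinfun_apply (x i j) \<zeta>))\<^sup>2 \<le> (\<Sum>i<n. (norm (\<Sum>k<n. blinfun_apply (x i k) (?\<xi> k)))\<^sup>2)"
    unfolding e by (rule member_le_sum[of i]) (use assms in auto)
  also have "\<dots> \<le> r\<^sup>2 * (\<Sum>k<n. (norm (?\<xi> k))\<^sup>2)" by (rule mat_boundD[OF assms(1)])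
  also have "\<dots> = (r * norm \<zeta>)\<^sup>2"
    using assms(4) by (simp add: power_mult_distrib if_distrib[of norm] if_distrib[of "\<lambda>x. x\<^sup>2"] cong: if_cong)
  finally show "norm (blinfun_apply (x i j) \<zeta>) \<le> r * norm \<zeta>"
    by (rule power2_le_imp_le) (use assms(2) in simp)
qed

lemma sum_inner_le:
  "(\<Sum>i\<in>I. inner (f i) (g i)) \<le> sqrt (\<Sum>i\<in>I. (norm (f i))\<^sup>2) * sqrt (\<Sum>i\<in>I. (norm (g i))\<^sup>2)"
proof -
  have "(\<Sum>i\<in>I. inner (f i) (g i)) \<le> (\<Sum>i\<in>I. \<bar>norm (f i)\<bar> * \<bar>norm (g i)\<bar>)"
    by (intro sum_mono) (simp add: norm_cauchy_schwarz)
  also have "\<dots> \<le> L2_set (\<lambda>i. norm (f i)) I * L2_set (\<lambda>i. norm (g i)) I"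
    by (rule L2_set_mult_ineq)
  finally show ?thesis by (simp add: L2_set_def)
qed

text \<open>With \<eta> the image of \<xi> under the adjoint matrix, the norm square of \<eta> is
  \<langle>x\<eta>, \<xi>\<rangle>, at most r times the norms of \<eta> and \<xi>; cancel the norm
  of \<eta>.\<close>

lemma mat_bound_adj:
  assumes "mat_bound n x r" "0 \<le> r" "\<And>i j. i < n \<Longrightarrow> j < n \<Longrightarrow> x i j \<in> bops UNIV"
  shows "mat_bound n (\<lambda>i j. adj (x j i)) r"
  unfolding mat_bound_def
proof
  fix \<xi> :: "nat \<Rightarrow> 'a"
  define \<eta> where "\<eta> j = (\<Sum>i<n. blinfun_apply (adj (x i j)) (\<xi> i))" for j
  define a where "a = (\<Sum>j<n. (norm (\<eta> j))\<^sup>2)"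
  define b where "b = (\<Sum>j<n. (norm (\<xi> j))\<^sup>2)"
  have ab: "0 \<le> a" "0 \<le> b" by (auto simp: a_def b_def sum_nonneg)
  have "a = (\<Sum>j<n. \<Sum>i<n. inner (\<eta> j) (blinfun_apply (adj (x i j)) (\<xi> i)))"
    unfolding a_def power2_norm_eq_inner by (subst (2) \<eta>_def) (simp add: inner_sum_right)
  also have "\<dots> = (\<Sum>j<n. \<Sum>i<n. inner (blinfun_apply (x i j) (\<eta> j)) (\<xi> i))"
    by (intro sum.cong refl) (simp add: inner_adj_right assms(3))
  also have "\<dots> = (\<Sum>i<n. inner (\<Sum>j<n. blinfun_apply (x i j) (\<eta> j)) (\<xi> i))"
    by (subst sum.swap) (simp add: inner_sum_left)
  also have "\<dots> \<le> sqrt (\<Sum>i<n. (norm (\<Sum>j<n. blinfun_apply (x i j) (\<eta> j)))\<^sup>2) * sqrt b"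
    unfolding b_def by (rule sum_inner_le)
  also have "\<dots> \<le> sqrt (r\<^sup>2 * a) * sqrt b"
    unfolding a_def by (intro mult_right_mono real_sqrt_le_mono mat_boundD[OF assms(1)]) (use ab in auto)
  also have "\<dots> = r * sqrt a * sqrt b" using assms(2) by (simp add: real_sqrt_mult)
  finally have *: "sqrt a * sqrt a \<le> (r * sqrt b) * sqrt a" using ab by (simp add: mult_ac)
  have "sqrt a \<le> r * sqrt b"
  proof (cases "a = 0")
    case False
    then have "0 < sqrt a" using ab by simp
    then show ?thesis using mult_right_le_imp_le[OF *] by blast
  qed (use ab assms in simp)
  then have "(sqrt a)\<^sup>2 \<le> (r * sqrt b)\<^sup>2" using ab by (intro power_mono) auto
  then have "a \<le> r\<^sup>2 * b" using ab by (simp add: power_mult_distrib)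
  then show "(\<Sum>i<n. (norm (\<Sum>j<n. blinfun_apply (adj (x j i)) (\<xi> j)))\<^sup>2) \<le> r\<^sup>2 * (\<Sum>i<n. (norm (\<xi> i))\<^sup>2)"
    by (simp add: a_def b_def \<eta>_def)
qed

lemma completely_isometric_mat_bound:
  assumes "completely_isometric A \<phi>" "\<And>i j. i < n \<Longrightarrow> j < n \<Longrightarrow> x i j \<in> A" "0 \<le> r"
  shows "mat_bound n (\<lambda>i j. \<phi> (x i j)) r \<longleftrightarrow> mat_bound n x r"
proof -
  have e: "opmat_norm n (\<lambda>i j. \<phi> (x i j)) = opmat_norm n x"
    using assms by (auto simp: completely_isometric_def)
  show ?thesis
    using mat_bound_opmat_norm[of n x] mat_bound_opmat_norm[of n "\<lambda>i j. \<phi> (x i j)"]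
      opmat_norm_le[of n x r] opmat_norm_le[of n "\<lambda>i j. \<phi> (x i j)" r]
      opmat_norm_nonneg[of n x] mat_bound_mono assms(3) e by metis
qed

lemma mat_bound_single: "0 \<le> r \<Longrightarrow> mat_bound 1 (\<lambda>i j. T) r \<longleftrightarrow> norm T \<le> r"
proof
  show "0 \<le> r \<Longrightarrow> mat_bound 1 (\<lambda>i j. T) r \<Longrightarrow> norm T \<le> r"
    using mat_bound_entry[of 1 "\<lambda>i j. T" r 0 0] by simp
  assume "0 \<le> r" "norm T \<le> r"
  then have "norm (blinfun_apply T x) \<le> r * norm x" for x
    using norm_blinfun[of T x] mult_right_mono[of "norm T" r "norm x"] by simp
  then have "(norm (blinfun_apply T x))\<^sup>2 \<le> r\<^sup>2 * (norm x)\<^sup>2" for x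
    using power_mono[of "norm (blinfun_apply T x)" "r * norm x" 2] by (simp add: power_mult_distrib)
  then show "mat_bound 1 (\<lambda>i j. T) r" by (simp add: mat_bound_def)
qed

lemma completely_isometric_norm:
  assumes "completely_isometric A \<phi>" "a \<in> A"
  shows "norm (\<phi> a) = norm a"
  using completely_isometric_mat_bound[OF assms(1), of 1 "\<lambda>i j. a"] assms(2)
    mat_bound_single[of _ a] mat_bound_single[of _ "\<phi> a"]
  by (metis norm_ge_zero order_antisym order_refl)

subsection \<open>Star homomorphisms are completely contractive\<close>

text \<open>The equation says (1 - y)^2 = 1 - x^2, so 1 - y plays the square root of 1 - x^2; it is
  written without 1 because \<open>C\<close> need not contain it. The root is the fixed point of y
  \<mapsto> (x^2 + y^2)/2, a contraction of a ball of selfadjoint elements.\<close>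

lemma self_adjoint_root:
  fixes C :: "'h::chilbert_space op set"
  assumes C: "cstar_algebra C" and x: "x \<in> C" "adj x = x" "norm x < 1"
  obtains y where "y \<in> C" "adj y = y" "2 *\<^sub>R y = (x o\<^sub>L x) + (y o\<^sub>L y)"
proof -
  note [simp] = cstar_algebraD[OF C]
  note cl = operator_algebra_closures[OF cstar_algebraD(1)[OF C]]
  note bo = operator_algebra_bops[OF cstar_algebraD(1)[OF C]]
  \<comment> \<open>This radius works twice: (r + r^2)/2 \<le> r keeps the ball invariant, and
    \<open>r\<close> is a Lipschitz constant of \<open>f\<close> on it.\<close>
  define r where "r = (norm x)\<^sup>2"
  have r: "0 \<le> r" "r < 1" using x by (auto simp: r_def power_less_one_iff)
  define S where "S = {y \<in> C. adj y = y \<and> norm y \<le> r}"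
  define f where "f y = (1/2) *\<^sub>R ((x o\<^sub>L x) + (y o\<^sub>L y))" for y
  have "closed S"
    unfolding closed_sequential_limits
  proof (intro allI impI, elim conjE)
    fix X l assume X: "\<forall>n. X n \<in> S" "X \<longlonglongrightarrow> l"
    have lC: "l \<in> C"
      using closed_sequentially[OF operator_algebra_closed[OF cstar_algebraD(1)[OF C]] _ X(2)] X(1)
      by (auto simp: S_def)
    have 1: "(\<lambda>n. adj (X n)) \<longlonglongrightarrow> adj l"
      by (rule tendsto_adj[OF X(2)]) (use X(1) lC bo in \<open>auto simp: S_def\<close>)
    have 2: "(\<lambda>n. adj (X n)) = X" using X(1) by (auto simp: S_def)
    have "adj l = l" by (rule LIMSEQ_unique[OF 1[unfolded 2] X(2)])
    moreover have "norm l \<le> r"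
      by (rule LIMSEQ_le_const2[OF tendsto_norm[OF X(2)]]) (use X(1) in \<open>simp add: S_def\<close>)
    ultimately show "l \<in> S" using lC by (simp add: S_def)
  qed
  then have cS: "complete S" by (simp add: complete_eq_closed)
  have zS: "0 \<in> S" using cl(1) r by (simp add: S_def)
  have fS: "f y \<in> S" if "y \<in> S" for y
  proof -
    have y: "y \<in> C" "adj y = y" "norm y \<le> r" using that by (auto simp: S_def)
    have "adj (f y) = f y"
      using x y bo by (simp add: f_def scaleR_scaleC adj_scaleC adj_add adj_compose cl)
    moreover have "norm (f y) \<le> r"
    proof -
      have "norm (y o\<^sub>L y) \<le> r * r"
        using norm_blinfun_compose[of y y] mult_mono[OF y(3) y(3)] r by simp
      moreover have "norm (x o\<^sub>L x) \<le> r"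
        using norm_blinfun_compose[of x x] by (simp add: r_def power2_eq_square)
      moreover have "r * r \<le> r" using r mult_left_le[of r r] by simp
      ultimately show ?thesis
        using norm_triangle_ineq[of "x o\<^sub>L x" "y o\<^sub>L y"] by (simp add: f_def)
    qed
    ultimately show ?thesis using x y by (simp add: S_def f_def cl)
  qed
  have lip: "dist (f y) (f z) \<le> r * dist y z" if "y \<in> S" "z \<in> S" for y z
  proof -
    have "f y - f z = (1/2) *\<^sub>R ((y o\<^sub>L (y - z)) + ((y - z) o\<^sub>L z))"
      by (rule blinfun_eqI) (simp add: f_def blinfun.bilinear_simps algebra_simps)
    moreover have "norm (y o\<^sub>L (y - z)) \<le> r * norm (y - z)"
      using norm_blinfun_compose[of y "y - z"] mult_right_mono[of "norm y" r "norm (y - z)"] that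
      by (auto simp: S_def)
    moreover have "norm ((y - z) o\<^sub>L z) \<le> r * norm (y - z)"
      using norm_blinfun_compose[of "y - z" z] mult_left_mono[of "norm z" r "norm (y - z)"] that
      by (auto simp: S_def mult.commute)
    ultimately show ?thesis
      using norm_triangle_ineq[of "y o\<^sub>L (y - z)" "(y - z) o\<^sub>L z"] by (simp add: dist_norm)
  qed
  have "\<exists>!y\<in>S. f y = y"
    by (rule Banach_fix[OF cS _ r(1) r(2) _ lip]) (use zS fS in auto)
  then obtain y where y: "y \<in> S" "f y = y" by blast
  have "2 *\<^sub>R y = 2 *\<^sub>R f y" using y(2) by simp
  also have "\<dots> = (x o\<^sub>L x) + (y o\<^sub>L y)" by (simp add: f_def)
  finally show ?thesis using that y(1) by (auto simp: S_def)
qed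

locale star_representation =
  fixes C :: "'h::chilbert_space op set" and \<pi> :: "'h op \<Rightarrow> 'k::chilbert_space op"
  assumes C: "cstar_algebra C" and star_hom: "star_hom C \<pi>" and into_bops: "\<pi> ` C \<subseteq> bops UNIV"
begin

lemma algebra: "operator_algebra C"
  by (rule cstar_algebraD(1)[OF C])

lemmas closures = operator_algebra_closures[OF algebra] cstar_algebraD(2)[OF C]
lemmas in_bops = operator_algebra_bops[OF algebra]

lemma hom: "algebra_hom C \<pi>"
  using star_hom by (simp add: star_hom_def)

lemmas hom_simps = algebra_hom_add[OF hom operator_algebra_csubspace[OF algebra]]
  algebra_hom_scaleC[OF hom operator_algebra_csubspace[OF algebra]]
  algebra_hom_compose[OF hom operator_algebra_csubspace[OF algebra]]
  algebra_hom_zero[OF hom operator_algebra_csubspace[OF algebra]]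
  algebra_hom_diff[OF hom operator_algebra_csubspace[OF algebra]]
  algebra_hom_scaleR[OF hom operator_algebra_csubspace[OF algebra]]
  algebra_hom_sum[OF hom operator_algebra_csubspace[OF algebra]]

lemma hom_adj: "c \<in> C \<Longrightarrow> \<pi> (adj c) = adj (\<pi> c)"
  using star_hom by (simp add: star_hom_def)

lemma rep_bops: "c \<in> C \<Longrightarrow> \<pi> c \<in> bops UNIV"
  using into_bops by auto

text \<open>Applying \<pi> to the equation of \<open>self_adjoint_root\<close> turns the norm square
  of \<xi> - \<pi>(y)\<xi> into the difference of the norm squares of \<xi> and \<pi>(x)\<xi>, which
  is therefore nonnegative.\<close>

lemma self_adjoint_contractive:
  assumes x: "x \<in> C" "adj x = x" "norm x < 1"
  shows "norm (blinfun_apply (\<pi> x) \<xi>) \<le> norm \<xi>"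
proof -
  obtain y where y: "y \<in> C" "adj y = y" "2 *\<^sub>R y = (x o\<^sub>L x) + (y o\<^sub>L y)"
    using self_adjoint_root[OF C x] by blast
  have "2 *\<^sub>R \<pi> y = \<pi> (2 *\<^sub>R y)" using y(1) by (simp add: hom_simps)
  also have "\<dots> = (\<pi> x o\<^sub>L \<pi> x) + (\<pi> y o\<^sub>L \<pi> y)" using x y(1) by (simp add: y(3) hom_simps closures)
  finally have "blinfun_apply (2 *\<^sub>R \<pi> y) \<xi> = blinfun_apply ((\<pi> x o\<^sub>L \<pi> x) + (\<pi> y o\<^sub>L \<pi> y)) \<xi>" by simp
  then have e: "2 *\<^sub>R blinfun_apply (\<pi> y) \<xi> = blinfun_apply (\<pi> x) (blinfun_apply (\<pi> x) \<xi>)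
      + blinfun_apply (\<pi> y) (blinfun_apply (\<pi> y) \<xi>)"
    by (simp add: blinfun.bilinear_simps)
  have sq: "inner \<xi> (blinfun_apply (\<pi> z) (blinfun_apply (\<pi> z) \<xi>)) = (norm (blinfun_apply (\<pi> z) \<xi>))\<^sup>2"
    if "z \<in> C" "adj z = z" for z
    using inner_adj_right[OF rep_bops[OF that(1)], of \<xi> "blinfun_apply (\<pi> z) \<xi>"] hom_adj[OF that(1)] that(2)
    by (simp add: power2_norm_eq_inner)
  have "2 * inner \<xi> (blinfun_apply (\<pi> y) \<xi>)
      = (norm (blinfun_apply (\<pi> x) \<xi>))\<^sup>2 + (norm (blinfun_apply (\<pi> y) \<xi>))\<^sup>2"
    using arg_cong[OF e, of "inner \<xi>"] by (simp add: inner_add_right sq x y)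
  then have "(norm (\<xi> - blinfun_apply (\<pi> y) \<xi>))\<^sup>2 = (norm \<xi>)\<^sup>2 - (norm (blinfun_apply (\<pi> x) \<xi>))\<^sup>2"
    by (simp add: norm_diff_sq)
  then have "(norm (blinfun_apply (\<pi> x) \<xi>))\<^sup>2 \<le> (norm \<xi>)\<^sup>2"
    using zero_le_power2[of "norm (\<xi> - blinfun_apply (\<pi> y) \<xi>)"] by linarith
  then show ?thesis by (rule power2_le_imp_le) simp
qed

text \<open>The norm square of \<pi>(a)\<xi> is the pairing of \<xi> with the image of
  \<open>adj a o\<^sub>L a\<close>, and this element divided by t^2 is a selfadjoint strict
  contraction for every t > norm a; strictness is what the preceding lemma asks for.\<close>

lemma contractive:
  assumes a: "a \<in> C"
  shows "norm (\<pi> a) \<le> norm a"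
proof (rule dense_ge)
  fix t assume t: "norm a < t"
  have t0: "0 < t" using t norm_ge_zero[of a] by linarith
  show "norm (\<pi> a) \<le> t"
  proof (rule norm_blinfun_bound)
    fix \<xi>
    define x where "x = (1 / t\<^sup>2) *\<^sub>R (adj a o\<^sub>L a)"
    have ax: "adj a o\<^sub>L a = t\<^sup>2 *\<^sub>R x" using t0 by (simp add: x_def)
    have x: "x \<in> C" "adj x = x"
      using a in_bops closures by (simp_all add: x_def scaleR_scaleC adj_scaleC adj_compose adj_adj adj_in_bops bops_compose)
    have "norm (adj a o\<^sub>L a) \<le> norm a * norm a"
      using norm_blinfun_compose[of "adj a" a] norm_adj[OF in_bops[OF a]] by simp
    also have "\<dots> < t\<^sup>2" using t by (simp add: power2_eq_square mult_strict_mono')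
    finally have "norm x < 1" using t0 by (simp add: x_def)
    have "(norm (blinfun_apply (\<pi> a) \<xi>))\<^sup>2 = inner \<xi> (blinfun_apply (\<pi> (adj a o\<^sub>L a)) \<xi>)"
      using inner_adj_right[OF rep_bops[OF a]] a closures by (simp add: hom_simps hom_adj power2_norm_eq_inner)
    also have "\<dots> = t\<^sup>2 * inner \<xi> (blinfun_apply (\<pi> x) \<xi>)"
      using x by (simp add: ax hom_simps blinfun.bilinear_simps)
    also have "\<dots> \<le> t\<^sup>2 * (norm \<xi> * norm (blinfun_apply (\<pi> x) \<xi>))"
      by (intro mult_left_mono norm_cauchy_schwarz) auto
    also have "\<dots> \<le> t\<^sup>2 * (norm \<xi> * norm \<xi>)"
      by (intro mult_left_mono self_adjoint_contractive x \<open>norm x < 1\<close>) auto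
    finally have "(norm (blinfun_apply (\<pi> a) \<xi>))\<^sup>2 \<le> (t * norm \<xi>)\<^sup>2"
      by (simp add: power_mult_distrib power2_eq_square mult_ac)
    then show "norm (blinfun_apply (\<pi> a) \<xi>) \<le> t * norm \<xi>"
      by (rule power2_le_imp_le) (use t0 in simp)
  qed (use t0 in simp)
qed

lemma tendsto_rep:
  assumes "(f \<longlongrightarrow> c) F" "c \<in> C" "\<forall>\<^sub>F x in F. f x \<in> C"
  shows "((\<lambda>x. \<pi> (f x)) \<longlongrightarrow> \<pi> c) F"
proof (rule tendstoI)
  fix e :: real assume "e > 0"
  from tendstoD[OF assms(1) this] assms(3)
  show "\<forall>\<^sub>F x in F. dist (\<pi> (f x)) (\<pi> c) < e"
  proof eventually_elim
    case (elim x)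
    have "norm (\<pi> (f x) - \<pi> c) \<le> norm (f x - c)"
      using contractive[of "f x - c"] elim assms(2) closures by (simp add: hom_simps)
    then show ?case using elim by (simp add: dist_norm)
  qed
qed

lemma completely_contractive_mat:
  assumes x: "\<And>i j. i < n \<Longrightarrow> j < n \<Longrightarrow> x i j \<in> C" and bd: "mat_bound n x r" and r: "0 \<le> r"
  shows "mat_bound n (\<lambda>i j. \<pi> (x i j)) r"
proof -
  text \<open>Entrywise contractivity gives the bound up to the factor \<open>n\<^sup>2\<close>; applying it to the powers
    \<open>h\<^bsup>2^m\<^esup>\<close> of the positive matrix \<open>h = x\<^sup>* x\<close> removes the factor.\<close>
  define h where "h = rec_nat (\<lambda>i j. \<Sum>k<n. adj (x k i) o\<^sub>L x k j) (\<lambda>m g i j. \<Sum>k<n. g i k o\<^sub>L g k j)"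
  have h0: "h 0 = (\<lambda>i j. \<Sum>k<n. adj (x k i) o\<^sub>L x k j)" by (simp add: h_def)
  have hS: "h (Suc m) = (\<lambda>i j. \<Sum>k<n. h m i k o\<^sub>L h m k j)" for m by (simp add: h_def)
  have hC: "h m i j \<in> C" if "i < n" "j < n" for m i j
    using that
  proof (induction m arbitrary: i j)
    case 0 then show ?case
      using x by (auto simp: h0 intro!: csubspace_sum[OF operator_algebra_csubspace[OF algebra]] closures)
  next
    case (Suc m) then show ?case
      by (auto simp: hS intro!: csubspace_sum[OF operator_algebra_csubspace[OF algebra]] closures)
  qed
  have adj_sum: "adj (\<Sum>k\<in>I. f k) = (\<Sum>k\<in>I. adj (f k))" if "\<And>k. k \<in> I \<Longrightarrow> f k \<in> bops UNIV" for I and f :: "nat \<Rightarrow> 'h op"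
    using that by (induction I rule: infinite_finite_induct) (auto simp: adj_add csubspace_sum[OF csubspace_bops])
  have hadj: "adj (h m i j) = h m j i" if "i < n" "j < n" for m i j
    using that
  proof (induction m arbitrary: i j)
    case 0
    have "adj (\<Sum>k<n. adj (x k i) o\<^sub>L x k j) = (\<Sum>k<n. adj (adj (x k i) o\<^sub>L x k j))"
      by (rule adj_sum) (use 0 x in_bops closures in auto)
    also have "\<dots> = (\<Sum>k<n. adj (x k j) o\<^sub>L x k i)"
      by (intro sum.cong refl) (use 0 x in_bops closures in \<open>simp add: adj_compose adj_adj adj_in_bops\<close>)
    finally show ?case by (simp add: h0)
  next
    case (Suc m)
    have "adj (\<Sum>k<n. h m i k o\<^sub>L h m k j) = (\<Sum>k<n. adj (h m i k o\<^sub>L h m k j))"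
      by (rule adj_sum) (use Suc.prems hC in_bops closures in auto)
    also have "\<dots> = (\<Sum>k<n. h m j k o\<^sub>L h m k i)"
      by (intro sum.cong refl) (use Suc hC in_bops in \<open>simp add: adj_compose\<close>)
    finally show ?case by (simp add: hS)
  qed
  have hbd: "mat_bound n (h m) ((r\<^sup>2) ^ (2 ^ m))" for m
  proof (induction m)
    case 0
    show ?case
      using mat_bound_mult[OF mat_bound_adj[OF bd r] bd] x in_bops by (simp add: h0 power2_eq_square)
  next
    case (Suc m)
    show ?case using mat_bound_mult[OF Suc Suc] by (simp add: hS power_add[symmetric] mult_2)
  qed
  have main: "(\<Sum>i<n. (norm (\<Sum>j<n. blinfun_apply (\<pi> (x i j)) (\<xi> j)))\<^sup>2) \<le> r\<^sup>2"
    if \<xi>: "(\<Sum>i<n. (norm (\<xi> i))\<^sup>2) = 1" for \<xi>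
  proof -
    define Q where "Q m = (\<Sum>i<n. \<Sum>j<n. inner (blinfun_apply (\<pi> (h m i j)) (\<xi> j)) (\<xi> i))" for m
    \<comment> \<open>\<open>g'\<close> is separate from \<open>g\<close> so that one computation
      serves the start, where it is the adjoint of \<open>x\<close>, and the squarings, where it is
      \<open>h m\<close> itself.\<close>
    have gram: "(\<Sum>i<n. \<Sum>j<n. inner (blinfun_apply (\<pi> (\<Sum>k<n. g' i k o\<^sub>L g k j)) (\<xi> j)) (\<xi> i))
        = (\<Sum>k<n. (norm (\<Sum>j<n. blinfun_apply (\<pi> (g k j)) (\<xi> j)))\<^sup>2)"
      if g: "\<And>i j. i < n \<Longrightarrow> j < n \<Longrightarrow> g i j \<in> C" "\<And>i j. i < n \<Longrightarrow> j < n \<Longrightarrow> g' i j = adj (g j i)" for g g'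
    proof -
      have "inner (blinfun_apply (\<pi> (\<Sum>k<n. g' i k o\<^sub>L g k j)) (\<xi> j)) (\<xi> i)
          = (\<Sum>k<n. inner (blinfun_apply (\<pi> (g k j)) (\<xi> j)) (blinfun_apply (\<pi> (g k i)) (\<xi> i)))"
        if ij: "i < n" "j < n" for i j
      proof -
        have "\<pi> (\<Sum>k<n. g' i k o\<^sub>L g k j) = (\<Sum>k<n. adj (\<pi> (g k i)) o\<^sub>L \<pi> (g k j))"
          using ij g closures by (subst hom_simps(7)) (auto simp: hom_simps hom_adj)
        then show ?thesis
          using ij g rep_bops by (simp add: blinfun.sum_left inner_sum_left inner_adj_left)
      qed
      then have "(\<Sum>i<n. \<Sum>j<n. inner (blinfun_apply (\<pi> (\<Sum>k<n. g' i k o\<^sub>L g k j)) (\<xi> j)) (\<xi> i))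
        = (\<Sum>i<n. \<Sum>j<n. \<Sum>k<n. inner (blinfun_apply (\<pi> (g k j)) (\<xi> j)) (blinfun_apply (\<pi> (g k i)) (\<xi> i)))"
        by (intro sum.cong refl) auto
      also have "\<dots> = (\<Sum>i<n. \<Sum>k<n. \<Sum>j<n. inner (blinfun_apply (\<pi> (g k j)) (\<xi> j)) (blinfun_apply (\<pi> (g k i)) (\<xi> i)))"
        by (rule sum.cong[OF refl], rule sum.swap)
      also have "\<dots> = (\<Sum>k<n. \<Sum>i<n. \<Sum>j<n. inner (blinfun_apply (\<pi> (g k j)) (\<xi> j)) (blinfun_apply (\<pi> (g k i)) (\<xi> i)))"
        by (rule sum.swap)
      also have "\<dots> = (\<Sum>k<n. (norm (\<Sum>j<n. blinfun_apply (\<pi> (g k j)) (\<xi> j)))\<^sup>2)"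
        by (simp add: power2_norm_eq_inner inner_sum_left inner_sum_right)
      finally show ?thesis .
    qed
    have Q0: "Q 0 = (\<Sum>i<n. (norm (\<Sum>j<n. blinfun_apply (\<pi> (x i j)) (\<xi> j)))\<^sup>2)"
      unfolding Q_def h0 by (rule gram) (use x in auto)
    have QS: "Q (Suc m) = (\<Sum>i<n. (norm (\<Sum>j<n. blinfun_apply (\<pi> (h m i j)) (\<xi> j)))\<^sup>2)" for m
      unfolding Q_def hS by (rule gram) (use hC hadj in auto)
    \<comment> \<open>Cauchy-Schwarz against the unit vector \<xi>: \<open>Q m\<close> is
      \<langle>H\<xi>, \<xi>\<rangle> with H the image of \<open>h m\<close>, and
      \<open>Q (Suc m)\<close> is the norm square of H\<xi>.\<close>
    have Qsq: "(Q m)\<^sup>2 \<le> Q (Suc m)" for m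
    proof -
      have "Q m = (\<Sum>i<n. inner (\<Sum>j<n. blinfun_apply (\<pi> (h m i j)) (\<xi> j)) (\<xi> i))"
        by (simp add: Q_def inner_sum_left)
      also have "\<dots> \<le> sqrt (Q (Suc m))"
        using sum_inner_le[of "\<lambda>i. \<Sum>j<n. blinfun_apply (\<pi> (h m i j)) (\<xi> j)" \<xi> "{..<n}"] \<xi> by (simp add: QS)
      finally have u: "Q m \<le> sqrt (Q (Suc m))" .
      have "- Q m = (\<Sum>i<n. inner (- (\<Sum>j<n. blinfun_apply (\<pi> (h m i j)) (\<xi> j))) (\<xi> i))"
        by (simp add: Q_def inner_sum_left sum_negf)
      also have "\<dots> \<le> sqrt (Q (Suc m))"
        using sum_inner_le[of "\<lambda>i. - (\<Sum>j<n. blinfun_apply (\<pi> (h m i j)) (\<xi> j))" \<xi> "{..<n}"] \<xi> by (simp add: QS)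
      finally have "\<bar>Q m\<bar> \<le> sqrt (Q (Suc m))" using u by simp
      then have "\<bar>Q m\<bar>\<^sup>2 \<le> (sqrt (Q (Suc m)))\<^sup>2" by (intro power_mono) auto
      moreover have "0 \<le> Q (Suc m)" by (simp add: QS sum_nonneg)
      ultimately show ?thesis by simp
    qed
    have Q0n: "0 \<le> Q m" for m
      by (cases m) (auto simp: Q0 QS sum_nonneg)
    have pow: "Q 0 ^ (2 ^ m) \<le> Q m" for m
    proof (induction m)
      case (Suc m)
      have "Q 0 ^ (2 ^ Suc m) = (Q 0 ^ (2 ^ m))\<^sup>2" by (simp add: power_mult[symmetric] mult.commute)
      also have "\<dots> \<le> (Q m)\<^sup>2" by (intro power_mono Suc) (simp add: Q0n)
      finally show ?case using Qsq[of m] by simp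
    qed simp
    have \<xi>1: "norm (\<xi> i) \<le> 1" if "i < n" for i
    proof -
      have "(norm (\<xi> i))\<^sup>2 \<le> (\<Sum>i<n. (norm (\<xi> i))\<^sup>2)" by (rule member_le_sum) (use that in auto)
      then show ?thesis using \<xi> by (simp add: power_le_one_iff abs_square_le_1)
    qed
    \<comment> \<open>The only place where the size of the matrix enters: n^2 entries, each bounded
      by contractivity of \<pi> on single elements.\<close>
    have up: "Q m \<le> real n * real n * (r\<^sup>2) ^ (2 ^ m)" for m
    proof -
      let ?R = "(r\<^sup>2) ^ (2 ^ m)"
      have "inner (blinfun_apply (\<pi> (h m i j)) (\<xi> j)) (\<xi> i) \<le> ?R" if "i < n" "j < n" for i j
      proof -
        have "inner (blinfun_apply (\<pi> (h m i j)) (\<xi> j)) (\<xi> i) \<le> norm (blinfun_apply (\<pi> (h m i j)) (\<xi> j)) * norm (\<xi> i)"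
          by (rule norm_cauchy_schwarz)
        also have "\<dots> \<le> (norm (\<pi> (h m i j)) * norm (\<xi> j)) * norm (\<xi> i)"
          by (intro mult_right_mono norm_blinfun) auto
        also have "\<dots> \<le> (?R * 1) * 1"
          using contractive[OF hC[OF that]] mat_bound_entry[OF hbd _ that, of m] \<xi>1 that
          by (intro mult_mono) (auto intro: order_trans)
        finally show ?thesis by simp
      qed
      then have "Q m \<le> (\<Sum>i<n. \<Sum>j<n. ?R)" unfolding Q_def by (intro sum_mono) auto
      then show ?thesis by (simp add: mult.assoc)
    qed
    have "Q 0 \<le> r\<^sup>2"
    proof (rule ccontr)
      assume "\<not> Q 0 \<le> r\<^sup>2"
      then have lt: "r\<^sup>2 < Q 0" by simp
      then have "0 < Q 0" using zero_le_power2[of r] by linarith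
      \<comment> \<open>If \<open>Q 0\<close> exceeded r^2, the bounds \<open>pow\<close> and
        \<open>up\<close> would give 1 \<le> n^2 q^(2^m) with q < 1 for every m.\<close>
      define q where "q = r\<^sup>2 / Q 0"
      have q: "0 \<le> q" "q < 1" using lt \<open>0 < Q 0\<close> by (auto simp: q_def)
      have "1 \<le> real n * real n * q ^ (2 ^ m)" for m
        using order_trans[OF pow[of m] up[of m]] \<open>0 < Q 0\<close> by (simp add: q_def power_divide field_simps)
      moreover have "(\<lambda>m. real n * real n * q ^ (2 ^ m)) \<longlonglongrightarrow> real n * real n * 0"
      proof (intro tendsto_intros)
        have "(\<lambda>m. q ^ m) \<longlonglongrightarrow> 0" using q by (intro LIMSEQ_power_zero) auto
        then show "(\<lambda>m. q ^ (2 ^ m)) \<longlonglongrightarrow> 0"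
          by (rule LIMSEQ_subseq_LIMSEQ[where f = "\<lambda>m. 2 ^ m", unfolded comp_def]) (simp add: strict_mono_Suc_iff)
      qed
      ultimately have "1 \<le> real n * real n * (0::real)"
        by (intro LIMSEQ_le_const) auto
      then show False by simp
    qed
    then show ?thesis by (simp add: Q0)
  qed
  show ?thesis using main by (rule mat_boundI_unit)
qed

end

subsection \<open>Sublinear functionals\<close>

text \<open>For homogeneity one inequality is enough, since scaling back by 1/c gives the other.
  Everything is relative to \<open>S\<close> because the functions to be handled form only a
  subspace.\<close>

definition sublinear_on :: "'x::real_vector set \<Rightarrow> ('x \<Rightarrow> real) \<Rightarrow> bool" where
  "sublinear_on S q \<longleftrightarrow> (\<forall>x\<in>S. \<forall>y\<in>S. q (x + y) \<le> q x + q y) \<and>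
     (\<forall>x\<in>S. \<forall>c\<ge>0. q (c *\<^sub>R x) \<le> c * q x)"

lemma sublinear_onD:
  assumes "sublinear_on S q"
  shows "x \<in> S \<Longrightarrow> y \<in> S \<Longrightarrow> q (x + y) \<le> q x + q y"
    "x \<in> S \<Longrightarrow> 0 \<le> c \<Longrightarrow> q (c *\<^sub>R x) \<le> c * q x"
  using assms by (auto simp: sublinear_on_def)

context
  fixes S :: "'x::real_vector set"
  assumes S: "subspace S"
begin

lemmas S_closures = subspace_0[OF S] subspace_add[OF S] subspace_scale[OF S] subspace_neg[OF S]
  subspace_diff[OF S]

lemma sublinear_on_zero: "sublinear_on S q \<Longrightarrow> q 0 = 0"
  using sublinear_onD(1)[of S q 0 0] sublinear_onD(2)[of S q 0 0] S_closures(1) by simp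

lemma sublinear_on_scale:
  assumes "sublinear_on S q" "x \<in> S" "0 \<le> c"
  shows "q (c *\<^sub>R x) = c * q x"
proof (cases "c = 0")
  case False
  have "q ((1 / c) *\<^sub>R c *\<^sub>R x) \<le> (1 / c) * q (c *\<^sub>R x)"
    by (rule sublinear_onD[OF assms(1)]) (use assms S_closures in auto)
  then have "c * q x \<le> q (c *\<^sub>R x)" using False assms(3) by (simp add: field_simps)
  then show ?thesis using sublinear_onD(2)[OF assms] by simp
qed (simp add: sublinear_on_zero[OF assms(1)])

lemma sublinear_on_lower:
  assumes "sublinear_on S q" "x \<in> S"
  shows "- q (- x) \<le> q x"
  using sublinear_onD(1)[OF assms(1,2), of "- x"] assms S_closures(4) sublinear_on_zero[OF assms(1)] by simp

text \<open>Hahn-Banach by minimality: Zorn yields a minimal sublinear functional below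
  \<open>p\<close>, and a minimal one is additive, because otherwise it could be lowered along a
  direction \<open>x\<close>.\<close>

theorem sublinear_dominates_linear:
  assumes p: "sublinear_on S p"
  obtains s where "\<And>x. x \<in> S \<Longrightarrow> s x \<le> p x"
    "\<And>x y. x \<in> S \<Longrightarrow> y \<in> S \<Longrightarrow> s (x + y) = s x + s y"
    "\<And>c x. x \<in> S \<Longrightarrow> s (c *\<^sub>R x) = c * s x"
proof -
  \<comment> \<open>Values off \<open>S\<close> are fixed to be 0: the order compares at all points,
    and unconstrained values would leave nothing minimal.\<close>
  define Q where "Q = {q. sublinear_on S q \<and> (\<forall>x\<in>S. q x \<le> p x) \<and> (\<forall>x. x \<notin> S \<longrightarrow> q x = 0)}"
  \<comment> \<open>Reversed, so that a maximal element in the sense of Zorn is a minimal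
    functional.\<close>
  define R where "R q q' \<longleftrightarrow> (\<forall>x. q' x \<le> q x)" for q q' :: "'x \<Rightarrow> real"
  have low: "- p (- x) \<le> q x" if "q \<in> Q" "x \<in> S" for q x
    using sublinear_on_lower[of q x] that S_closures(4)[of x] by (fastforce simp: Q_def)
  have "\<exists>m\<in>Q. \<forall>q\<in>Q. R m q \<longrightarrow> q = m"
  proof (rule predicate_Zorn)
    show "partial_order_on Q (relation_of R Q)"
      by (rule partial_order_on_relation_ofI) (auto simp: R_def intro: order_trans intro!: ext antisym)
    fix C assume "C \<in> Chains (relation_of R Q)"
    then have CQ: "C \<subseteq> Q" and chain: "\<And>a b. a \<in> C \<Longrightarrow> b \<in> C \<Longrightarrow> R a b \<or> R b a"
      by (auto simp: Chains_def relation_of_def)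
    show "\<exists>u\<in>Q. \<forall>a\<in>C. R a u"
    proof (cases "C = {}")
      case True
      have "(\<lambda>x. if x \<in> S then p x else 0) \<in> Q"
        using p S_closures by (auto simp: Q_def sublinear_on_def)
      then show ?thesis using True by blast
    next
      case False
      then obtain q0 where q0: "q0 \<in> C" by blast
      define u where "u x = (if x \<in> S then (INF q\<in>C. q x) else 0)" for x
      have bdd: "bdd_below ((\<lambda>q. q x) ` C)" if "x \<in> S" for x
        by (rule bdd_belowI[of _ "- p (- x)"]) (use low CQ that in auto)
      have ule: "u x \<le> q x" if "q \<in> C" for x q
      proof (cases "x \<in> S")
        case True
        then show ?thesis using cINF_lower[OF bdd[OF True] that] by (simp add: u_def)
      qed (use that CQ in \<open>auto simp: u_def Q_def\<close>)
      have ug: "a \<le> u x" if "x \<in> S" "\<And>q. q \<in> C \<Longrightarrow> a \<le> q x" for a x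
        using that cINF_greatest[OF False, of a "\<lambda>q. q x"] by (simp add: u_def)
      have add: "u (x + y) \<le> u x + u y" if xy: "x \<in> S" "y \<in> S" for x y
      proof -
        have "u (x + y) - u y \<le> q1 x" if q1: "q1 \<in> C" for q1
        proof -
          have "u (x + y) - q1 x \<le> q2 y" if q2: "q2 \<in> C" for q2
          proof -
            \<comment> \<open>By the chain condition \<open>q\<close> is the smaller of
              \<open>q1\<close> and \<open>q2\<close>; a single functional is needed to use
              subadditivity.\<close>
            obtain q where q: "q \<in> C" "\<And>z. q z \<le> q1 z" "\<And>z. q z \<le> q2 z"
              using chain[OF q1 q2] q1 q2 unfolding R_def by (metis order_refl)
            have "u (x + y) \<le> q x + q y"
              using ule[OF q(1), of "x + y"] q(1) CQ xy sublinear_onD(1)[of S q x y]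
              by (auto simp: Q_def)
            then show ?thesis using q(2)[of x] q(3)[of y] by linarith
          qed
          then have "u (x + y) - q1 x \<le> u y" by (rule ug[OF xy(2)])
          then show ?thesis by linarith
        qed
        then have "u (x + y) - u y \<le> u x" by (rule ug[OF xy(1)])
        then show ?thesis by linarith
      qed
      have scale: "u (c *\<^sub>R x) \<le> c * u x" if x: "x \<in> S" and c: "c \<ge> 0" for c x
      proof -
        have le: "u (c *\<^sub>R x) \<le> c * q x" if "q \<in> C" for q
          using ule[OF that, of "c *\<^sub>R x"] that CQ sublinear_onD(2)[of S q x c] x c by (fastforce simp: Q_def)
        show ?thesis
        proof (cases "c = 0")
          case False
          then have "u (c *\<^sub>R x) / c \<le> u x"
            using le c by (intro ug[OF x]) (simp add: divide_le_eq mult.commute)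
          then show ?thesis using False c by (simp add: divide_le_eq mult.commute)
        qed (use le[OF q0] in simp)
      qed
      have "u x \<le> p x" if "x \<in> S" for x
        using ule[OF q0, of x] q0 CQ that by (force simp: Q_def)
      moreover have "u x = 0" if "x \<notin> S" for x using that by (simp add: u_def)
      ultimately have "u \<in> Q" using add scale by (simp add: Q_def sublinear_on_def)
      then show ?thesis using ule by (auto simp: R_def)
    qed
  qed
  then obtain m where mQ: "m \<in> Q" and min: "\<And>q. q \<in> Q \<Longrightarrow> R m q \<Longrightarrow> q = m" by blast
  have m: "sublinear_on S m" and mp: "\<And>x. x \<in> S \<Longrightarrow> m x \<le> p x" and mS: "\<And>x. x \<notin> S \<Longrightarrow> m x = 0"
    using mQ by (auto simp: Q_def)
  have super: "m x + m y \<le> m (x + y)" if x: "x \<in> S" and y: "y \<in> S" for x y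
  proof -
    \<comment> \<open>The infimum of \<open>D z\<close> is the usual lowering of \<open>m\<close> in
      the direction \<open>x\<close>. Being sublinear it must equal \<open>m\<close>, and t = 1 then
      gives m y \<le> m (y + x) - m x.\<close>
    define D where "D z = (\<lambda>t. m (z + t *\<^sub>R x) - t * m x) ` {0..}" for z
    define q where "q z = (if z \<in> S then Inf (D z) else 0)" for z
    have bdd: "bdd_below (D z)" if z: "z \<in> S" for z
    proof (rule bdd_belowI)
      fix a assume "a \<in> D z"
      then obtain t where t: "t \<ge> 0" "a = m (z + t *\<^sub>R x) - t * m x" by (auto simp: D_def)
      have "m ((z + t *\<^sub>R x) + (- z)) \<le> m (z + t *\<^sub>R x) + m (- z)"
        by (rule sublinear_onD[OF m]) (use x z S_closures in auto)
      then show "- m (- z) \<le> a" using sublinear_on_scale[OF m x t(1)] t(2) by simp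
    qed
    have qle: "q z \<le> m (z + t *\<^sub>R x) - t * m x" if "z \<in> S" "t \<ge> 0" for z t
      using cInf_lower[OF _ bdd[OF that(1)]] that by (auto simp: q_def D_def)
    have qg: "a \<le> q z" if "z \<in> S" "\<And>t. t \<ge> 0 \<Longrightarrow> a \<le> m (z + t *\<^sub>R x) - t * m x" for a z
      using that cInf_greatest[of "D z" a] by (auto simp: q_def D_def)
    have qm: "q z \<le> m z" for z
    proof (cases "z \<in> S")
      case True
      then show ?thesis using qle[of z 0] by simp
    qed (simp add: q_def mS)
    have add: "q (z + w) \<le> q z + q w" if zw: "z \<in> S" "w \<in> S" for z w
    proof -
      have "q (z + w) - q w \<le> m (z + t *\<^sub>R x) - t * m x" if t: "t \<ge> 0" for t
      proof -
        have "q (z + w) - (m (z + t *\<^sub>R x) - t * m x) \<le> m (w + r *\<^sub>R x) - r * m x" if r: "r \<ge> 0" for r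
        proof -
          have "q (z + w) \<le> m ((z + w) + (t + r) *\<^sub>R x) - (t + r) * m x"
            by (rule qle) (use zw t r S_closures in auto)
          also have "(z + w) + (t + r) *\<^sub>R x = (z + t *\<^sub>R x) + (w + r *\<^sub>R x)"
            by (simp add: algebra_simps)
          also have "m \<dots> \<le> m (z + t *\<^sub>R x) + m (w + r *\<^sub>R x)"
            by (rule sublinear_onD[OF m]) (use x zw S_closures in auto)
          finally show ?thesis by (simp add: algebra_simps)
        qed
        then have "q (z + w) - (m (z + t *\<^sub>R x) - t * m x) \<le> q w" by (rule qg[OF zw(2)])
        then show ?thesis by linarith
      qed
      then have "q (z + w) - q w \<le> q z" by (rule qg[OF zw(1)])
      then show ?thesis by linarith
    qed
    have scale: "q (c *\<^sub>R z) \<le> c * q z" if z: "z \<in> S" and c: "c \<ge> 0" for c z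
    proof (cases "c = 0")
      case True
      then show ?thesis using qm[of 0] sublinear_on_zero[OF m] by simp
    next
      case False
      have "q (c *\<^sub>R z) / c \<le> m (z + t *\<^sub>R x) - t * m x" if t: "t \<ge> 0" for t
      proof -
        have "q (c *\<^sub>R z) \<le> m (c *\<^sub>R z + (c * t) *\<^sub>R x) - (c * t) * m x"
          by (rule qle) (use z c t S_closures in auto)
        also have "c *\<^sub>R z + (c * t) *\<^sub>R x = c *\<^sub>R (z + t *\<^sub>R x)" by (simp add: algebra_simps)
        also have "m \<dots> = c * m (z + t *\<^sub>R x)"
          by (rule sublinear_on_scale[OF m]) (use x z c S_closures in auto)
        finally have "q (c *\<^sub>R z) \<le> (m (z + t *\<^sub>R x) - t * m x) * c" by (simp add: algebra_simps)
        then show ?thesis using False c by (simp add: pos_divide_le_eq)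
      qed
      then have "q (c *\<^sub>R z) / c \<le> q z" by (rule qg[OF z])
      then show ?thesis using False c by (simp add: divide_le_eq mult.commute)
    qed
    have "q \<in> Q"
      unfolding Q_def sublinear_on_def using add scale order_trans[OF qm mp] by (auto simp: q_def)
    then have "q = m" by (rule min) (simp add: R_def qm)
    then show ?thesis using qle[OF y, of 1] by (simp add: add.commute)
  qed
  have add: "m (x + y) = m x + m y" if "x \<in> S" "y \<in> S" for x y
    using super[OF that] sublinear_onD(1)[OF m that] by simp
  have neg: "m (- x) = - m x" if "x \<in> S" for x
    using add[OF that S_closures(4)[OF that]] sublinear_on_zero[OF m] by simp
  have "m (c *\<^sub>R x) = c * m x" if x: "x \<in> S" for c x
  proof (cases "c \<ge> 0")
    case False
    then show ?thesis
      using sublinear_on_scale[OF m x, of "- c"] neg[OF S_closures(3)[OF x, of c]] by simp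
  qed (simp add: sublinear_on_scale[OF m x])
  then show ?thesis using that mp add by blast
qed

end

instantiation "fun" :: (type, real_vector) real_vector
begin

definition scaleR_fun :: "real \<Rightarrow> ('a \<Rightarrow> 'b) \<Rightarrow> 'a \<Rightarrow> 'b" where
  "scaleR_fun c f = (\<lambda>x. c *\<^sub>R f x)"

instance
  by standard (auto simp: scaleR_fun_def plus_fun_def fun_eq_iff algebra_simps)

end

subsection \<open>Extending a compression to a positive functional\<close>

text \<open>Gathers a list of formal tensors into one n-by-n matrix of operators. The family
  \<open>X\<close> stays abstract since the identity is read forwards for \<open>k\<close> with
  arbitrary vectors and backwards for \<sigma> with basis vectors.\<close>

lemma sum_list_inner_expand:
  fixes w :: "nat \<Rightarrow> 'h::chilbert_space" and X :: "'t \<Rightarrow> 'h \<Rightarrow> 'h"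
  assumes add: "\<And>t x y. t \<in> set ts \<Longrightarrow> X t (x + y) = X t x + X t y"
    and scale: "\<And>t c x. t \<in> set ts \<Longrightarrow> X t (c *\<^sub>C x) = c *\<^sub>C X t x"
  shows "(\<Sum>t\<leftarrow>ts. inner (X t (\<Sum>j<n. a t j *\<^sub>C w j)) (\<Sum>i<n. b t i *\<^sub>C w i))
    = (\<Sum>i<n. \<Sum>j<n. inner (\<Sum>t\<leftarrow>ts. (a t j * cnj (b t i)) *\<^sub>C X t (w j)) (w i))"
  using assms
proof (induction ts)
  case (Cons t ts)
  have zero: "X t 0 = 0" using Cons.prems(2)[of t 0 0] by simp
  have sum: "X t (\<Sum>j\<in>I. f j) = (\<Sum>j\<in>I. X t (f j))" for f and I :: "nat set"
    using Cons.prems(1) by (induction I rule: infinite_finite_induct) (auto simp: zero)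
  have "inner (X t (\<Sum>j<n. a t j *\<^sub>C w j)) (\<Sum>i<n. b t i *\<^sub>C w i)
      = (\<Sum>i<n. \<Sum>j<n. inner (a t j *\<^sub>C X t (w j)) (b t i *\<^sub>C w i))"
    using Cons.prems(2) by (simp add: sum inner_sum_left inner_sum_right)
  also have "\<dots> = (\<Sum>i<n. \<Sum>j<n. inner ((a t j * cnj (b t i)) *\<^sub>C X t (w j)) (w i))"
    by (simp add: inner_scaleC scaleC_scaleC mult.commute)
  finally show ?case
    using Cons by (simp add: inner_add_left sum.distrib)
qed simp

text \<open>The index \<open>v = (J, w)\<close> runs through linear maps \<open>\<xi> \<mapsto> \<Sum>\<^sub>i\<^sub>\<in>\<^sub>J \<xi>\<^sub>i w\<^sub>i\<close> from \<open>\<ell>\<^sup>2('u)\<close> to \<open>'f\<close> (zero when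
  \<open>J\<close> is infinite).  Formal tensors \<open>x \<otimes> \<xi> \<otimes> \<eta>\<close> are represented by the functions
  \<open>v \<mapsto> \<langle>x (ev v \<xi>), ev v \<eta>\<rangle>\<close>, for which sesquilinearity in \<open>\<xi>, \<eta>\<close> and the order are automatic, so that no
  tensor product has to be constructed.\<close>

definition ev :: "'u set \<times> ('u \<Rightarrow> 'f) \<Rightarrow> 'u ell2 \<Rightarrow> 'f::chilbert_space" where
  "ev v \<xi> = (\<Sum>i\<in>fst v. Rep_ell2 \<xi> i *\<^sub>C snd v i)"

lemma ev_add: "ev v (\<xi> + \<eta>) = ev v \<xi> + ev v \<eta>"
  by (simp add: ev_def plus_ell2.rep_eq scaleC_add_left sum.distrib)

lemma ev_scaleC: "ev v (c *\<^sub>C \<xi>) = c *\<^sub>C ev v \<xi>"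
  by (simp add: ev_def scaleC_ell2.rep_eq scaleC_sum_right scaleC_scaleC)

lemma ev_zero [simp]: "ev v 0 = 0"
  using ev_scaleC[of v 0 0] by simp

lemma ev_minus: "ev v (- \<xi>) = - ev v \<xi>"
  using ev_scaleC[of v "-1" \<xi>] by simp

lemma ev_diff: "ev v (\<xi> - \<eta>) = ev v \<xi> - ev v \<eta>"
  using ev_add[of v \<xi> "- \<eta>"] by (simp add: ev_minus)

section \<open>Approximation by finitely supported vectors\<close>

lift_definition ket :: "'u \<Rightarrow> 'u ell2" is "\<lambda>i j. if i = j then 1 else 0"
proof -
  fix i :: 'u
  have "(\<lambda>j. (cmod (if i = j then 1 else 0))\<^sup>2) summable_on {i}" by simp
  then show "(\<lambda>j. (cmod (if i = j then 1 else 0))\<^sup>2) summable_on UNIV"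
    by (rule summable_on_cong_neutral[THEN iffD1, rotated -1]) auto
qed

definition cutoff :: "'u set \<Rightarrow> 'u ell2 \<Rightarrow> 'u ell2" where
  "cutoff J \<xi> = (\<Sum>i\<in>J. Rep_ell2 \<xi> i *\<^sub>C ket i)"

lemma Rep_ell2_sum: "Rep_ell2 (\<Sum>i\<in>J. f i) j = (\<Sum>i\<in>J. Rep_ell2 (f i) j)"
  by (induction J rule: infinite_finite_induct) (auto simp: plus_ell2.rep_eq zero_ell2.rep_eq)

lemma Rep_cutoff: "finite J \<Longrightarrow> Rep_ell2 (cutoff J \<xi>) j = (if j \<in> J then Rep_ell2 \<xi> j else 0)"
  by (simp add: cutoff_def Rep_ell2_sum scaleC_ell2.rep_eq ket.rep_eq if_distrib[of "(*) _"] cong: if_cong)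

text \<open>By Pythagoras the squared error is the tail of a convergent sum. It reduces positivity
  on the whole space to finitely many coordinates.\<close>

lemma tendsto_cutoff: "((\<lambda>J. cutoff J \<xi>) \<longlongrightarrow> \<xi>) (finite_subsets_at_top UNIV)"
proof -
  let ?s = "\<lambda>J. \<Sum>i\<in>J. (cmod (Rep_ell2 \<xi> i))\<^sup>2"
  have sm: "(\<lambda>i. (cmod (Rep_ell2 \<xi> i))\<^sup>2) summable_on UNIV" using Rep_ell2[of \<xi>] by simp
  have e: "(norm (cutoff J \<xi> - \<xi>))\<^sup>2 = (norm \<xi>)\<^sup>2 - ?s J" if J: "finite J" for J
  proof -
    have "(norm (cutoff J \<xi> - \<xi>))\<^sup>2 = (\<Sum>\<^sub>\<infinity>i. (cmod (if i \<in> J then 0 else Rep_ell2 \<xi> i))\<^sup>2)"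
      unfolding norm_ell2_sq minus_ell2.rep_eq Rep_cutoff[OF J] by (intro infsum_cong) auto
    also have "\<dots> = (\<Sum>\<^sub>\<infinity>i\<in>UNIV - J. (cmod (Rep_ell2 \<xi> i))\<^sup>2)"
      by (rule infsum_cong_neutral) auto
    also have "\<dots> = (\<Sum>\<^sub>\<infinity>i. (cmod (Rep_ell2 \<xi> i))\<^sup>2) - (\<Sum>\<^sub>\<infinity>i\<in>J. (cmod (Rep_ell2 \<xi> i))\<^sup>2)"
      by (rule infsum_Diff) (use sm J in auto)
    finally show ?thesis using J by (simp add: norm_ell2_sq)
  qed
  have "(?s \<longlongrightarrow> (norm \<xi>)\<^sup>2) (finite_subsets_at_top UNIV)"
    using has_sum_infsum[OF sm] by (simp add: has_sum_def norm_ell2_sq)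
  then have 1: "((\<lambda>J. sqrt ((norm \<xi>)\<^sup>2 - ?s J)) \<longlongrightarrow> sqrt ((norm \<xi>)\<^sup>2 - (norm \<xi>)\<^sup>2)) (finite_subsets_at_top UNIV)"
    by (intro tendsto_intros)
  have 2: "\<forall>\<^sub>F J in finite_subsets_at_top UNIV. sqrt ((norm \<xi>)\<^sup>2 - ?s J) = norm (cutoff J \<xi> - \<xi>)"
    by (rule eventually_finite_subsets_at_top_weakI) (simp flip: e)
  have "((\<lambda>J. norm (cutoff J \<xi> - \<xi>)) \<longlongrightarrow> 0) (finite_subsets_at_top UNIV)"
    using Lim_transform_eventually[OF 1 2] by simp
  then show ?thesis unfolding tendsto_dist_iff[of _ \<xi>] dist_norm .
qed

section \<open>Functions and vector-valued functions bounded by the formal unit\<close>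

text \<open>The functions bounded by a multiple of a sum of formal tensors 1 \<otimes> \<xi>
  \<otimes> \<xi>. Such a majorant has a prescribed value, which is what makes the Hahn-Banach bound
  finite.\<close>

definition dominated :: "('u set \<times> ('u \<Rightarrow> 'f::chilbert_space) \<Rightarrow> real) set" where
  "dominated = {h. \<exists>K\<ge>0. \<exists>xs. \<forall>v. \<bar>h v\<bar> \<le> K * (\<Sum>\<xi>\<leftarrow>xs. (norm (ev v \<xi>))\<^sup>2)}"

lemma sum_list_ev_nonneg: "0 \<le> (\<Sum>\<xi>\<leftarrow>xs. (norm (ev v \<xi>))\<^sup>2)"
  by (rule sum_list_nonneg) auto

lemma dominated_bound_add:
  assumes "a \<le> K * (\<Sum>\<xi>\<leftarrow>xs. (norm (ev v \<xi>))\<^sup>2)" "b \<le> L * (\<Sum>\<xi>\<leftarrow>ys. (norm (ev v \<xi>))\<^sup>2)"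
    "0 \<le> K" "0 \<le> L"
  shows "a + b \<le> (K + L) * (\<Sum>\<xi>\<leftarrow>xs @ ys. (norm (ev v \<xi>))\<^sup>2)"
proof -
  have "(K + L) * (\<Sum>\<xi>\<leftarrow>xs @ ys. (norm (ev v \<xi>))\<^sup>2)
     = K * (\<Sum>\<xi>\<leftarrow>xs. (norm (ev v \<xi>))\<^sup>2) + L * (\<Sum>\<xi>\<leftarrow>ys. (norm (ev v \<xi>))\<^sup>2)
      + (L * (\<Sum>\<xi>\<leftarrow>xs. (norm (ev v \<xi>))\<^sup>2) + K * (\<Sum>\<xi>\<leftarrow>ys. (norm (ev v \<xi>))\<^sup>2))"
    by (simp add: algebra_simps)
  moreover have "0 \<le> L * (\<Sum>\<xi>\<leftarrow>xs. (norm (ev v \<xi>))\<^sup>2) + K * (\<Sum>\<xi>\<leftarrow>ys. (norm (ev v \<xi>))\<^sup>2)"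
    using assms(3,4) by (intro add_nonneg_nonneg mult_nonneg_nonneg sum_list_ev_nonneg)
  ultimately show ?thesis using assms(1,2) by linarith
qed

lemma subspace_dominated: "subspace dominated"
proof (rule subspaceI)
  show "0 \<in> dominated" by (auto simp: dominated_def)
  fix f g :: "'u set \<times> ('u \<Rightarrow> 'f::chilbert_space) \<Rightarrow> real" and c :: real
  assume f: "f \<in> dominated"
  then obtain K xs where K: "0 \<le> K" "\<And>v. \<bar>f v\<bar> \<le> K * (\<Sum>\<xi>\<leftarrow>xs. (norm (ev v \<xi>))\<^sup>2)"
    by (auto simp: dominated_def)
  have "\<bar>c * f v\<bar> \<le> (\<bar>c\<bar> * K) * (\<Sum>\<xi>\<leftarrow>xs. (norm (ev v \<xi>))\<^sup>2)" for v
    using mult_left_mono[OF K(2)[of v] abs_ge_zero[of c]] by (simp add: abs_mult mult.assoc)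
  then show "c *\<^sub>R f \<in> dominated"
    using K(1) unfolding dominated_def scaleR_fun_def
    by (intro CollectI exI[of _ "\<bar>c\<bar> * K"] exI[of _ xs] conjI allI) auto
  assume "g \<in> dominated"
  then obtain L ys where L: "0 \<le> L" "\<And>v. \<bar>g v\<bar> \<le> L * (\<Sum>\<xi>\<leftarrow>ys. (norm (ev v \<xi>))\<^sup>2)"
    by (auto simp: dominated_def)
  have "\<bar>f v + g v\<bar> \<le> (K + L) * (\<Sum>\<xi>\<leftarrow>xs @ ys. (norm (ev v \<xi>))\<^sup>2)" for v
    using dominated_bound_add[OF K(2)[of v] L(2)[of v] K(1) L(1)] abs_triangle_ineq[of "f v" "g v"] by linarith
  then show "f + g \<in> dominated"
    using K(1) L(1) unfolding dominated_def plus_fun_def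
    by (intro CollectI exI[of _ "K + L"] exI[of _ "xs @ ys"] conjI allI) auto
qed

text \<open>Representatives of Stinespring vectors: x \<otimes> \<xi> becomes the function v
  \<mapsto> x (ev v \<xi>). The bound is on the square so that inner products of two of them are
  \<open>dominated\<close>.\<close>

definition dominated_vec :: "('u set \<times> ('u \<Rightarrow> 'f::chilbert_space) \<Rightarrow> 'f) set" where
  "dominated_vec = {t. \<exists>K\<ge>0. \<exists>xs. \<forall>v. (norm (t v))\<^sup>2 \<le> K * (\<Sum>\<xi>\<leftarrow>xs. (norm (ev v \<xi>))\<^sup>2)}"

lemma dominated_vec_ev: "(\<lambda>v. ev v \<xi>) \<in> dominated_vec"
  unfolding dominated_vec_def by (intro CollectI exI[of _ 1] exI[of _ "[\<xi>]"] conjI) auto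

lemma dominated_vec_apply:
  assumes "t \<in> dominated_vec"
  shows "(\<lambda>v. blinfun_apply X (t v)) \<in> dominated_vec"
proof -
  obtain K xs where K: "0 \<le> K" "\<And>v. (norm (t v))\<^sup>2 \<le> K * (\<Sum>\<xi>\<leftarrow>xs. (norm (ev v \<xi>))\<^sup>2)"
    using assms by (auto simp: dominated_vec_def)
  have "(norm (blinfun_apply X (t v)))\<^sup>2 \<le> ((norm X)\<^sup>2 * K) * (\<Sum>\<xi>\<leftarrow>xs. (norm (ev v \<xi>))\<^sup>2)" for v
  proof -
    have "(norm (blinfun_apply X (t v)))\<^sup>2 \<le> (norm X * norm (t v))\<^sup>2"
      by (intro power_mono norm_blinfun) auto
    also have "\<dots> \<le> (norm X)\<^sup>2 * (K * (\<Sum>\<xi>\<leftarrow>xs. (norm (ev v \<xi>))\<^sup>2))"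
      using mult_left_mono[OF K(2)[of v], of "(norm X)\<^sup>2"] by (simp add: power_mult_distrib)
    finally show ?thesis by (simp add: mult.assoc)
  qed
  then show ?thesis
    using K(1) unfolding dominated_vec_def
    by (intro CollectI exI[of _ "(norm X)\<^sup>2 * K"] exI[of _ xs] conjI allI) auto
qed

lemma dominated_vec_add:
  assumes "t \<in> dominated_vec" "t' \<in> dominated_vec"
  shows "(\<lambda>v. t v + t' v) \<in> dominated_vec"
proof -
  obtain K xs where K: "0 \<le> K" "\<And>v. (norm (t v))\<^sup>2 \<le> K * (\<Sum>\<xi>\<leftarrow>xs. (norm (ev v \<xi>))\<^sup>2)"
    using assms(1) by (auto simp: dominated_vec_def)
  obtain L ys where L: "0 \<le> L" "\<And>v. (norm (t' v))\<^sup>2 \<le> L * (\<Sum>\<xi>\<leftarrow>ys. (norm (ev v \<xi>))\<^sup>2)"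
    using assms(2) by (auto simp: dominated_vec_def)
  have "(norm (t v + t' v))\<^sup>2 \<le> (2 * (K + L)) * (\<Sum>\<xi>\<leftarrow>xs @ ys. (norm (ev v \<xi>))\<^sup>2)" for v
  proof -
    have "(norm (t v + t' v))\<^sup>2 \<le> 2 * ((norm (t v))\<^sup>2 + (norm (t' v))\<^sup>2)"
      using zero_le_power2[of "norm (t v - t' v)"] by (simp add: norm_diff_sq norm_add_sq)
    also have "\<dots> \<le> 2 * ((K + L) * (\<Sum>\<xi>\<leftarrow>xs @ ys. (norm (ev v \<xi>))\<^sup>2))"
      by (intro mult_left_mono dominated_bound_add K L) auto
    finally show ?thesis by (simp only: mult.assoc)
  qed
  then show ?thesis
    using K(1) L(1) unfolding dominated_vec_def
    by (intro CollectI exI[of _ "2 * (K + L)"] exI[of _ "xs @ ys"] conjI allI) auto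
qed

lemma dominated_vec_scaleC:
  assumes "t \<in> dominated_vec"
  shows "(\<lambda>v. c *\<^sub>C t v) \<in> dominated_vec"
  using dominated_vec_apply[OF assms, of "c *\<^sub>C id_blinfun"] by (simp add: blinfun_apply_scaleC)

lemma dominated_vec_scaleR: "t \<in> dominated_vec \<Longrightarrow> (\<lambda>v. r *\<^sub>R t v) \<in> dominated_vec"
  by (simp add: scaleR_scaleC dominated_vec_scaleC)

lemma dominated_vec_diff: "t \<in> dominated_vec \<Longrightarrow> t' \<in> dominated_vec \<Longrightarrow> (\<lambda>v. t v - t' v) \<in> dominated_vec"
  using dominated_vec_add[OF _ dominated_vec_scaleC[of t' "-1"], of t] by simp

lemma dominated_vec_zero: "(\<lambda>v. 0) \<in> dominated_vec"
  using dominated_vec_scaleC[OF dominated_vec_ev, of 0] by simp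

lemma dominated_vec_sum:
  "(\<And>i. i \<in> I \<Longrightarrow> t i \<in> dominated_vec) \<Longrightarrow> (\<lambda>v. \<Sum>i\<in>I. t i v) \<in> dominated_vec"
  by (induction I rule: infinite_finite_induct) (auto simp: dominated_vec_zero dominated_vec_add)

lemmas dominated_vec_intros = dominated_vec_ev dominated_vec_apply dominated_vec_add
  dominated_vec_scaleC dominated_vec_scaleR dominated_vec_diff dominated_vec_zero dominated_vec_sum

lemma dominated_inner:
  assumes "t \<in> dominated_vec" "t' \<in> dominated_vec"
  shows "(\<lambda>v. inner (t v) (t' v)) \<in> dominated"
proof -
  obtain K xs where K: "0 \<le> K" "\<And>v. (norm (t v))\<^sup>2 \<le> K * (\<Sum>\<xi>\<leftarrow>xs. (norm (ev v \<xi>))\<^sup>2)"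
    using assms(1) by (auto simp: dominated_vec_def)
  obtain L ys where L: "0 \<le> L" "\<And>v. (norm (t' v))\<^sup>2 \<le> L * (\<Sum>\<xi>\<leftarrow>ys. (norm (ev v \<xi>))\<^sup>2)"
    using assms(2) by (auto simp: dominated_vec_def)
  have "\<bar>inner (t v) (t' v)\<bar> \<le> (K + L) * (\<Sum>\<xi>\<leftarrow>xs @ ys. (norm (ev v \<xi>))\<^sup>2)" for v
  proof -
    have "2 * \<bar>inner (t v) (t' v)\<bar> \<le> (norm (t v))\<^sup>2 + (norm (t' v))\<^sup>2"
      using zero_le_power2[of "norm (t v - t' v)"] zero_le_power2[of "norm (t v + t' v)"]
      unfolding norm_diff_sq norm_add_sq by linarith
    then show ?thesis
      using dominated_bound_add[OF K(2)[of v] L(2)[of v] K(1) L(1)]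
        zero_le_power2[of "norm (t v)"] zero_le_power2[of "norm (t' v)"] by linarith
  qed
  then show ?thesis
    using K(1) L(1) unfolding dominated_def
    by (intro CollectI exI[of _ "K + L"] exI[of _ "xs @ ys"] conjI allI) auto
qed

text \<open>In the application \<open>B\<close> is the relative crossed product, \<open>k\<close>
  its embedding into the envelope, \<sigma> the compression to one covariant representation,
  \<open>M\<close> the essential space of \<open>A\<close> there, and \<E> the image of the
  approximate unit of \<open>A\<close>.\<close>

locale compression =
  fixes B :: "'b::chilbert_space op set" and k :: "'b op \<Rightarrow> 'f::chilbert_space op"
    and \<sigma> :: "'b op \<Rightarrow> 'u ell2 op" and M :: "'u ell2 set" and \<E> :: "'b op filter"
  assumes B: "operator_algebra B"
    and k_hom: "algebra_hom B k" and k_iso: "completely_isometric B k" and k_bops: "k ` B \<subseteq> bops UNIV"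
    and \<sigma>_hom: "algebra_hom B \<sigma>" and \<sigma>_bops: "\<sigma> ` B \<subseteq> bops UNIV"
    and \<sigma>_cc: "\<And>n x r. (\<And>i j. i < n \<Longrightarrow> j < n \<Longrightarrow> x i j \<in> B) \<Longrightarrow> 0 \<le> r \<Longrightarrow> mat_bound n x r \<Longrightarrow>
      mat_bound n (\<lambda>i j. \<sigma> (x i j)) r"
    and M: "closed_csubspace M"
    and \<sigma>_range: "\<And>b x. b \<in> B \<Longrightarrow> blinfun_apply (\<sigma> b) x \<in> M"
    and \<sigma>_proj: "\<And>b x. b \<in> B \<Longrightarrow> blinfun_apply (\<sigma> b) (proj M x) = blinfun_apply (\<sigma> b) x"
    and unit: "\<E> \<noteq> bot" "\<forall>\<^sub>F e in \<E>. e \<in> B \<and> norm e \<le> 1"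
    and unit_tendsto: "\<And>y. y \<in> M \<Longrightarrow> ((\<lambda>e. blinfun_apply (\<sigma> e) y) \<longlongrightarrow> y) \<E>"
begin

lemmas B_sub = operator_algebra_csubspace[OF B]
lemmas B_closures = operator_algebra_closures[OF B]
lemmas k_simps = algebra_hom_add[OF k_hom B_sub] algebra_hom_scaleC[OF k_hom B_sub]
  algebra_hom_compose[OF k_hom B_sub] algebra_hom_zero[OF k_hom B_sub] algebra_hom_diff[OF k_hom B_sub]
  algebra_hom_scaleR[OF k_hom B_sub]
lemmas \<sigma>_simps = algebra_hom_add[OF \<sigma>_hom B_sub] algebra_hom_scaleC[OF \<sigma>_hom B_sub]
  algebra_hom_compose[OF \<sigma>_hom B_sub] algebra_hom_zero[OF \<sigma>_hom B_sub] algebra_hom_diff[OF \<sigma>_hom B_sub]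
  algebra_hom_scaleR[OF \<sigma>_hom B_sub]

lemma k_scaleC: "b \<in> B \<Longrightarrow> blinfun_apply (k b) (c *\<^sub>C x) = c *\<^sub>C blinfun_apply (k b) x"
  and \<sigma>_scaleC: "b \<in> B \<Longrightarrow> blinfun_apply (\<sigma> b) (c *\<^sub>C y) = c *\<^sub>C blinfun_apply (\<sigma> b) y"
  using k_bops \<sigma>_bops bops_scaleC by blast+

text \<open>If the matrix \<open>X = (k b\<^sub>i\<^sub>j + \<lambda>\<^sub>i\<^sub>j)\<close> is accretive then \<open>1 - \<epsilon>X\<close> has norm \<open>1 + O(\<epsilon>\<^sup>2)\<close>, and
  multiplying by an approximate unit moves it into the domain of \<open>\<sigma>\<close>.\<close>

lemma matrix_positive:
  fixes b :: "nat \<Rightarrow> nat \<Rightarrow> 'b op" and l :: "nat \<Rightarrow> nat \<Rightarrow> complex"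
  assumes b: "\<And>i j. b i j \<in> B"
    and pos: "\<And>w. 0 \<le> (\<Sum>i<n. \<Sum>j<n. inner (blinfun_apply (k (b i j)) (w j) + l i j *\<^sub>C w j) (w i))"
  shows "0 \<le> (\<Sum>i<n. \<Sum>j<n. inner (blinfun_apply (\<sigma> (b i j)) (x j) + l i j *\<^sub>C proj M (x j)) (x i))"
proof -
  define X where "X i j = k (b i j) + l i j *\<^sub>C id_blinfun" for i j
  define C where "C = (\<Sum>i<n. \<Sum>j<n. norm (X i j))\<^sup>2"
  have C0: "0 \<le> C" by (simp add: C_def)
  have C: "(\<Sum>i<n. (norm (\<Sum>j<n. blinfun_apply (X i j) (w j)))\<^sup>2) \<le> C * (\<Sum>i<n. (norm (w i))\<^sup>2)" for w
    unfolding C_def by (rule mat_boundD[OF mat_bound_crude])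
  \<comment> \<open>Both terms of the final claim see only components in \<open>M\<close>, and it is
    on \<open>M\<close> that \<sigma>(e) is assumed to converge to the identity.\<close>
  define y where "y j = proj M (x j)" for j
  define z where "z i = (\<Sum>j<n. blinfun_apply (\<sigma> (b i j)) (y j) + l i j *\<^sub>C y j)" for i
  define Y where "Y = (\<Sum>i<n. (norm (y i))\<^sup>2)"
  define q where "q = (\<Sum>i<n. inner (z i) (y i))"
  have Y0: "0 \<le> Y" by (simp add: Y_def sum_nonneg)
  have yM: "y j \<in> M" for j by (simp add: y_def M)
  have key: "(\<Sum>i<n. (norm (y i - \<epsilon> *\<^sub>R z i))\<^sup>2) \<le> (1 + \<epsilon>\<^sup>2 * C) * Y" if \<epsilon>: "0 < \<epsilon>" for \<epsilon>
  proof -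
    \<comment> \<open>\<open>Z e\<close> is 1 - \<epsilon>X times the diagonal matrix of
      \<open>e\<close>; the factor \<open>e\<close> absorbs the scalars \<open>l i j\<close>, so
      that the entries lie in \<open>B\<close>.\<close>
    define Z :: "'b op \<Rightarrow> nat \<Rightarrow> nat \<Rightarrow> 'b op" where "Z e i j = (if i = j then e else 0) - \<epsilon> *\<^sub>R ((b i j o\<^sub>L e) + l i j *\<^sub>C e)" for e i j
    let ?s = "sqrt (1 + \<epsilon>\<^sup>2 * C)"
    have ZB: "Z e i j \<in> B" if "e \<in> B" for e i j
      using that b B_closures by (auto simp: Z_def)
    have "(\<Sum>i<n. (norm (blinfun_apply (\<sigma> e) (y i) - \<epsilon> *\<^sub>R (\<Sum>j<n. blinfun_apply (\<sigma> (b i j)) (blinfun_apply (\<sigma> e) (y j))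
        + l i j *\<^sub>C blinfun_apply (\<sigma> e) (y j))))\<^sup>2) \<le> (1 + \<epsilon>\<^sup>2 * C) * Y"
      if e: "e \<in> B" "norm e \<le> 1" for e
    proof -
      have "mat_bound n (\<lambda>i j. k (Z e i j)) ?s"
        unfolding mat_bound_def
      proof
        fix w :: "nat \<Rightarrow> 'f"
        define u where "u j = blinfun_apply (k e) (w j)" for j
        have "norm (u j) \<le> norm (w j)" for j
          using norm_blinfun[of "k e" "w j"] completely_isometric_norm[OF k_iso e(1)] e(2)
            mult_right_mono[of "norm e" 1 "norm (w j)"] by (simp add: u_def)
        then have uw: "(\<Sum>i<n. (norm (u i))\<^sup>2) \<le> (\<Sum>i<n. (norm (w i))\<^sup>2)"
          by (intro sum_mono power_mono) auto
        have "(\<Sum>j<n. blinfun_apply (k (Z e i j)) (w j)) = u i - \<epsilon> *\<^sub>R (\<Sum>j<n. blinfun_apply (X i j) (u j))"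
          if i: "i < n" for i
        proof -
          have "blinfun_apply (k (Z e i j)) (w j) = (if i = j then u j else 0) - \<epsilon> *\<^sub>R blinfun_apply (X i j) (u j)" for j
            using e b B_closures
            by (simp add: Z_def k_simps X_def u_def blinfun.bilinear_simps blinfun_apply_scaleC)
          then show ?thesis using i by (simp add: sum_subtractf scaleR_sum_right)
        qed
        then have "(\<Sum>i<n. (norm (\<Sum>j<n. blinfun_apply (k (Z e i j)) (w j)))\<^sup>2)
            = (\<Sum>i<n. (norm (u i - \<epsilon> *\<^sub>R (\<Sum>j<n. blinfun_apply (X i j) (u j))))\<^sup>2)" by simp
        also have "\<dots> = (\<Sum>i<n. (norm (u i))\<^sup>2) - 2 * \<epsilon> * (\<Sum>i<n. \<Sum>j<n. inner (blinfun_apply (X i j) (u j)) (u i))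
            + \<epsilon>\<^sup>2 * (\<Sum>i<n. (norm (\<Sum>j<n. blinfun_apply (X i j) (u j)))\<^sup>2)"
          by (simp add: norm_diff_sq sum.distrib sum_subtractf power_mult_distrib inner_sum_right
              sum_distrib_left inner_commute mult.assoc)
        \<comment> \<open>Accretivity discards the term linear in \<epsilon>, which leaves only a
          quadratic excess over 1.\<close>
        also have "\<dots> \<le> (\<Sum>i<n. (norm (u i))\<^sup>2) - 2 * \<epsilon> * 0 + \<epsilon>\<^sup>2 * (C * (\<Sum>i<n. (norm (u i))\<^sup>2))"
          using pos[of u] \<epsilon> C[of u]
          by (intro add_mono diff_mono mult_left_mono) (auto simp: X_def blinfun.bilinear_simps blinfun_apply_scaleC)
        also have "\<dots> = (1 + \<epsilon>\<^sup>2 * C) * (\<Sum>i<n. (norm (u i))\<^sup>2)" by (simp add: algebra_simps)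
        also have "\<dots> \<le> (1 + \<epsilon>\<^sup>2 * C) * (\<Sum>i<n. (norm (w i))\<^sup>2)"
          using C0 by (intro mult_left_mono uw) auto
        finally show "(\<Sum>i<n. (norm (\<Sum>j<n. blinfun_apply (k (Z e i j)) (w j)))\<^sup>2) \<le> ?s\<^sup>2 * (\<Sum>i<n. (norm (w i))\<^sup>2)"
          using C0 by simp
      qed
      then have "mat_bound n (Z e) ?s"
        using completely_isometric_mat_bound[OF k_iso, of n "Z e" ?s] ZB[OF e(1)] C0 by simp
      then have "mat_bound n (\<lambda>i j. \<sigma> (Z e i j)) ?s"
        by (intro \<sigma>_cc) (use ZB[OF e(1)] C0 in auto)
      from mat_boundD[OF this, of y]
      have "(\<Sum>i<n. (norm (\<Sum>j<n. blinfun_apply (\<sigma> (Z e i j)) (y j)))\<^sup>2) \<le> (1 + \<epsilon>\<^sup>2 * C) * Y"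
        using C0 by (simp add: Y_def)
      moreover have "(\<Sum>j<n. blinfun_apply (\<sigma> (Z e i j)) (y j)) = blinfun_apply (\<sigma> e) (y i)
          - \<epsilon> *\<^sub>R (\<Sum>j<n. blinfun_apply (\<sigma> (b i j)) (blinfun_apply (\<sigma> e) (y j)) + l i j *\<^sub>C blinfun_apply (\<sigma> e) (y j))"
        if i: "i < n" for i
      proof -
        have "blinfun_apply (\<sigma> (Z e i j)) (y j) = (if i = j then blinfun_apply (\<sigma> e) (y j) else 0)
            - \<epsilon> *\<^sub>R (blinfun_apply (\<sigma> (b i j)) (blinfun_apply (\<sigma> e) (y j)) + l i j *\<^sub>C blinfun_apply (\<sigma> e) (y j))" for j
          using e b B_closures
          by (simp add: Z_def \<sigma>_simps blinfun.bilinear_simps blinfun_apply_scaleC)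
        then show ?thesis using i by (simp add: sum_subtractf scaleR_sum_right)
      qed
      ultimately show ?thesis by simp
    qed
    then have ev: "\<forall>\<^sub>F e in \<E>. (\<Sum>i<n. (norm (blinfun_apply (\<sigma> e) (y i) - \<epsilon> *\<^sub>R (\<Sum>j<n. blinfun_apply (\<sigma> (b i j)) (blinfun_apply (\<sigma> e) (y j))
        + l i j *\<^sub>C blinfun_apply (\<sigma> e) (y j))))\<^sup>2) \<le> (1 + \<epsilon>\<^sup>2 * C) * Y"
      using unit(2) by (auto elim: eventually_mono)
    have "((\<lambda>e. \<Sum>i<n. (norm (blinfun_apply (\<sigma> e) (y i) - \<epsilon> *\<^sub>R (\<Sum>j<n. blinfun_apply (\<sigma> (b i j)) (blinfun_apply (\<sigma> e) (y j))
        + l i j *\<^sub>C blinfun_apply (\<sigma> e) (y j))))\<^sup>2) \<longlongrightarrow> (\<Sum>i<n. (norm (y i - \<epsilon> *\<^sub>R z i))\<^sup>2)) \<E>"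
      unfolding z_def
      by (intro tendsto_intros unit_tendsto[OF yM] tendsto_scaleC_right
          bounded_linear.tendsto[OF blinfun.bounded_linear_right])
    from tendsto_upperbound[OF this ev unit(1)] show ?thesis .
  qed
  have exp: "(\<Sum>i<n. (norm (y i - \<epsilon> *\<^sub>R z i))\<^sup>2) = Y - 2 * \<epsilon> * q + \<epsilon>\<^sup>2 * (\<Sum>i<n. (norm (z i))\<^sup>2)" for \<epsilon>
    by (simp add: norm_diff_sq sum.distrib sum_subtractf power_mult_distrib Y_def q_def
        sum_distrib_left inner_commute mult.assoc)
  have low: "- (\<epsilon> * (C * Y)) \<le> 2 * q" if \<epsilon>: "0 < \<epsilon>" for \<epsilon>
  proof -
    have "0 \<le> \<epsilon>\<^sup>2 * (\<Sum>i<n. (norm (z i))\<^sup>2)" by (simp add: sum_nonneg)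
    then have "\<epsilon> * (- (\<epsilon> * (C * Y))) \<le> \<epsilon> * (2 * q)"
      using key[OF \<epsilon>] exp[of \<epsilon>] by (simp add: algebra_simps power2_eq_square)
    then show ?thesis using \<epsilon> by (simp only: mult_le_cancel_left_pos)
  qed
  have "0 \<le> q"
  proof (rule ccontr)
    assume "\<not> 0 \<le> q"
    then have q: "q < 0" by simp
    have CY: "0 \<le> C * Y" using C0 Y0 by simp
    \<comment> \<open>By \<open>low\<close>, 2q is at least minus \<epsilon> times C * Y, and this
      \<epsilon> makes that bound at least q, although 2q < q. The added 1 guards against a zero
      denominator.\<close>
    define \<epsilon> where "\<epsilon> = - q / (C * Y + 1)"
    have \<epsilon>: "0 < \<epsilon>" using q CY by (simp add: \<epsilon>_def divide_neg_pos)
    have "\<epsilon> * (C * Y) \<le> \<epsilon> * (C * Y + 1)" using \<epsilon> by simp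
    also have "\<dots> = - q" using CY by (simp add: \<epsilon>_def)
    finally show False using low[OF \<epsilon>] q by linarith
  qed
  also have "q = (\<Sum>i<n. \<Sum>j<n. inner (blinfun_apply (\<sigma> (b i j)) (x j) + l i j *\<^sub>C proj M (x j)) (x i))"
  proof -
    have "inner (blinfun_apply (\<sigma> (b i j)) (y j) + l i j *\<^sub>C y j) (y i)
        = inner (blinfun_apply (\<sigma> (b i j)) (x j) + l i j *\<^sub>C proj M (x j)) (x i)" for i j
    proof -
      have "blinfun_apply (\<sigma> (b i j)) (x j) + l i j *\<^sub>C proj M (x j) \<in> M"
        using M b \<sigma>_range by (auto simp: closed_csubspace_def intro!: csubspaceD)
      then have "cinner (y i) (blinfun_apply (\<sigma> (b i j)) (x j) + l i j *\<^sub>C proj M (x j))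
         = cinner (x i) (blinfun_apply (\<sigma> (b i j)) (x j) + l i j *\<^sub>C proj M (x j))"
        unfolding y_def by (rule cinner_proj_in[OF M])
      then show ?thesis
        using \<sigma>_proj[OF b] by (metis Re_cinner inner_commute y_def)
    qed
    then show ?thesis by (simp add: q_def z_def inner_sum_left)
  qed
  finally show ?thesis .
qed
end

lemma bounded_linear_proj: "closed_csubspace M \<Longrightarrow> bounded_linear (proj M)"
  by (rule bounded_linear_intro[where K = 1])
    (auto simp: proj_add proj_scaleC scaleR_scaleC norm_proj_le)

lemma tendsto_sum_list:
  fixes f :: "'t \<Rightarrow> 'c \<Rightarrow> 'd::real_normed_vector"
  shows "(\<And>t. t \<in> set ts \<Longrightarrow> (f t \<longlongrightarrow> l t) F) \<Longrightarrow> ((\<lambda>x. \<Sum>t\<leftarrow>ts. f t x) \<longlongrightarrow> (\<Sum>t\<leftarrow>ts. l t)) F"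
  by (induction ts) (auto intro!: tendsto_add)

text \<open>A quadruple (b, c, \<xi>, \<eta>) stands for the formal tensor (b + c1) \<otimes> \<xi>
  \<otimes> \<eta>; the scalar is kept apart because \<open>B\<close> need not contain a
  unit.\<close>

type_synonym ('b, 'u) form_term = "'b op \<times> complex \<times> 'u ell2 \<times> 'u ell2"

section \<open>The positive functional obtained from Hahn-Banach\<close>

context compression
begin

definition domain_form :: "('b, 'u) form_term list \<Rightarrow> 'u set \<times> ('u \<Rightarrow> 'f) \<Rightarrow> real" where
  "domain_form ts v = (\<Sum>(b, c, \<xi>, \<eta>)\<leftarrow>ts. inner (blinfun_apply (k b) (ev v \<xi>) + c *\<^sub>C ev v \<xi>) (ev v \<eta>))"

text \<open>The intended value of the functional on \<open>domain_form ts\<close>. The formal unit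
  goes to the projection onto \<open>M\<close>, the strong limit of \<sigma>(e) along the
  approximate unit.\<close>

definition range_form :: "('b, 'u) form_term list \<Rightarrow> real" where
  "range_form ts = (\<Sum>(b, c, \<xi>, \<eta>)\<leftarrow>ts. inner (blinfun_apply (\<sigma> b) \<xi> + c *\<^sub>C proj M \<xi>) \<eta>)"

definition admissible :: "('b, 'u) form_term list \<Rightarrow> bool" where
  "admissible ts \<longleftrightarrow> fst ` set ts \<subseteq> B"

text \<open>Collapses a list to one element of \<open>B\<close> and one scalar. The three claims
  share one induction, as additivity of \<open>k\<close> and \<sigma> needs the membership.\<close>

lemma combine_terms:
  assumes "admissible ts"
  shows "(\<Sum>t\<leftarrow>ts. a t *\<^sub>C fst t) \<in> B"
    and "blinfun_apply (k (\<Sum>t\<leftarrow>ts. a t *\<^sub>C fst t)) y + (\<Sum>t\<leftarrow>ts. a t * fst (snd t)) *\<^sub>C y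
      = (\<Sum>t\<leftarrow>ts. a t *\<^sub>C (blinfun_apply (k (fst t)) y + fst (snd t) *\<^sub>C y))"
    and "blinfun_apply (\<sigma> (\<Sum>t\<leftarrow>ts. a t *\<^sub>C fst t)) x + (\<Sum>t\<leftarrow>ts. a t * fst (snd t)) *\<^sub>C proj M x
      = (\<Sum>t\<leftarrow>ts. a t *\<^sub>C (blinfun_apply (\<sigma> (fst t)) x + fst (snd t) *\<^sub>C proj M x))"
proof -
  have "(\<Sum>t\<leftarrow>ts. a t *\<^sub>C fst t) \<in> B \<and>
    blinfun_apply (k (\<Sum>t\<leftarrow>ts. a t *\<^sub>C fst t)) y + (\<Sum>t\<leftarrow>ts. a t * fst (snd t)) *\<^sub>C y
      = (\<Sum>t\<leftarrow>ts. a t *\<^sub>C (blinfun_apply (k (fst t)) y + fst (snd t) *\<^sub>C y)) \<and>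
    blinfun_apply (\<sigma> (\<Sum>t\<leftarrow>ts. a t *\<^sub>C fst t)) x + (\<Sum>t\<leftarrow>ts. a t * fst (snd t)) *\<^sub>C proj M x
      = (\<Sum>t\<leftarrow>ts. a t *\<^sub>C (blinfun_apply (\<sigma> (fst t)) x + fst (snd t) *\<^sub>C proj M x))"
    using assms
  proof (induction ts)
    case (Cons t ts)
    have t: "fst t \<in> B" and ts: "admissible ts" using Cons.prems by (auto simp: admissible_def)
    note IH = Cons.IH[OF ts]
    have e: "k (a t *\<^sub>C fst t + (\<Sum>t\<leftarrow>ts. a t *\<^sub>C fst t)) = a t *\<^sub>C k (fst t) + k (\<Sum>t\<leftarrow>ts. a t *\<^sub>C fst t)"
      "\<sigma> (a t *\<^sub>C fst t + (\<Sum>t\<leftarrow>ts. a t *\<^sub>C fst t)) = a t *\<^sub>C \<sigma> (fst t) + \<sigma> (\<Sum>t\<leftarrow>ts. a t *\<^sub>C fst t)"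
      using t IH B_closures by (simp_all add: k_simps \<sigma>_simps)
    show ?case
      using t IH B_closures e
      by (simp add: blinfun.add_left blinfun_apply_scaleC scaleC_add_left scaleC_add_right scaleC_scaleC algebra_simps)
  qed (use B_closures in \<open>simp add: k_simps \<sigma>_simps\<close>)
  then show "(\<Sum>t\<leftarrow>ts. a t *\<^sub>C fst t) \<in> B"
    "blinfun_apply (k (\<Sum>t\<leftarrow>ts. a t *\<^sub>C fst t)) y + (\<Sum>t\<leftarrow>ts. a t * fst (snd t)) *\<^sub>C y
      = (\<Sum>t\<leftarrow>ts. a t *\<^sub>C (blinfun_apply (k (fst t)) y + fst (snd t) *\<^sub>C y))"
    "blinfun_apply (\<sigma> (\<Sum>t\<leftarrow>ts. a t *\<^sub>C fst t)) x + (\<Sum>t\<leftarrow>ts. a t * fst (snd t)) *\<^sub>C proj M x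
      = (\<Sum>t\<leftarrow>ts. a t *\<^sub>C (blinfun_apply (\<sigma> (fst t)) x + fst (snd t) *\<^sub>C proj M x))"
    by blast+
qed

text \<open>On vectors supported in \<open>J\<close> the list is one matrix of size card J. Since
  \<open>ev\<close> with first component \<open>J\<close> sends the basis vectors of
  \<open>J\<close> to arbitrary vectors of \<open>'f\<close>, positivity at all such
  \<open>v\<close> is exactly accretivity of this matrix, and \<open>matrix_positive\<close> carries
  it over to \<sigma>.\<close>

lemma range_form_cutoff_nonneg:
  assumes ts: "admissible ts" and pos: "\<And>v. 0 \<le> domain_form ts v" and J: "finite J"
  shows "0 \<le> (\<Sum>(b, c, \<xi>, \<eta>)\<leftarrow>ts. inner (blinfun_apply (\<sigma> b) (cutoff J \<xi>) + c *\<^sub>C proj M (cutoff J \<xi>)) (cutoff J \<eta>))"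
proof -
  obtain h where "bij_betw h {0..<card J} J" using ex_bij_betw_nat_finite[OF J] by blast
  then have h: "bij_betw h {..<card J} J" by (simp add: atLeast0LessThan)
  define n where "n = card J"
  define \<xi> where "\<xi> t = fst (snd (snd t))" for t :: "('b, 'u) form_term"
  define \<eta> where "\<eta> t = snd (snd (snd t))" for t :: "('b, 'u) form_term"
  define a where "a i j t = Rep_ell2 (\<xi> t) (h j) * cnj (Rep_ell2 (\<eta> t) (h i))" for i j t
  define b where "b i j = (\<Sum>t\<leftarrow>ts. a i j t *\<^sub>C fst t)" for i j
  define l where "l i j = (\<Sum>t\<leftarrow>ts. a i j t * fst (snd t))" for i j
  have cut: "cutoff J x = (\<Sum>j<n. Rep_ell2 x (h j) *\<^sub>C ket (h j))" for x
    unfolding cutoff_def n_def by (rule sum.reindex_bij_betw[OF h, symmetric])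
  have "0 \<le> (\<Sum>i<n. \<Sum>j<n. inner (blinfun_apply (\<sigma> (b i j)) (ket (h j)) + l i j *\<^sub>C proj M (ket (h j))) (ket (h i)))"
  proof (rule matrix_positive)
    show "b i j \<in> B" for i j unfolding b_def by (rule combine_terms[OF ts])
    fix w :: "nat \<Rightarrow> 'f"
    \<comment> \<open>\<open>ev v\<close> sends the basis vector with index \<open>h j\<close> to
      \<open>w j\<close>.\<close>
    define v where "v = (J, \<lambda>u. w (inv_into {..<n} h u))"
    have ev: "ev v x = (\<Sum>j<n. Rep_ell2 x (h j) *\<^sub>C w j)" for x
    proof -
      have "ev v x = (\<Sum>j<n. Rep_ell2 x (h j) *\<^sub>C w (inv_into {..<n} h (h j)))"
        unfolding ev_def v_def n_def fst_conv snd_conv by (rule sum.reindex_bij_betw[OF h, symmetric])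
      also have "\<dots> = (\<Sum>j<n. Rep_ell2 x (h j) *\<^sub>C w j)"
        using h by (intro sum.cong refl) (auto simp: bij_betw_def n_def inv_into_f_f)
      finally show ?thesis .
    qed
    have "domain_form ts v = (\<Sum>t\<leftarrow>ts. inner (blinfun_apply (k (fst t)) (\<Sum>j<n. Rep_ell2 (\<xi> t) (h j) *\<^sub>C w j)
        + fst (snd t) *\<^sub>C (\<Sum>j<n. Rep_ell2 (\<xi> t) (h j) *\<^sub>C w j)) (\<Sum>i<n. Rep_ell2 (\<eta> t) (h i) *\<^sub>C w i))"
      unfolding domain_form_def ev \<xi>_def \<eta>_def by (simp add: case_prod_unfold)
    also have "\<dots> = (\<Sum>i<n. \<Sum>j<n. inner (\<Sum>t\<leftarrow>ts. a i j t *\<^sub>C (blinfun_apply (k (fst t)) (w j) + fst (snd t) *\<^sub>C w j)) (w i))"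
      unfolding a_def
      by (rule sum_list_inner_expand)
        (use ts in \<open>auto simp: admissible_def blinfun.add_right scaleC_add_right k_scaleC scaleC_scaleC mult.commute image_subset_iff\<close>)
    finally show "0 \<le> (\<Sum>i<n. \<Sum>j<n. inner (blinfun_apply (k (b i j)) (w j) + l i j *\<^sub>C w j) (w i))"
      using pos[of v] unfolding b_def l_def combine_terms(2)[OF ts] by simp
  qed
  also have "\<dots> = (\<Sum>i<n. \<Sum>j<n. inner (\<Sum>t\<leftarrow>ts. a i j t *\<^sub>C (blinfun_apply (\<sigma> (fst t)) (ket (h j)) + fst (snd t) *\<^sub>C proj M (ket (h j)))) (ket (h i)))"
    unfolding b_def l_def combine_terms(3)[OF ts] ..
  also have "\<dots> = (\<Sum>t\<leftarrow>ts. inner (blinfun_apply (\<sigma> (fst t)) (\<Sum>j<n. Rep_ell2 (\<xi> t) (h j) *\<^sub>C ket (h j))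
        + fst (snd t) *\<^sub>C proj M (\<Sum>j<n. Rep_ell2 (\<xi> t) (h j) *\<^sub>C ket (h j))) (\<Sum>i<n. Rep_ell2 (\<eta> t) (h i) *\<^sub>C ket (h i)))"
    unfolding a_def
    by (rule sum_list_inner_expand[symmetric])
      (use ts in \<open>auto simp: admissible_def blinfun.add_right scaleC_add_right \<sigma>_scaleC scaleC_scaleC mult.commute
        image_subset_iff proj_add[OF M] proj_scaleC[OF M]\<close>)
  also have "\<dots> = (\<Sum>(b, c, \<xi>, \<eta>)\<leftarrow>ts. inner (blinfun_apply (\<sigma> b) (cutoff J \<xi>) + c *\<^sub>C proj M (cutoff J \<xi>)) (cutoff J \<eta>))"
    unfolding cut \<xi>_def \<eta>_def by (simp add: case_prod_unfold)
  finally show ?thesis .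
qed

lemma range_form_nonneg:
  assumes ts: "admissible ts" and pos: "\<And>v. 0 \<le> domain_form ts v"
  shows "0 \<le> range_form ts"
proof (rule tendsto_lowerbound)
  show "((\<lambda>J. \<Sum>(b, c, \<xi>, \<eta>)\<leftarrow>ts. inner (blinfun_apply (\<sigma> b) (cutoff J \<xi>) + c *\<^sub>C proj M (cutoff J \<xi>)) (cutoff J \<eta>))
      \<longlongrightarrow> range_form ts) (finite_subsets_at_top UNIV)"
    unfolding range_form_def case_prod_unfold
    by (intro tendsto_sum_list tendsto_inner tendsto_add tendsto_scaleC_right
        bounded_linear.tendsto[OF blinfun.bounded_linear_right]
        bounded_linear.tendsto[OF bounded_linear_proj[OF M]] tendsto_cutoff)
  show "\<forall>\<^sub>F J in finite_subsets_at_top UNIV.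
      0 \<le> (\<Sum>(b, c, \<xi>, \<eta>)\<leftarrow>ts. inner (blinfun_apply (\<sigma> b) (cutoff J \<xi>) + c *\<^sub>C proj M (cutoff J \<xi>)) (cutoff J \<eta>))"
    by (rule eventually_finite_subsets_at_top_weakI) (rule range_form_cutoff_nonneg[OF ts pos])
qed simp

lemma dominated_domain_form:
  assumes "admissible ts"
  shows "domain_form ts \<in> dominated"
  using assms
proof (induction ts)
  case Nil
  then show ?case using subspace_0[OF subspace_dominated] by (simp add: domain_form_def[abs_def] zero_fun_def)
next
  case (Cons t ts)
  obtain b c \<xi> \<eta> where t: "t = (b, c, \<xi>, \<eta>)" by (cases t)
  have "(\<lambda>v. inner (blinfun_apply (k b) (ev v \<xi>) + c *\<^sub>C ev v \<xi>) (ev v \<eta>)) \<in> dominated"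
    by (intro dominated_inner dominated_vec_intros)
  moreover have "domain_form ts \<in> dominated" using Cons by (simp add: admissible_def)
  ultimately have "(\<lambda>v. inner (blinfun_apply (k b) (ev v \<xi>) + c *\<^sub>C ev v \<xi>) (ev v \<eta>)) + domain_form ts \<in> dominated"
    by (rule subspace_add[OF subspace_dominated])
  moreover have "domain_form (t # ts) = (\<lambda>v. inner (blinfun_apply (k b) (ev v \<xi>) + c *\<^sub>C ev v \<xi>) (ev v \<eta>)) + domain_form ts"
    by (simp add: fun_eq_iff domain_form_def t plus_fun_def)
  ultimately show ?case by metis
qed

text \<open>Forms are real-linear in \<eta>, so scaling \<eta> scales the whole list and leaves the
  entries from \<open>B\<close> untouched.\<close>

definition scale_form :: "real \<Rightarrow> ('b, 'u) form_term list \<Rightarrow> ('b, 'u) form_term list" where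
  "scale_form r ts = map (\<lambda>(b, c, \<xi>, \<eta>). (b, c, \<xi>, r *\<^sub>R \<eta>)) ts"

lemma scale_form:
  "domain_form (scale_form r ts) v = r * domain_form ts v" "range_form (scale_form r ts) = r * range_form ts"
  "admissible (scale_form r ts) = admissible ts"
proof -
  have e: "ev v (r *\<^sub>R \<eta>) = r *\<^sub>R ev v \<eta>" for \<eta> by (simp add: scaleR_scaleC ev_scaleC)
  show "domain_form (scale_form r ts) v = r * domain_form ts v" "range_form (scale_form r ts) = r * range_form ts"
    by (simp_all add: domain_form_def range_form_def scale_form_def case_prod_unfold comp_def e sum_list_const_mult)
  show "admissible (scale_form r ts) = admissible ts"
    by (force simp: admissible_def scale_form_def)
qed

lemma append_form:
  "domain_form (ts @ us) v = domain_form ts v + domain_form us v" "range_form (ts @ us) = range_form ts + range_form us"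
  "admissible (ts @ us) \<longleftrightarrow> admissible ts \<and> admissible us"
  by (auto simp: domain_form_def range_form_def admissible_def)

text \<open>\<open>p f\<close> is the infimum of \<open>range_form\<close> over the admissible
  majorants of \<open>f\<close>. A linear functional below \<open>p\<close> is automatically
  nonnegative on nonnegative functions, and it equals \<open>range_form\<close> on forms because the
  negative of a form is again a form.\<close>

theorem exists_positive_extension:
  obtains s :: "('u set \<times> ('u \<Rightarrow> 'f) \<Rightarrow> real) \<Rightarrow> real" where
    "\<And>f g. f \<in> dominated \<Longrightarrow> g \<in> dominated \<Longrightarrow> s (f + g) = s f + s g"
    "\<And>c f. f \<in> dominated \<Longrightarrow> s (c *\<^sub>R f) = c * s f"
    "\<And>f. f \<in> dominated \<Longrightarrow> (\<And>v. 0 \<le> f v) \<Longrightarrow> 0 \<le> s f"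
    "\<And>b \<xi> \<eta>. b \<in> B \<Longrightarrow> s (\<lambda>v. inner (blinfun_apply (k b) (ev v \<xi>)) (ev v \<eta>)) = inner (blinfun_apply (\<sigma> b) \<xi>) \<eta>"
    "\<And>\<xi> \<eta>. s (\<lambda>v. inner (ev v \<xi>) (ev v \<eta>)) = inner (proj M \<xi>) \<eta>"
proof -
  define G where "G f = range_form ` {ts. admissible ts \<and> (\<forall>v. f v \<le> domain_form ts v)}"
    for f :: "'u set \<times> ('u \<Rightarrow> 'f) \<Rightarrow> real"
  define p where "p f = Inf (G f)" for f
  have B0: "0 \<in> B" by (rule B_closures)
  have ne: "\<exists>ts. admissible ts \<and> (\<forall>v. f v \<le> domain_form ts v)" if f: "f \<in> dominated" for f
  proof -
    obtain K xs where K: "0 \<le> K" "\<And>v. \<bar>f v\<bar> \<le> K * (\<Sum>\<xi>\<leftarrow>xs. (norm (ev v \<xi>))\<^sup>2)"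
      using f by (auto simp: dominated_def)
    \<comment> \<open>With b = 0 and c = 1, scaled by \<open>K\<close>: a multiple of the formal
      unit alone dominates \<open>f\<close>.\<close>
    let ?ts = "scale_form K (map (\<lambda>\<xi>. (0, 1, \<xi>, \<xi>)) xs)"
    have "admissible ?ts" unfolding scale_form using B0 by (auto simp: admissible_def)
    moreover have "domain_form ?ts v = K * (\<Sum>\<xi>\<leftarrow>xs. (norm (ev v \<xi>))\<^sup>2)" for v
      unfolding scale_form by (simp add: domain_form_def k_simps comp_def power2_norm_eq_inner)
    moreover have "f v \<le> K * (\<Sum>\<xi>\<leftarrow>xs. (norm (ev v \<xi>))\<^sup>2)" for v
      using K(2)[of v] by linarith
    ultimately show ?thesis by (intro exI[of _ ?ts]) simp
  qed
  have bdd: "bdd_below (G f)" if f: "f \<in> dominated" for f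
  proof -
    \<comment> \<open>A majorant \<open>us\<close> of -f bounds the infimum from below: joined to
      any \<open>ts\<close> above f it gives a nonnegative form.\<close>
    have "- f \<in> dominated" using subspace_neg[OF subspace_dominated f] .
    then obtain us where us: "admissible us" "\<And>v. - f v \<le> domain_form us v" using ne by force
    show ?thesis
    proof (rule bdd_belowI)
      fix x assume "x \<in> G f"
      then obtain ts where ts: "admissible ts" "\<And>v. f v \<le> domain_form ts v" "x = range_form ts"
        by (auto simp: G_def)
      have "0 \<le> range_form (ts @ us)"
      proof (rule range_form_nonneg)
        show "0 \<le> domain_form (ts @ us) v" for v using ts(2)[of v] us(2)[of v] by (simp add: append_form)
      qed (use ts us in \<open>simp add: append_form\<close>)
      then show "- range_form us \<le> x" using ts(3) by (simp add: append_form)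
    qed
  qed
  have ple: "p f \<le> range_form ts" if "f \<in> dominated" "admissible ts" "\<And>v. f v \<le> domain_form ts v" for f ts
    unfolding p_def by (rule cInf_lower[OF _ bdd[OF that(1)]]) (use that in \<open>auto simp: G_def\<close>)
  have pge: "a \<le> p f" if "f \<in> dominated" "\<And>ts. admissible ts \<Longrightarrow> (\<And>v. f v \<le> domain_form ts v) \<Longrightarrow> a \<le> range_form ts" for a f
    unfolding p_def by (rule cInf_greatest) (use that ne[OF that(1)] in \<open>auto simp: G_def\<close>)
  have "sublinear_on dominated p"
    unfolding sublinear_on_def
  proof (intro conjI ballI allI impI)
    fix f g :: "'u set \<times> ('u \<Rightarrow> 'f) \<Rightarrow> real" assume f: "f \<in> dominated" and g: "g \<in> dominated"
    have "p (f + g) - p g \<le> range_form ts" if ts: "admissible ts" "\<And>v. f v \<le> domain_form ts v" for ts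
    proof -
      have "p (f + g) - range_form ts \<le> range_form us" if us: "admissible us" "\<And>v. g v \<le> domain_form us v" for us
      proof -
        have "p (f + g) \<le> range_form (ts @ us)"
          by (rule ple) (use f g ts us subspace_add[OF subspace_dominated] in \<open>auto simp: append_form add_mono\<close>)
        then show ?thesis by (simp add: append_form)
      qed
      then have "p (f + g) - range_form ts \<le> p g" by (rule pge[OF g])
      then show ?thesis by simp
    qed
    then have "p (f + g) - p g \<le> p f" by (rule pge[OF f])
    then show "p (f + g) \<le> p f + p g" by simp
  next
    fix f :: "'u set \<times> ('u \<Rightarrow> 'f) \<Rightarrow> real" and c :: real assume f: "f \<in> dominated" and c: "0 \<le> c"
    have le: "p (c *\<^sub>R f) \<le> c * range_form ts" if ts: "admissible ts" "\<And>v. f v \<le> domain_form ts v" for ts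
      unfolding scale_form(2)[symmetric]
      by (rule ple) (use f c ts subspace_scale[OF subspace_dominated] in \<open>auto simp: scale_form scaleR_fun_def mult_left_mono\<close>)
    show "p (c *\<^sub>R f) \<le> c * p f"
    proof (cases "c = 0")
      case True
      then show ?thesis using le ne[OF f] by auto
    next
      case False
      then have "p (c *\<^sub>R f) / c \<le> p f"
        using c le by (intro pge[OF f]) (simp add: pos_divide_le_eq mult.commute)
      then show ?thesis using False c by (simp add: pos_divide_le_eq mult.commute)
    qed
  qed
  then obtain s where sp: "\<And>f. f \<in> dominated \<Longrightarrow> s f \<le> p f"
    and s_add: "\<And>f g. f \<in> dominated \<Longrightarrow> g \<in> dominated \<Longrightarrow> s (f + g) = s f + s g"
    and s_scale: "\<And>c f. f \<in> dominated \<Longrightarrow> s (c *\<^sub>R f) = c * s f"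
    using sublinear_dominates_linear[OF subspace_dominated] by metis
  have s_pos: "0 \<le> s f" if f: "f \<in> dominated" "\<And>v. 0 \<le> f v" for f
  proof -
    have m: "(-1) *\<^sub>R f \<in> dominated" by (rule subspace_scale[OF subspace_dominated f(1)])
    have "s ((-1) *\<^sub>R f) \<le> p ((-1) *\<^sub>R f)" by (rule sp[OF m])
    \<comment> \<open>The empty list is a majorant of the nonpositive function -f.\<close>
    also have "\<dots> \<le> range_form []"
      by (rule ple[OF m]) (use f(2) in \<open>auto simp: admissible_def domain_form_def scaleR_fun_def\<close>)
    finally show ?thesis using s_scale[OF f(1), of "-1"] by (simp add: range_form_def)
  qed
  have s_form: "s (domain_form ts) = range_form ts" if ts: "admissible ts" for ts
  proof (rule order_antisym)
    show "s (domain_form ts) \<le> range_form ts"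
      using sp[OF dominated_domain_form[OF ts]] ple[OF dominated_domain_form[OF ts] ts] by fastforce
    have "domain_form (scale_form (-1) ts) = (-1) *\<^sub>R domain_form ts"
      by (simp add: fun_eq_iff scale_form scaleR_fun_def)
    then have m: "(-1) *\<^sub>R domain_form ts = domain_form (scale_form (-1) ts)" "admissible (scale_form (-1) ts)"
      using ts by (simp_all add: scale_form)
    have "s ((-1) *\<^sub>R domain_form ts) \<le> range_form (scale_form (-1) ts)"
      unfolding m(1) using sp[OF dominated_domain_form[OF m(2)]] ple[OF dominated_domain_form[OF m(2)] m(2)] by fastforce
    then show "range_form ts \<le> s (domain_form ts)"
      using s_scale[OF dominated_domain_form[OF ts], of "-1"] by (simp add: scale_form)
  qed
  show ?thesis
  proof (rule that[OF s_add s_scale s_pos])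
    fix b \<xi> \<eta> assume b: "b \<in> B"
    show "s (\<lambda>v. inner (blinfun_apply (k b) (ev v \<xi>)) (ev v \<eta>)) = inner (blinfun_apply (\<sigma> b) \<xi>) \<eta>"
      using s_form[of "[(b, 0, \<xi>, \<eta>)]"] b by (simp add: admissible_def domain_form_def[abs_def] range_form_def)
  next
    fix \<xi> \<eta>
    show "s (\<lambda>v. inner (ev v \<xi>) (ev v \<eta>)) = inner (proj M \<xi>) \<eta>"
      using s_form[of "[(0, 1, \<xi>, \<eta>)]"] B0
      by (simp add: admissible_def domain_form_def[abs_def] range_form_def k_simps \<sigma>_simps)
  qed
qed

end

subsection \<open>Reindexing square-summable families\<close>

text \<open>\<open>pull h\<close> is the adjoint of the isometry \<open>push h\<close>. The index
  map \<open>h\<close> is a shift when room for one more dimension is needed, and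
  \<open>Pair s\<close> for the summands of a direct sum.\<close>

definition pull :: "('i \<Rightarrow> 'j) \<Rightarrow> 'j ell2 \<Rightarrow> 'i ell2" where
  "pull h \<psi> = Abs_ell2 (\<lambda>i. Rep_ell2 \<psi> (h i))"

definition push :: "('i \<Rightarrow> 'j) \<Rightarrow> 'i ell2 \<Rightarrow> 'j ell2" where
  "push h \<xi> = Abs_ell2 (\<lambda>j. if j \<in> range h then Rep_ell2 \<xi> (inv_into UNIV h j) else 0)"

context
  fixes h :: "'i \<Rightarrow> 'j"
  assumes h: "inj h"
begin

lemma Rep_pull: "Rep_ell2 (pull h \<psi>) i = Rep_ell2 \<psi> (h i)"
proof -
  have "(\<lambda>j. (cmod (Rep_ell2 \<psi> j))\<^sup>2) summable_on range h"
    by (rule summable_on_subset_banach[of _ UNIV]) (use Rep_ell2[of \<psi>] in auto)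
  then have "(\<lambda>i. (cmod (Rep_ell2 \<psi> (h i)))\<^sup>2) summable_on UNIV"
    by (simp only: summable_on_reindex[OF h] comp_def)
  then show ?thesis by (simp add: pull_def Abs_ell2_inverse)
qed

lemma Rep_push: "Rep_ell2 (push h \<xi>) j = (if j \<in> range h then Rep_ell2 \<xi> (inv_into UNIV h j) else 0)"
proof -
  have "(\<lambda>i. (cmod (Rep_ell2 \<xi> i))\<^sup>2) summable_on UNIV" using Rep_ell2[of \<xi>] by simp
  then have "((\<lambda>j. (cmod (Rep_ell2 \<xi> (inv_into UNIV h j)))\<^sup>2) \<circ> h) summable_on UNIV"
    by (simp add: comp_def inv_f_f[OF h])
  then have "(\<lambda>j. (cmod (Rep_ell2 \<xi> (inv_into UNIV h j)))\<^sup>2) summable_on range h"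
    using summable_on_reindex[OF h] by blast
  then have "(\<lambda>j. (cmod (if j \<in> range h then Rep_ell2 \<xi> (inv_into UNIV h j) else 0))\<^sup>2) summable_on UNIV"
    by (rule summable_on_cong_neutral[THEN iffD1, rotated -1]) auto
  then show ?thesis by (simp add: push_def Abs_ell2_inverse)
qed

lemma pull_push: "pull h (push h \<xi>) = \<xi>"
  by (simp add: Rep_ell2_inject[symmetric] fun_eq_iff Rep_pull Rep_push inv_f_f[OF h])

lemma pull_add: "pull h (\<psi> + \<phi>) = pull h \<psi> + pull h \<phi>"
  and pull_scaleC: "pull h (c *\<^sub>C \<psi>) = c *\<^sub>C pull h \<psi>"
  by (simp_all add: Rep_ell2_inject[symmetric] fun_eq_iff Rep_pull plus_ell2.rep_eq scaleC_ell2.rep_eq)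

lemma push_add: "push h (\<xi> + \<eta>) = push h \<xi> + push h \<eta>"
  and push_scaleC: "push h (c *\<^sub>C \<xi>) = c *\<^sub>C push h \<xi>"
  by (simp_all add: Rep_ell2_inject[symmetric] fun_eq_iff Rep_push plus_ell2.rep_eq scaleC_ell2.rep_eq)

lemma cinner_push: "cinner (push h \<xi>) \<psi> = cinner \<xi> (pull h \<psi>)"
proof -
  have "cinner (push h \<xi>) \<psi> = (\<Sum>\<^sub>\<infinity>j\<in>range h. Rep_ell2 \<xi> (inv_into UNIV h j) * cnj (Rep_ell2 \<psi> j))"
    unfolding cinner_ell2.rep_eq by (rule infsum_cong_neutral) (auto simp: Rep_push)
  also have "\<dots> = (\<Sum>\<^sub>\<infinity>i. Rep_ell2 \<xi> i * cnj (Rep_ell2 \<psi> (h i)))"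
    by (subst infsum_reindex[OF h]) (simp add: comp_def inv_f_f[OF h])
  finally show ?thesis by (simp add: cinner_ell2.rep_eq Rep_pull)
qed

lemma norm_push: "norm (push h \<xi>) = norm \<xi>"
proof -
  have "cinner (push h \<xi>) (push h \<xi>) = cinner \<xi> \<xi>" by (simp add: cinner_push pull_push)
  then have "(norm (push h \<xi>))\<^sup>2 = (norm \<xi>)\<^sup>2" unfolding cinner_self of_real_eq_iff .
  then show ?thesis by simp
qed

lemma norm_pull_le: "norm (pull h \<psi>) \<le> norm \<psi>"
proof (cases "pull h \<psi> = 0")
  case False
  have "(norm (pull h \<psi>))\<^sup>2 = Re (cinner (push h (pull h \<psi>)) \<psi>)"
    by (simp add: cinner_push Re_cinner power2_norm_eq_inner)
  also have "\<dots> \<le> norm (push h (pull h \<psi>)) * norm \<psi>" by (simp add: Re_cinner norm_cauchy_schwarz)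
  finally show ?thesis using False by (simp add: norm_push power2_eq_square)
qed simp

lemma bounded_linear_pull: "bounded_linear (pull h)"
  by (rule bounded_linear_intro[where K = 1])
    (auto simp: pull_add pull_scaleC scaleR_scaleC norm_pull_le)

lemma bounded_linear_push: "bounded_linear (push h)"
  by (rule bounded_linear_intro[where K = 1])
    (auto simp: push_add push_scaleC scaleR_scaleC norm_push)

end

text \<open>Hilbert's hotel: an infinite index set is equipotent with itself less a point, so
  \<open>'u ell2\<close> holds a copy of itself plus the line through \<open>e\<close>. Dilations by
  one dimension thus stay in the same universe.\<close>

lemma exists_shift:
  assumes "infinite (UNIV :: 'u set)"
  obtains h :: "'u \<Rightarrow> 'u" and e :: "'u ell2"
  where "inj h" "cinner e e = 1" "pull h e = 0" "\<And>\<psi>. \<psi> = push h (pull h \<psi>) + cinner \<psi> e *\<^sub>C e"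
proof -
  obtain i0 :: 'u where True by blast
  obtain h :: "'u \<Rightarrow> 'u" where h: "bij_betw h UNIV (UNIV - {i0})"
    using infinite_imp_bij_betw[OF assms, of i0] by blast
  have inj: "inj h" and range: "range h = UNIV - {i0}" using h by (auto simp: bij_betw_def)
  have ck: "cinner \<psi> (ket i0) = Rep_ell2 \<psi> i0" for \<psi>
  proof -
    have "cinner \<psi> (ket i0) = (\<Sum>\<^sub>\<infinity>i\<in>{i0}. Rep_ell2 \<psi> i)"
      unfolding cinner_ell2.rep_eq ket.rep_eq by (rule infsum_cong_neutral) auto
    then show ?thesis by simp
  qed
  show ?thesis
  proof (rule that[OF inj])
    show "cinner (ket i0) (ket i0) = 1" by (simp add: ck ket.rep_eq)
    show "pull h (ket i0) = 0"
      using range by (auto simp: Rep_ell2_inject[symmetric] fun_eq_iff Rep_pull[OF inj] ket.rep_eq zero_ell2.rep_eq)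
    show "\<psi> = push h (pull h \<psi>) + cinner \<psi> (ket i0) *\<^sub>C ket i0" for \<psi>
      using range f_inv_into_f[of _ h UNIV]
      by (auto simp: Rep_ell2_inject[symmetric] fun_eq_iff Rep_pull[OF inj] Rep_push[OF inj] ket.rep_eq ck
          plus_ell2.rep_eq scaleC_ell2.rep_eq)
  qed
qed

subsection \<open>The semi-inner product of a positive extension\<close>

locale positive_extension = compression B k \<sigma> M \<E>
  for B :: "'b::chilbert_space op set" and k :: "'b op \<Rightarrow> 'f::chilbert_space op"
    and \<sigma> :: "'b op \<Rightarrow> 'u ell2 op" and M \<E> +
  fixes s :: "('u set \<times> ('u \<Rightarrow> 'f) \<Rightarrow> real) \<Rightarrow> real"
  assumes s_add: "\<And>f g. f \<in> dominated \<Longrightarrow> g \<in> dominated \<Longrightarrow> s (f + g) = s f + s g"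
    and s_scale: "\<And>c f. f \<in> dominated \<Longrightarrow> s (c *\<^sub>R f) = c * s f"
    and s_pos: "\<And>f. f \<in> dominated \<Longrightarrow> (\<And>v. 0 \<le> f v) \<Longrightarrow> 0 \<le> s f"
    and s_k: "\<And>b \<xi> \<eta>. b \<in> B \<Longrightarrow> s (\<lambda>v. inner (blinfun_apply (k b) (ev v \<xi>)) (ev v \<eta>)) = inner (blinfun_apply (\<sigma> b) \<xi>) \<eta>"
    and s_one: "\<And>\<xi> \<eta>. s (\<lambda>v. inner (ev v \<xi>) (ev v \<eta>)) = inner (proj M \<xi>) \<eta>"
begin

text \<open>The semi-inner product of the Stinespring space, on representatives; equality in that
  space means that the difference has \<open>ip\<close> zero with itself.\<close>

definition ip :: "('u set \<times> ('u \<Rightarrow> 'f) \<Rightarrow> 'f) \<Rightarrow> ('u set \<times> ('u \<Rightarrow> 'f) \<Rightarrow> 'f) \<Rightarrow> real" where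
  "ip t t' = s (\<lambda>v. inner (t v) (t' v))"

lemma ip_commute: "ip t t' = ip t' t"
  by (simp add: ip_def inner_commute)

lemma ip_add_left:
  assumes "t \<in> dominated_vec" "u \<in> dominated_vec" "w \<in> dominated_vec"
  shows "ip (\<lambda>v. t v + u v) w = ip t w + ip u w"
  using s_add[OF dominated_inner[OF assms(1,3)] dominated_inner[OF assms(2,3)]]
  by (simp add: ip_def inner_add_left plus_fun_def)

lemma ip_scaleR_left:
  assumes "t \<in> dominated_vec" "w \<in> dominated_vec"
  shows "ip (\<lambda>v. r *\<^sub>R t v) w = r * ip t w"
  using s_scale[OF dominated_inner[OF assms], of r] by (simp add: ip_def scaleR_fun_def)

lemma ip_diff_left:
  assumes "t \<in> dominated_vec" "u \<in> dominated_vec" "w \<in> dominated_vec"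
  shows "ip (\<lambda>v. t v - u v) w = ip t w - ip u w"
  using ip_add_left[OF assms(1) dominated_vec_scaleR[OF assms(2), of "-1"] assms(3)]
    ip_scaleR_left[OF assms(2,3), of "-1"] by simp

lemma ip_add_right:
  "t \<in> dominated_vec \<Longrightarrow> u \<in> dominated_vec \<Longrightarrow> w \<in> dominated_vec \<Longrightarrow> ip w (\<lambda>v. t v + u v) = ip w t + ip w u"
  and ip_scaleR_right: "t \<in> dominated_vec \<Longrightarrow> w \<in> dominated_vec \<Longrightarrow> ip w (\<lambda>v. r *\<^sub>R t v) = r * ip w t"
  and ip_diff_right:
  "t \<in> dominated_vec \<Longrightarrow> u \<in> dominated_vec \<Longrightarrow> w \<in> dominated_vec \<Longrightarrow> ip w (\<lambda>v. t v - u v) = ip w t - ip w u"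
  by (simp_all add: ip_commute[of w] ip_add_left ip_scaleR_left ip_diff_left)

lemma ip_scaleC_left: "ip (\<lambda>v. c *\<^sub>C t v) w = ip t (\<lambda>v. cnj c *\<^sub>C w v)"
  by (simp add: ip_def inner_scaleC)

text \<open>Operators on \<open>'f\<close> act pointwise, so their adjoints for \<open>ip\<close>
  are the pointwise ones: this is the representation by left multiplication on Stinespring
  vectors.\<close>

lemma ip_apply: "X \<in> bops UNIV \<Longrightarrow> ip (\<lambda>v. blinfun_apply X (t v)) w = ip t (\<lambda>v. blinfun_apply (adj X) (w v))"
  by (simp add: ip_def inner_adj_right)

lemma ip_apply_right: "X \<in> bops UNIV \<Longrightarrow> ip w (\<lambda>v. blinfun_apply X (t v)) = ip (\<lambda>v. blinfun_apply (adj X) (w v)) t"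
  by (simp add: ip_commute[of w] ip_apply ip_commute[of t])

lemma ip_nonneg: "t \<in> dominated_vec \<Longrightarrow> 0 \<le> ip t t"
  unfolding ip_def by (rule s_pos) (auto intro: dominated_inner)

lemma ip_ev: "ip (\<lambda>v. ev v \<xi>) (\<lambda>v. ev v \<eta>) = inner (proj M \<xi>) \<eta>"
  by (simp add: ip_def s_one)

lemma ip_k: "b \<in> B \<Longrightarrow> ip (\<lambda>v. blinfun_apply (k b) (ev v \<xi>)) (\<lambda>v. ev v \<eta>) = inner (blinfun_apply (\<sigma> b) \<xi>) \<eta>"
  by (simp add: ip_def s_k)

lemma ip_add_sq:
  assumes "t \<in> dominated_vec" "u \<in> dominated_vec"
  shows "ip (\<lambda>v. t v + u v) (\<lambda>v. t v + u v) = ip t t + 2 * ip t u + ip u u"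
  using assms by (simp add: ip_add_left ip_add_right dominated_vec_intros ip_commute[of u t])

lemma ip_diff_sq:
  assumes "t \<in> dominated_vec" "u \<in> dominated_vec"
  shows "ip (\<lambda>v. t v - u v) (\<lambda>v. t v - u v) = ip t t - 2 * ip t u + ip u u"
  using assms by (simp add: ip_diff_left ip_diff_right dominated_vec_intros ip_commute[of u t])

lemma ip_cauchy_schwarz:
  assumes t: "t \<in> dominated_vec" and w: "w \<in> dominated_vec"
  shows "(ip t w)\<^sup>2 \<le> ip t t * ip w w"
proof -
  have q: "0 \<le> ip t t + 2 * (r * ip t w) + r\<^sup>2 * ip w w" for r
  proof -
    have "0 \<le> ip (\<lambda>v. t v + r *\<^sub>R w v) (\<lambda>v. t v + r *\<^sub>R w v)"
      by (intro ip_nonneg dominated_vec_intros assms)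
    then show ?thesis
      using assms by (simp add: ip_add_sq ip_scaleR_left ip_scaleR_right dominated_vec_intros power2_eq_square mult.assoc)
  qed
  show ?thesis
  proof (cases "ip w w = 0")
    case True
    have "ip t w = 0"
    proof (rule ccontr)
      assume n: "ip t w \<noteq> 0"
      \<comment> \<open>With ip w w = 0 the quadratic in r becomes affine, and this r gives it the
        negative value - ip t t - 2.\<close>
      have "0 \<le> ip t t + 2 * ((- (ip t t + 1) / ip t w) * ip t w)"
        using q[of "- (ip t t + 1) / ip t w"] True by simp
      then show False using n ip_nonneg[OF t] by simp
    qed
    then show ?thesis using ip_nonneg[OF t] ip_nonneg[OF w] by simp
  next
    case False
    then have pos: "0 < ip w w" using ip_nonneg[OF w] by simp
    have "0 \<le> ip t t - (ip t w)\<^sup>2 / ip w w"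
      using q[of "- ip t w / ip w w"] False by (simp add: power2_eq_square)
    then show ?thesis using pos by (simp add: pos_divide_le_eq)
  qed
qed

lemma ip_null:
  assumes "t \<in> dominated_vec" "w \<in> dominated_vec" "ip t t = 0"
  shows "ip t w = 0"
  using ip_cauchy_schwarz[OF assms(1,2)] assms(3) by simp

lemma null_apply:
  assumes "t \<in> dominated_vec" "X \<in> bops UNIV" "ip t t = 0"
  shows "ip (\<lambda>v. blinfun_apply X (t v)) (\<lambda>v. blinfun_apply X (t v)) = 0"
  unfolding ip_apply[OF assms(2)] by (rule ip_null[OF assms(1) _ assms(3)]) (intro dominated_vec_intros assms)

lemma null_add:
  assumes "t \<in> dominated_vec" "u \<in> dominated_vec" "ip t t = 0" "ip u u = 0"
  shows "ip (\<lambda>v. t v + u v) (\<lambda>v. t v + u v) = 0"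
  using assms by (simp add: ip_add_sq ip_null)

lemma sum_ip:
  assumes "\<And>i. i \<in> I \<Longrightarrow> t i \<in> dominated_vec"
  shows "(\<lambda>v. \<Sum>i\<in>I. (norm (t i v))\<^sup>2) \<in> dominated \<and> (\<Sum>i\<in>I. ip (t i) (t i)) = s (\<lambda>v. \<Sum>i\<in>I. (norm (t i v))\<^sup>2)"
  using assms
proof (induction I rule: infinite_finite_induct)
  case (insert i I)
  have d: "(\<lambda>v. (norm (t i v))\<^sup>2) \<in> dominated"
    using dominated_inner[of "t i" "t i"] insert by (simp add: power2_norm_eq_inner)
  have e: "(\<lambda>v. \<Sum>i\<in>insert i I. (norm (t i v))\<^sup>2) = (\<lambda>v. (norm (t i v))\<^sup>2) + (\<lambda>v. \<Sum>i\<in>I. (norm (t i v))\<^sup>2)"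
    using insert by (simp add: plus_fun_def)
  show ?case
    unfolding e using insert d subspace_add[OF subspace_dominated d] s_add[OF d]
    by (simp add: ip_def power2_norm_eq_inner)
qed (use subspace_0[OF subspace_dominated] s_scale[OF subspace_0[OF subspace_dominated], of 0]
    in \<open>simp_all add: zero_fun_def scaleR_fun_def\<close>)

text \<open>Positivity of \<open>s\<close> lifts an inequality valid at every index
  \<open>v\<close>; in this way a \<open>mat_bound\<close> on \<open>'f\<close> becomes one on
  Stinespring vectors.\<close>

lemma sum_ip_mono:
  assumes t: "\<And>i. i \<in> I \<Longrightarrow> t i \<in> dominated_vec" and u: "\<And>j. j \<in> J \<Longrightarrow> u j \<in> dominated_vec"
    and le: "\<And>v. (\<Sum>i\<in>I. (norm (t i v))\<^sup>2) \<le> K * (\<Sum>j\<in>J. (norm (u j v))\<^sup>2)"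
  shows "(\<Sum>i\<in>I. ip (t i) (t i)) \<le> K * (\<Sum>j\<in>J. ip (u j) (u j))"
proof -
  let ?f = "\<lambda>v. \<Sum>i\<in>I. (norm (t i v))\<^sup>2" and ?g = "\<lambda>v. \<Sum>j\<in>J. (norm (u j v))\<^sup>2"
  have f: "?f \<in> dominated" "(\<Sum>i\<in>I. ip (t i) (t i)) = s ?f" using sum_ip[of I t] t by auto
  have g: "?g \<in> dominated" "(\<Sum>j\<in>J. ip (u j) (u j)) = s ?g" using sum_ip[of J u] u by auto
  have d: "K *\<^sub>R ?g \<in> dominated" "(-1) *\<^sub>R ?f \<in> dominated"
    using f g subspace_scale[OF subspace_dominated] by blast+
  have "0 \<le> s (K *\<^sub>R ?g + (-1) *\<^sub>R ?f)"
    by (rule s_pos) (use subspace_add[OF subspace_dominated d] le in \<open>auto simp: scaleR_fun_def plus_fun_def\<close>)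
  also have "\<dots> = K * s ?g - s ?f" unfolding s_add[OF d] s_scale[OF g(1)] s_scale[OF f(1)] by simp
  finally show ?thesis using f g by simp
qed

section \<open>Complex form of the semi-inner product\<close>

definition cip :: "('u set \<times> ('u \<Rightarrow> 'f) \<Rightarrow> 'f) \<Rightarrow> ('u set \<times> ('u \<Rightarrow> 'f) \<Rightarrow> 'f) \<Rightarrow> complex" where
  "cip t t' = Complex (ip t t') (ip t (\<lambda>v. \<i> *\<^sub>C t' v))"

lemma Re_cip [simp]: "Re (cip t t') = ip t t'"
  by (simp add: cip_def)

lemma cip_add_left:
  "t \<in> dominated_vec \<Longrightarrow> u \<in> dominated_vec \<Longrightarrow> w \<in> dominated_vec \<Longrightarrow> cip (\<lambda>v. t v + u v) w = cip t w + cip u w"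
  by (simp add: cip_def ip_add_left dominated_vec_intros complex_eq_iff)

lemma cip_add_right:
  "t \<in> dominated_vec \<Longrightarrow> u \<in> dominated_vec \<Longrightarrow> w \<in> dominated_vec \<Longrightarrow> cip w (\<lambda>v. t v + u v) = cip w t + cip w u"
  by (simp add: cip_def ip_add_right dominated_vec_intros complex_eq_iff scaleC_add_right)

lemma ip_scaleC_right_Complex:
  assumes "t \<in> dominated_vec" "w \<in> dominated_vec"
  shows "ip t (\<lambda>v. c *\<^sub>C w v) = Re c * ip t w + Im c * ip t (\<lambda>v. \<i> *\<^sub>C w v)"
proof -
  have "c *\<^sub>C w v = Re c *\<^sub>R w v + Im c *\<^sub>R (\<i> *\<^sub>C w v)" for v
    unfolding scaleR_scaleC scaleC_scaleC scaleC_add_left[symmetric] by (simp add: complex_eq_iff)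
  then show ?thesis
    using assms by (simp add: ip_add_right ip_scaleR_right dominated_vec_intros)
qed

lemma cip_scaleC_right:
  assumes "t \<in> dominated_vec" "w \<in> dominated_vec"
  shows "cip t (\<lambda>v. c *\<^sub>C w v) = cnj c * cip t w"
  using ip_scaleC_right_Complex[OF assms, of c] ip_scaleC_right_Complex[OF assms, of "\<i> * c"]
  by (simp add: cip_def complex_eq_iff scaleC_scaleC)

lemma cip_scaleC_left:
  assumes "t \<in> dominated_vec" "w \<in> dominated_vec"
  shows "cip (\<lambda>v. c *\<^sub>C t v) w = c * cip t w"
proof -
  have "cip (\<lambda>v. c *\<^sub>C t v) w = cip t (\<lambda>v. cnj c *\<^sub>C w v)"
    by (simp add: cip_def ip_scaleC_left scaleC_scaleC mult.commute)
  then show ?thesis using cip_scaleC_right[OF assms, of "cnj c"] by simp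
qed

lemma cip_sum_left:
  assumes "\<And>i. i \<in> I \<Longrightarrow> t i \<in> dominated_vec" "w \<in> dominated_vec"
  shows "cip (\<lambda>v. \<Sum>i\<in>I. t i v) w = (\<Sum>i\<in>I. cip (t i) w)"
proof -
  have z: "cip (\<lambda>v. 0) w = 0"
    using cip_scaleC_left[OF dominated_vec_ev assms(2), of 0] by simp
  show ?thesis
    using assms(1)
    by (induction I rule: infinite_finite_induct) (auto simp: z cip_add_left assms(2) dominated_vec_sum)
qed

lemma cip_k:
  assumes "b \<in> B"
  shows "cip (\<lambda>v. blinfun_apply (k b) (ev v \<xi>)) (\<lambda>v. ev v \<eta>) = cinner (blinfun_apply (\<sigma> b) \<xi>) \<eta>"
  using ip_k[OF assms, of \<xi> "\<i> *\<^sub>C \<eta>"] by (simp add: cip_def ip_k assms cinner_eq_Complex ev_scaleC)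

lemma norm_cip_le:
  assumes t: "t \<in> dominated_vec" and w: "w \<in> dominated_vec"
  shows "cmod (cip t w) \<le> sqrt (ip t t) * sqrt (ip w w)"
proof -
  define c where "c = (if cip t w = 0 then 1 else cnj (cip t w) / cmod (cip t w))"
  have cc: "cnj c * c = 1"
    by (simp add: c_def complex_norm_square[symmetric] power2_eq_square mult.commute norm_divide)
  have "c * cip t w = cmod (cip t w)"
    by (simp add: c_def mult.commute[of _ "cip t w"] complex_norm_square[symmetric] power2_eq_square)
  then have "cip (\<lambda>v. c *\<^sub>C t v) w = cmod (cip t w)"
    by (simp add: cip_scaleC_left t w)
  then have e: "cmod (cip t w) = ip (\<lambda>v. c *\<^sub>C t v) w"
    by (metis Re_cip Re_complex_of_real)
  have "ip (\<lambda>v. c *\<^sub>C t v) (\<lambda>v. c *\<^sub>C t v) = ip t t"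
    by (simp add: ip_scaleC_left scaleC_scaleC cc)
  then have "(cmod (cip t w))\<^sup>2 \<le> ip t t * ip w w"
    using ip_cauchy_schwarz[OF dominated_vec_scaleC[OF t, of c] w] by (simp add: e)
  then show ?thesis by (metis real_le_rsqrt real_sqrt_mult)
qed

end

subsection \<open>Maximality forces reduction\<close>

locale maximal_extension = positive_extension B k \<sigma> M \<E> s
  for B :: "'b::chilbert_space op set" and k :: "'b op \<Rightarrow> 'f::chilbert_space op"
    and \<sigma> :: "'b op \<Rightarrow> 'u ell2 op" and M \<E> s +
  fixes A :: "'h::chilbert_space op set" and \<theta> :: "'h op \<Rightarrow> 'b op"
  assumes A: "csubspace A" and \<theta>_linear: "clinear_on A \<theta>" and \<theta>_in: "\<And>a. a \<in> A \<Longrightarrow> \<theta> a \<in> B"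
    and \<theta>_cc: "\<And>n x r. (\<And>i j. i < n \<Longrightarrow> j < n \<Longrightarrow> x i j \<in> A) \<Longrightarrow> 0 \<le> r \<Longrightarrow> mat_bound n x r \<Longrightarrow>
      mat_bound n (\<lambda>i j. \<theta> (x i j)) r"
    and maximal: "maximal_map TYPE('u ell2) A M (\<lambda>a. \<sigma> (\<theta> a))"
    and essential: "essential_space A (\<lambda>a. \<sigma> (\<theta> a)) M = M"
    and infinite_index: "infinite (UNIV :: 'u set)"
begin

lemma \<theta>_add: "a \<in> A \<Longrightarrow> b \<in> A \<Longrightarrow> \<theta> (a + b) = \<theta> a + \<theta> b"
  and \<theta>_scaleC: "a \<in> A \<Longrightarrow> \<theta> (c *\<^sub>C a) = c *\<^sub>C \<theta> a"
  using \<theta>_linear by (auto simp: clinear_on_def)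

text \<open>Bessel's inequality for the copy of \<open>M\<close> together with \<open>t0\<close>:
  expand the square of \<open>t\<close> minus \<open>?w\<close>. The bound
  \<open>ip t0 t0 \<le> 1\<close> can replace a unit vector, as it only lowers the square of
  \<open>?w\<close>; null vectors are thereby included.\<close>

lemma bessel:
  assumes t: "t \<in> dominated_vec" and t0: "t0 \<in> dominated_vec"
    and orth: "\<And>y. ip t0 (\<lambda>v. ev v y) = 0" and t01: "ip t0 t0 \<le> 1"
    and z: "z \<in> M" "\<And>y. ip t (\<lambda>v. ev v y) = inner z y"
  shows "(norm z)\<^sup>2 + (cmod (cip t t0))\<^sup>2 \<le> ip t t"
proof -
  let ?d = "cip t t0"
  let ?w = "\<lambda>v. ev v z + ?d *\<^sub>C t0 v"
  note [simp] = t t0 dominated_vec_intros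
  have "cip t (\<lambda>v. ?d *\<^sub>C t0 v) = complex_of_real ((cmod ?d)\<^sup>2)"
    unfolding complex_norm_square by (simp add: cip_scaleC_right mult.commute)
  then have "ip t (\<lambda>v. ?d *\<^sub>C t0 v) = (cmod ?d)\<^sup>2" by (metis Re_cip Re_complex_of_real)
  then have tw: "ip t ?w = (norm z)\<^sup>2 + (cmod ?d)\<^sup>2"
    by (simp add: ip_add_right z(2) power2_norm_eq_inner[of z])
  have e0: "ip (\<lambda>v. ev v z) (\<lambda>v. ?d *\<^sub>C t0 v) = 0"
    using orth[of "cnj ?d *\<^sub>C z"] by (simp add: ip_commute[of "\<lambda>v. ev v z"] ip_scaleC_left ev_scaleC)
  have "cip (\<lambda>v. ?d *\<^sub>C t0 v) (\<lambda>v. ?d *\<^sub>C t0 v) = complex_of_real ((cmod ?d)\<^sup>2) * cip t0 t0"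
    unfolding complex_norm_square by (simp add: cip_scaleC_left cip_scaleC_right mult.commute mult.left_commute)
  from arg_cong[OF this, of Re]
  have "ip (\<lambda>v. ?d *\<^sub>C t0 v) (\<lambda>v. ?d *\<^sub>C t0 v) = (cmod ?d)\<^sup>2 * ip t0 t0"
    by (simp only: Re_cip times_complex.sel(1) Re_complex_of_real Im_complex_of_real mult_zero_left diff_zero)
  also have "\<dots> \<le> (cmod ?d)\<^sup>2" using mult_left_mono[OF t01, of "(cmod ?d)\<^sup>2"] by simp
  finally have "ip ?w ?w \<le> (norm z)\<^sup>2 + (cmod ?d)\<^sup>2"
    by (simp add: ip_add_sq e0 ip_ev proj_id[OF M z(1)] power2_norm_eq_inner)
  moreover have "0 \<le> ip (\<lambda>v. t v - ?w v) (\<lambda>v. t v - ?w v)"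
    by (intro ip_nonneg) simp
  ultimately show ?thesis by (simp add: ip_diff_sq tw)
qed

theorem maximal_orthogonal:
  assumes t0: "t0 \<in> dominated_vec" and orth: "\<And>y. ip t0 (\<lambda>v. ev v y) = 0" and t01: "ip t0 t0 \<le> 1"
    and a0: "a \<in> A" and x0: "x \<in> M"
  shows "ip (\<lambda>v. blinfun_apply (k (\<theta> a)) (ev v x)) t0 = 0"
    and "ip (\<lambda>v. blinfun_apply (k (\<theta> a)) (t0 v)) (\<lambda>v. ev v x) = 0"
proof -
  text \<open>Were \<open>t\<^sub>0\<close> a unit vector of a Hilbert space in which the vectors \<open>ev \<xi>\<close>, \<open>\<xi> \<in> M\<close>, form an
    isometric copy of \<open>M\<close>, then \<open>\<rho>\<close> below would be the compression of \<open>k \<circ> \<theta>\<close> to \<open>M \<oplus> \<complex>t\<^sub>0\<close>.\<close>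
  note [simp] = t0 dominated_vec_intros
  have Msub: "csubspace M" and Mcl: "closed M" using M by (auto simp: closed_csubspace_def)
  obtain h :: "'u \<Rightarrow> 'u" and e where h: "inj h" and ee: "cinner e e = 1" and pe: "pull h e = 0"
    and dec: "\<And>\<psi>. \<psi> = push h (pull h \<psi>) + cinner \<psi> e *\<^sub>C e"
    using exists_shift[OF infinite_index] by blast
  define W where "W = push h"
  define Ws where "Ws = pull h"
  have WsW: "Ws (W y) = y" for y by (simp add: W_def Ws_def pull_push[OF h])
  have W_add: "W (y + y') = W y + W y'" and W_scale: "W (c *\<^sub>C y) = c *\<^sub>C W y"
    and Ws_add: "Ws (y + y') = Ws y + Ws y'" and Ws_scale: "Ws (c *\<^sub>C y) = c *\<^sub>C Ws y" for y y' c
    by (simp_all add: W_def Ws_def push_add[OF h] push_scaleC[OF h] pull_add[OF h] pull_scaleC[OF h])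
  have WWs: "cinner (W y) u = cinner y (Ws u)" for y u by (simp add: W_def Ws_def cinner_push[OF h])
  have Wse: "Ws e = 0" using pe by (simp add: Ws_def)
  have We: "cinner (W y) e = 0" "cinner e (W y) = 0" for y
    using WWs[of y e] cinner_commute[of e "W y"] by (simp_all add: Wse)
  have nW: "norm (W y) = norm y" for y by (simp add: W_def norm_push[OF h])
  have norm_dec: "(norm (W y + c *\<^sub>C e))\<^sup>2 = (norm y)\<^sup>2 + (cmod c)\<^sup>2" for y c
  proof -
    have "inner (W y) (c *\<^sub>C e) = 0" by (simp flip: Re_cinner add: cinner_scaleC_right We)
    moreover have "(norm e)\<^sup>2 = 1" using ee unfolding cinner_self of_real_eq_1_iff .
    then have "norm e = 1" using norm_ge_zero[of e] by (auto simp: power2_eq_1_iff)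
    ultimately show ?thesis by (simp add: norm_add_sq nW norm_scaleC)
  qed
  have norm_u: "(norm u)\<^sup>2 = (norm (Ws u))\<^sup>2 + (cmod (cinner u e))\<^sup>2" for u
    using norm_dec[of "Ws u" "cinner u e"] dec[of u] by (simp add: W_def Ws_def)

  define \<pi> where "\<pi> a = \<sigma> (\<theta> a)" for a
  define T where "T a = (\<lambda>v. blinfun_apply (k (\<theta> a)) (t0 v))" for a
  have Tv: "T a \<in> dominated_vec" for a by (simp add: T_def)
  \<comment> \<open>\<open>g a\<close> will be the component in \<open>M\<close> of
    \<open>k (\<theta> a)\<close> applied to \<open>t0\<close>. On representatives there is no
    projection, so Riesz produces it from the pairing of \<open>T a\<close> with \<open>ev\<close>,
    bounded because \<open>ev\<close> does not increase norms.\<close>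
  have "\<exists>g. \<forall>z. cinner g z = cip (T a) (\<lambda>v. ev v z)" for a
  proof -
    have "cmod (cnj (cip (T a) (\<lambda>v. ev v z))) \<le> sqrt (ip (T a) (T a)) * norm z" for z
    proof -
      have "ip (\<lambda>v. ev v z) (\<lambda>v. ev v z) = inner (proj M z) (proj M z)"
        unfolding ip_ev using cinner_proj_in[OF M proj_in[OF M], of z z] cinner_proj[OF M, of z z]
        by (metis Re_cinner cinner_proj[OF M] proj_id[OF M] proj_in[OF M])
      then have "sqrt (ip (\<lambda>v. ev v z) (\<lambda>v. ev v z)) \<le> norm z"
        using norm_proj_le[OF M, of z] by (simp add: norm_eq_sqrt_inner)
      then show ?thesis
        using norm_cip_le[OF Tv dominated_vec_ev, of a z] ip_nonneg[OF Tv, of a]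
          mult_left_mono[of "sqrt (ip (\<lambda>v. ev v z) (\<lambda>v. ev v z))" "norm z" "sqrt (ip (T a) (T a))"]
        by simp
    qed
    moreover have "cnj (cip (T a) (\<lambda>v. ev v (z + z'))) = cnj (cip (T a) (\<lambda>v. ev v z)) + cnj (cip (T a) (\<lambda>v. ev v z'))" for z z'
      by (simp add: ev_add cip_add_right Tv)
    moreover have "cnj (cip (T a) (\<lambda>v. ev v (c *\<^sub>C z))) = c * cnj (cip (T a) (\<lambda>v. ev v z))" for c z
      by (simp add: ev_scaleC cip_scaleC_right Tv)
    ultimately obtain g where "\<And>z. cnj (cip (T a) (\<lambda>v. ev v z)) = cinner z g"
      using riesz_representation[of "\<lambda>z. cnj (cip (T a) (\<lambda>v. ev v z))"] by metis
    then have "cinner g z = cip (T a) (\<lambda>v. ev v z)" for z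
      by (metis cinner_commute complex_cnj_cnj)
    then show ?thesis by blast
  qed
  then obtain g where g: "\<And>a z. cinner (g a) z = cip (T a) (\<lambda>v. ev v z)" by metis
  have gM: "g a \<in> M" for a
  proof -
    let ?y = "g a - proj M (g a)"
    have y: "proj M ?y = 0" by (rule proj_zero[OF M]) (simp add: proj_orth[OF M])
    have "ip (\<lambda>v. ev v ?y) (\<lambda>v. ev v ?y) = 0" by (simp add: ip_ev y)
    then have "cip (T a) (\<lambda>v. ev v ?y) = 0"
      using norm_cip_le[OF Tv dominated_vec_ev, of a ?y] by simp
    moreover have "cinner (proj M (g a)) ?y = 0" using cinner_proj[OF M, of "g a" ?y] y by simp
    ultimately have "cinner ?y ?y = 0" by (simp add: cinner_diff_left g)
    then have "g a = proj M (g a)" by (simp add: cinner_self)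
    then show ?thesis using proj_in[OF M, of "g a"] by simp
  qed

  \<comment> \<open>The entries of \<open>\<rho> a\<close> on \<open>M\<close> plus the line of
    \<open>e\<close>: \<open>\<pi> a\<close> upper left, \<open>g a\<close> upper right,
    \<open>\<gamma> a\<close> lower left, \<open>\<delta> a\<close> lower right. The two components
    of \<open>u\<close> are \<open>p u\<close> and \<open>cinner u e\<close>.\<close>
  define \<gamma> where "\<gamma> a y = cip (\<lambda>v. blinfun_apply (k (\<theta> a)) (ev v y)) t0" for a y
  define \<delta> where "\<delta> a = cip (T a) t0" for a
  define p where "p u = proj M (Ws u)" for u
  define zz where "zz a u = blinfun_apply (\<pi> a) (p u) + cinner u e *\<^sub>C g a" for a u
  define dd where "dd a u = \<gamma> a (p u) + cinner u e * \<delta> a" for a u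
  define R where "R a u = W (zz a u) + dd a u *\<^sub>C e" for a u
  have pM: "p u \<in> M" for u by (simp add: p_def M)
  have p_add: "p (u + u') = p u + p u'" and p_scale: "p (c *\<^sub>C u) = c *\<^sub>C p u" for u u' c
    by (simp_all add: p_def Ws_add Ws_scale proj_add[OF M] proj_scaleC[OF M])
  have \<pi>M: "a \<in> A \<Longrightarrow> blinfun_apply (\<pi> a) y \<in> M" for a y
    unfolding \<pi>_def by (rule \<sigma>_range[OF \<theta>_in])
  have zzM: "a \<in> A \<Longrightarrow> zz a u \<in> M" for a u
    unfolding zz_def by (intro csubspaceD[OF Msub] \<pi>M gM)
  have \<pi>_scale: "a \<in> A \<Longrightarrow> blinfun_apply (\<pi> a) (c *\<^sub>C y) = c *\<^sub>C blinfun_apply (\<pi> a) y" for a c y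
    unfolding \<pi>_def by (rule \<sigma>_scaleC[OF \<theta>_in])
  have \<gamma>_add: "\<gamma> a (y + y') = \<gamma> a y + \<gamma> a y'" for a y y'
    by (simp add: \<gamma>_def ev_add blinfun.add_right cip_add_left)
  have \<gamma>_scale: "\<gamma> a (c *\<^sub>C y) = c * \<gamma> a y" if "a \<in> A" for a c y
    by (simp add: \<gamma>_def ev_scaleC k_scaleC[OF \<theta>_in[OF that]] cip_scaleC_left)
  have R_add: "R a (u + u') = R a u + R a u'" for a u u'
    by (simp add: R_def zz_def dd_def p_add blinfun.add_right cinner_add_left W_add \<gamma>_add
        scaleC_add_left algebra_simps)
  have R_scale: "R a (c *\<^sub>C u) = c *\<^sub>C R a u" if "a \<in> A" for a c u
    using that by (simp add: R_def zz_def dd_def p_scale \<pi>_scale cinner_scaleC_left \<gamma>_scale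
        flip: W_scale add: W_add scaleC_add_right scaleC_scaleC algebra_simps)

  \<comment> \<open>Complete contractivity in three inequalities: \<open>bessel\<close> for cutting
    down to two components, \<open>sum_ip_mono\<close> for the bound carried by \<open>k\<close>
    after \<theta>, and ip t0 t0 \<le> 1 with contractivity of \<open>p\<close> for passing from
    \<open>u j\<close> to its Stinespring vector \<open>w j\<close>.\<close>
  have mat: "(\<Sum>i<n. (norm (\<Sum>j<n. R (b i j) (u j)))\<^sup>2) \<le> r\<^sup>2 * (\<Sum>j<n. (norm (u j))\<^sup>2)"
    if b: "\<And>i j. i < n \<Longrightarrow> j < n \<Longrightarrow> b i j \<in> A" and bd: "mat_bound n b r" and r: "0 \<le> r" for n b r u
  proof -
    define w where "w j = (\<lambda>v. ev v (p (u j)) + cinner (u j) e *\<^sub>C t0 v)" for j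
    define t where "t i = (\<lambda>v. \<Sum>j<n. blinfun_apply (k (\<theta> (b i j))) (w j v))" for i
    define z where "z i = (\<Sum>j<n. zz (b i j) (u j))" for i
    define d where "d i = (\<Sum>j<n. dd (b i j) (u j))" for i
    have wv: "w j \<in> dominated_vec" for j by (simp add: w_def)
    have tv: "t i \<in> dominated_vec" for i unfolding t_def by (intro dominated_vec_intros wv)
    have W_sum: "W (\<Sum>j\<in>J. f j) = (\<Sum>j\<in>J. W (f j))" for J :: "nat set" and f
      using W_scale[of 0 0] by (induction J rule: infinite_finite_induct) (auto simp: W_add)
    have Rzd: "(\<Sum>j<n. R (b i j) (u j)) = W (z i) + d i *\<^sub>C e" for i
      by (simp add: R_def z_def d_def sum.distrib W_sum scaleC_sum_left)
    have kw: "(\<lambda>v. blinfun_apply (k (\<theta> (b i j))) (w j v)) = (\<lambda>v. blinfun_apply (k (\<theta> (b i j))) (ev v (p (u j)))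
        + cinner (u j) e *\<^sub>C T (b i j) v)" if "i < n" "j < n" for i j
      using that by (simp add: w_def T_def blinfun.add_right k_scaleC[OF \<theta>_in[OF b]])
    have bes: "(norm (z i))\<^sup>2 + (cmod (d i))\<^sup>2 \<le> ip (t i) (t i)" if i: "i < n" for i
    proof -
      have "ip (t i) (\<lambda>v. ev v y) = inner (z i) y" for y
      proof -
        have "cip (t i) (\<lambda>v. ev v y) = (\<Sum>j<n. cip (\<lambda>v. blinfun_apply (k (\<theta> (b i j))) (w j v)) (\<lambda>v. ev v y))"
          unfolding t_def by (rule cip_sum_left) (use wv in auto)
        also have "\<dots> = (\<Sum>j<n. cinner (zz (b i j) (u j)) y)"
          using i by (intro sum.cong refl)
            (simp add: kw cip_add_left cip_scaleC_left Tv cip_k \<theta>_in b zz_def \<pi>_def cinner_add_left cinner_scaleC_left g)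
        finally have "cip (t i) (\<lambda>v. ev v y) = cinner (z i) y" by (simp add: z_def cinner_sum_left)
        then show ?thesis by (metis Re_cip Re_cinner)
      qed
      moreover have "cip (t i) t0 = d i"
      proof -
        have "cip (t i) t0 = (\<Sum>j<n. cip (\<lambda>v. blinfun_apply (k (\<theta> (b i j))) (w j v)) t0)"
          unfolding t_def by (rule cip_sum_left) (use wv in auto)
        also have "\<dots> = d i"
          unfolding d_def using i by (intro sum.cong refl)
            (simp add: kw cip_add_left cip_scaleC_left Tv dd_def \<gamma>_def \<delta>_def)
        finally show ?thesis .
      qed
      moreover have "z i \<in> M" unfolding z_def by (rule csubspace_sum[OF Msub]) (use i b zzM in auto)
      ultimately show ?thesis using bessel[OF tv t0 orth t01, of "z i" i] by simp
    qed
    have "(\<Sum>i<n. (norm (\<Sum>j<n. R (b i j) (u j)))\<^sup>2) = (\<Sum>i<n. (norm (z i))\<^sup>2 + (cmod (d i))\<^sup>2)"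
      by (simp only: Rzd norm_dec)
    also have "\<dots> \<le> (\<Sum>i<n. ip (t i) (t i))" by (intro sum_mono bes) auto
    also have "\<dots> \<le> r\<^sup>2 * (\<Sum>j<n. ip (w j) (w j))"
    proof (rule sum_ip_mono)
      have "mat_bound n (\<lambda>i j. \<theta> (b i j)) r" by (rule \<theta>_cc[OF b r bd])
      then have "mat_bound n (\<lambda>i j. k (\<theta> (b i j))) r"
        using completely_isometric_mat_bound[OF k_iso, of n "\<lambda>i j. \<theta> (b i j)" r] b \<theta>_in r by blast
      then show "(\<Sum>i<n. (norm (t i v))\<^sup>2) \<le> r\<^sup>2 * (\<Sum>j<n. (norm (w j v))\<^sup>2)" for v
        unfolding t_def by (rule mat_boundD)
    qed (use tv wv in auto)
    also have "\<dots> \<le> r\<^sup>2 * (\<Sum>j<n. (norm (u j))\<^sup>2)"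
    proof (intro mult_left_mono sum_mono)
      fix j
      let ?c = "cinner (u j) e"
      have "cip (\<lambda>v. ?c *\<^sub>C t0 v) (\<lambda>v. ?c *\<^sub>C t0 v) = complex_of_real ((cmod ?c)\<^sup>2) * cip t0 t0"
        unfolding complex_norm_square by (simp add: cip_scaleC_left cip_scaleC_right mult.commute mult.left_commute)
      from arg_cong[OF this, of Re]
      have "ip (\<lambda>v. ?c *\<^sub>C t0 v) (\<lambda>v. ?c *\<^sub>C t0 v) = (cmod ?c)\<^sup>2 * ip t0 t0"
        by (simp only: Re_cip times_complex.sel(1) Re_complex_of_real Im_complex_of_real mult_zero_left diff_zero)
      also have "\<dots> \<le> (cmod ?c)\<^sup>2" using mult_left_mono[OF t01, of "(cmod ?c)\<^sup>2"] by simp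
      finally have 1: "ip (\<lambda>v. ?c *\<^sub>C t0 v) (\<lambda>v. ?c *\<^sub>C t0 v) \<le> (cmod ?c)\<^sup>2" .
      have 2: "ip (\<lambda>v. ev v (p (u j))) (\<lambda>v. ?c *\<^sub>C t0 v) = 0"
        using orth[of "cnj ?c *\<^sub>C p (u j)"] by (simp add: ip_commute[of "\<lambda>v. ev v (p (u j))"] ip_scaleC_left ev_scaleC)
      have "(norm (p (u j)))\<^sup>2 \<le> (norm (Ws (u j)))\<^sup>2"
        unfolding p_def by (intro power_mono norm_proj_le[OF M]) auto
      then have "(norm (p (u j)))\<^sup>2 + (cmod ?c)\<^sup>2 \<le> (norm (u j))\<^sup>2" by (simp add: norm_u[of "u j"])
      moreover have "ip (\<lambda>v. ev v (p (u j))) (\<lambda>v. ev v (p (u j))) = (norm (p (u j)))\<^sup>2"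
        by (simp add: ip_ev proj_id[OF M pM] power2_norm_eq_inner)
      ultimately show "ip (w j) (w j) \<le> (norm (u j))\<^sup>2"
        using 1 2 unfolding w_def by (simp add: ip_add_sq)
    qed auto
    finally show ?thesis .
  qed

  have R_bl: "bounded_linear (R a)" if a: "a \<in> A" for a
  proof (rule bounded_linear_intro[where K = "norm a"])
    fix u
    have "(norm (R a u))\<^sup>2 \<le> (norm a)\<^sup>2 * (norm u)\<^sup>2"
      using mat[of 1 "\<lambda>i j. a" "norm a" "\<lambda>j. u"] a mat_bound_single[of "norm a" a] by simp
    then have "(norm (R a u))\<^sup>2 \<le> (norm u * norm a)\<^sup>2" by (simp add: power_mult_distrib mult.commute)
    then show "norm (R a u) \<le> norm u * norm a" by (rule power2_le_imp_le) simp
  qed (use a in \<open>auto simp: R_add R_scale scaleR_scaleC\<close>)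
  define \<rho> where "\<rho> a = Blinfun (R a)" for a
  have \<rho>_apply: "a \<in> A \<Longrightarrow> blinfun_apply (\<rho> a) u = R a u" for a u
    unfolding \<rho>_def by (simp add: bounded_linear_Blinfun_apply R_bl)
  \<comment> \<open>The image of \<open>M\<close> under \<open>W\<close> together with the line
    through \<open>e\<close>.\<close>
  define K where "K = {u. Ws u \<in> M}"
  have Ws0: "Ws 0 = 0" using Ws_scale[of 0 0] by simp
  have W0: "W 0 = 0" using W_scale[of 0 0] by simp
  have \<rho>_bops: "\<rho> a \<in> bops UNIV" if "a \<in> A" for a
    using that by (simp add: bops_UNIV \<rho>_apply R_scale)

  have dil: "dilation A M (\<lambda>a. \<sigma> (\<theta> a)) K W \<rho>"
    unfolding dilation_def
  proof (intro conjI ballI)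
    have "closed K"
      unfolding K_def using Mcl continuous_closed_vimage[of M Ws]
        linear_continuous_at[OF bounded_linear_pull[OF h]] by (simp add: Ws_def vimage_def)
    then show "closed_csubspace K"
      unfolding closed_csubspace_def K_def
      by (auto intro!: csubspaceI csubspaceD[OF Msub] simp: Ws0 Ws_add Ws_scale)
    show "completely_contractive A \<rho>"
      unfolding completely_contractive_def
    proof (intro conjI allI impI)
      have kA: "k (\<theta> (a + b)) = k (\<theta> a) + k (\<theta> b)" if "a \<in> A" "b \<in> A" for a b
        using that by (simp add: \<theta>_add k_simps \<theta>_in)
      have kS: "k (\<theta> (c *\<^sub>C a)) = c *\<^sub>C k (\<theta> a)" if "a \<in> A" for a c
        using that by (simp add: \<theta>_scaleC k_simps \<theta>_in)
      have TA: "T (a + b) = (\<lambda>v. T a v + T b v)" if "a \<in> A" "b \<in> A" for a b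
        using that by (simp add: T_def kA blinfun.add_left)
      have TS: "T (c *\<^sub>C a) = (\<lambda>v. c *\<^sub>C T a v)" if "a \<in> A" for a c
        using that by (simp add: T_def kS blinfun_apply_scaleC)
      have gA: "g (a + b) = g a + g b" if "a \<in> A" "b \<in> A" for a b
        by (rule cinner_ext) (simp add: g TA that cinner_add_left cip_add_left Tv)
      have gS: "g (c *\<^sub>C a) = c *\<^sub>C g a" if "a \<in> A" for a c
        by (rule cinner_ext) (simp add: g TS that cinner_scaleC_left cip_scaleC_left Tv)
      have \<pi>A: "\<pi> (a + b) = \<pi> a + \<pi> b" if "a \<in> A" "b \<in> A" for a b
        using that by (simp add: \<pi>_def \<theta>_add \<sigma>_simps \<theta>_in)
      have \<pi>S: "\<pi> (c *\<^sub>C a) = c *\<^sub>C \<pi> a" if "a \<in> A" for a c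
        using that by (simp add: \<pi>_def \<theta>_scaleC \<sigma>_simps \<theta>_in)
      have \<gamma>A: "\<gamma> (a + b) y = \<gamma> a y + \<gamma> b y" if "a \<in> A" "b \<in> A" for a b y
        using that by (simp add: \<gamma>_def kA blinfun.add_left cip_add_left)
      have \<gamma>S: "\<gamma> (c *\<^sub>C a) y = c * \<gamma> a y" if "a \<in> A" for a c y
        using that by (simp add: \<gamma>_def kS blinfun_apply_scaleC cip_scaleC_left)
      have \<delta>A: "\<delta> (a + b) = \<delta> a + \<delta> b" if "a \<in> A" "b \<in> A" for a b
        using that by (simp add: \<delta>_def TA cip_add_left Tv)
      have \<delta>S: "\<delta> (c *\<^sub>C a) = c * \<delta> a" if "a \<in> A" for a c
        using that by (simp add: \<delta>_def TS cip_scaleC_left Tv)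
      have "R (a + b) u = R a u + R b u" if "a \<in> A" "b \<in> A" for a b u
        using that by (simp add: R_def zz_def dd_def \<pi>A \<gamma>A \<delta>A gA blinfun.add_left W_add
            scaleC_add_left scaleC_add_right algebra_simps)
      moreover have "R (c *\<^sub>C a) u = c *\<^sub>C R a u" if "a \<in> A" for c a u
        using that by (simp add: R_def zz_def dd_def \<pi>S \<gamma>S \<delta>S gS blinfun_apply_scaleC
            flip: W_scale add: W_add scaleC_add_right scaleC_scaleC algebra_simps)
      ultimately show "clinear_on A \<rho>"
        unfolding clinear_on_def
        by (auto intro!: blinfun_eqI simp: \<rho>_apply csubspaceD[OF A] blinfun.add_left blinfun_apply_scaleC)
      fix n and b :: "nat \<Rightarrow> nat \<Rightarrow> 'h op" assume b: "\<forall>i<n. \<forall>j<n. b i j \<in> A"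
      have "mat_bound n (\<lambda>i j. \<rho> (b i j)) (opmat_norm n b)"
        unfolding mat_bound_def
      proof
        fix u :: "nat \<Rightarrow> 'u ell2"
        have "(\<Sum>i<n. (norm (\<Sum>j<n. blinfun_apply (\<rho> (b i j)) (u j)))\<^sup>2) = (\<Sum>i<n. (norm (\<Sum>j<n. R (b i j) (u j)))\<^sup>2)"
          using b by (simp add: \<rho>_apply)
        also have "\<dots> \<le> (opmat_norm n b)\<^sup>2 * (\<Sum>j<n. (norm (u j))\<^sup>2)"
          using b by (intro mat mat_bound_opmat_norm opmat_norm_nonneg) auto
        finally show "(\<Sum>i<n. (norm (\<Sum>j<n. blinfun_apply (\<rho> (b i j)) (u j)))\<^sup>2) \<le> (opmat_norm n b)\<^sup>2 * (\<Sum>j<n. (norm (u j))\<^sup>2)" .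
      qed
      then show "opmat_norm n (\<lambda>i j. \<rho> (b i j)) \<le> opmat_norm n b"
        by (intro opmat_norm_le opmat_norm_nonneg)
    qed
    show "\<rho> ` A \<subseteq> bops K"
    proof (rule image_subsetI)
      fix a assume a: "a \<in> A"
      have "R a u \<in> K" for u
        using zzM[OF a, of u] by (simp add: K_def R_def Ws_add Ws_scale WsW Wse)
      moreover have "R a u = 0" if u: "\<forall>y\<in>K. cinner u y = 0" for u
      proof -
        have "e \<in> K" by (simp add: K_def Wse csubspaceD[OF Msub])
        then have "cinner u e = 0" using u by blast
        moreover have "p u = 0"
          unfolding p_def
        proof (rule proj_zero[OF M])
          fix z assume "z \<in> M"
          then have "W z \<in> K" by (simp add: K_def WsW)
          then have "cinner (W z) u = 0" using u cinner_commute[of "W z" u] by simp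
          then show "cinner (Ws u) z = 0" using WWs[of z u] cinner_commute[of "Ws u" z] by simp
        qed
        moreover have "\<gamma> a 0 = 0" using \<gamma>_scale[OF a, of 0 0] by simp
        ultimately show ?thesis by (simp add: R_def zz_def dd_def W0)
      qed
      ultimately show "\<rho> a \<in> bops K"
        unfolding bops_def using a by (auto simp: \<rho>_apply R_scale)
    qed
    show "clinear_on M W" by (simp add: clinear_on_def W_add W_scale)
    show "W y \<in> K" "norm (W y) = norm y" if "y \<in> M" for y
      using that by (simp_all add: K_def WsW nW)
    show "cinner (blinfun_apply (\<rho> a) (W y)) (W y') = cinner (blinfun_apply (\<sigma> (\<theta> a)) y) y'"
      if "a \<in> A" "y \<in> M" "y' \<in> M" for a y y'
      using that by (simp add: \<rho>_apply R_def zz_def p_def WsW proj_id[OF M] cinner_add_left cinner_scaleC_left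
          We WWs Wse \<pi>_def)
  qed
  then have red: "reduces (\<rho> ` A) (W ` M)"
    using maximal essential by (auto simp: maximal_map_def)
  have px: "p (W x) = x" using x0 by (simp add: p_def WsW proj_id[OF M])
  \<comment> \<open>Invariance of the copy of \<open>M\<close> kills the lower left corner,
    invariance under the adjoint the upper right one; these are the two claims.\<close>
  have "blinfun_apply (\<rho> a) (W x) \<in> W ` M" using red a0 x0 unfolding reduces_def by blast
  then obtain m where "blinfun_apply (\<rho> a) (W x) = W m" by blast
  then have "cinner (R a (W x)) e = 0" by (simp add: We flip: \<rho>_apply[OF a0])
  then have "\<gamma> a x = 0"
    by (simp add: R_def dd_def px We ee cinner_add_left cinner_scaleC_left)
  then show "ip (\<lambda>v. blinfun_apply (k (\<theta> a)) (ev v x)) t0 = 0"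
    unfolding \<gamma>_def by (metis Re_cip zero_complex.sel(1))
  have "blinfun_apply (adj (\<rho> a)) (W x) \<in> W ` M" using red a0 x0 unfolding reduces_def by blast
  then obtain m' where "blinfun_apply (adj (\<rho> a)) (W x) = W m'" by blast
  then have "cinner e (blinfun_apply (adj (\<rho> a)) (W x)) = 0" by (simp add: We)
  then have "cinner (R a e) (W x) = 0" by (simp add: cinner_adj_right[OF \<rho>_bops[OF a0]] \<rho>_apply[OF a0])
  moreover have "p e = 0" by (simp add: p_def Wse proj_id[OF M] csubspaceD[OF Msub])
  ultimately have "cinner (g a) x = 0"
    by (simp add: R_def zz_def ee We cinner_add_left cinner_scaleC_left WWs WsW)
  then show "ip (\<lambda>v. blinfun_apply (k (\<theta> a)) (t0 v)) (\<lambda>v. ev v x) = 0"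
    unfolding g T_def by (metis Re_cip zero_complex.sel(1))
qed

end

section \<open>Intertwining and the multiplicative domain\<close>

lemma cstar_generated_subset: "cstar_algebra D \<Longrightarrow> X \<subseteq> D \<Longrightarrow> cstar_generated X \<subseteq> D"
  by (auto simp: cstar_generated_def)

text \<open>\<open>C\<close> will be the full crossed product, \<phi> the epimorphism onto the
  envelope and \<open>S\<close> the monomials with coefficient in \<open>A\<close>; the squares in
  \<open>S_sq\<close> lie in the copy of the coefficient algebra generated by the image of
  \<theta>.\<close>

locale crossed_extension = maximal_extension B k \<sigma> M \<E> s A \<theta>
  for B :: "'b::chilbert_space op set" and k :: "'b op \<Rightarrow> 'f::chilbert_space op"
    and \<sigma> :: "'b op \<Rightarrow> 'u ell2 op" and M \<E> s and A :: "'h::chilbert_space op set" and \<theta> +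
  fixes C :: "'b op set" and \<phi> :: "'b op \<Rightarrow> 'f op" and S :: "'b op set"
  assumes \<phi>: "star_representation C \<phi>" and \<sigma>: "star_representation C \<sigma>"
    and BC: "B \<subseteq> C" and \<phi>_k: "\<And>b. b \<in> B \<Longrightarrow> \<phi> b = k b"
    and SB: "S \<subseteq> B" and gen: "C \<subseteq> cstar_generated S"
    and S_sq: "\<And>b. b \<in> S \<Longrightarrow> adj b o\<^sub>L b \<in> cstar_generated (\<theta> ` A)"
      "\<And>b. b \<in> S \<Longrightarrow> b o\<^sub>L adj b \<in> cstar_generated (\<theta> ` A)"
    and \<sigma>_range': "\<And>c x. c \<in> C \<Longrightarrow> blinfun_apply (\<sigma> c) x \<in> M"
    and \<sigma>_proj': "\<And>c x. c \<in> C \<Longrightarrow> blinfun_apply (\<sigma> c) (proj M x) = blinfun_apply (\<sigma> c) x"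
begin

interpretation \<phi>: star_representation C \<phi> by (rule \<phi>)
interpretation \<sigma>: star_representation C \<sigma> by (rule \<sigma>)

text \<open>With V the map sending x to the class of \<open>ev\<close> at x, this represents
  (\<phi>(c)V - V\<sigma>(c))x.\<close>

definition defect :: "'b op \<Rightarrow> 'u ell2 \<Rightarrow> 'u set \<times> ('u \<Rightarrow> 'f) \<Rightarrow> 'f" where
  "defect c x = (\<lambda>v. blinfun_apply (\<phi> c) (ev v x) - ev v (blinfun_apply (\<sigma> c) x))"

text \<open>The relation \<phi>(c)V = V\<sigma>(c). It implies that the compression of \<phi>(c) is
  \<sigma>(c), by \<open>ip_intertwined\<close>, but unlike that weaker statement it is stable under
  products.\<close>

definition intertwined :: "'b op set" where
  "intertwined = {c \<in> C. \<forall>x. ip (defect c x) (defect c x) = 0}"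

lemma defect_dominated [simp]: "defect c x \<in> dominated_vec"
  unfolding defect_def by (intro dominated_vec_intros)

lemma ip_ev_range: "c \<in> C \<Longrightarrow> ip (\<lambda>v. ev v (blinfun_apply (\<sigma> c) x)) (\<lambda>v. ev v y) = inner (blinfun_apply (\<sigma> c) x) y"
  by (simp add: ip_ev proj_id[OF M \<sigma>_range'])

lemma ip_intertwined:
  assumes "c \<in> intertwined"
  shows "ip (\<lambda>v. blinfun_apply (\<phi> c) (ev v x)) (\<lambda>v. ev v y) = inner (blinfun_apply (\<sigma> c) x) y"
proof -
  have c: "c \<in> C" "ip (defect c x) (defect c x) = 0" using assms by (auto simp: intertwined_def)
  have "ip (defect c x) (\<lambda>v. ev v y) = 0"
    by (rule ip_null[OF defect_dominated _ c(2)]) (intro dominated_vec_intros)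
  then show ?thesis
    unfolding defect_def using ip_ev_range[OF c(1)] by (simp add: ip_diff_left dominated_vec_intros)
qed

lemma ip_mono:
  assumes "t \<in> dominated_vec" "u \<in> dominated_vec" "\<And>v. norm (t v) \<le> K * norm (u v)" 
  shows "ip t t \<le> K\<^sup>2 * ip u u"
  using sum_ip_mono[of "{()}" "\<lambda>_. t" "{()}" "\<lambda>_. u" "K\<^sup>2"] assms
  by (simp add: power_mono flip: power_mult_distrib)

lemma ip_ev_le: "ip (\<lambda>v. ev v x) (\<lambda>v. ev v x) \<le> (norm x)\<^sup>2"
proof -
  have "inner (proj M x) x \<le> norm (proj M x) * norm x" by (rule norm_cauchy_schwarz)
  also have "\<dots> \<le> norm x * norm x" by (intro mult_right_mono norm_proj_le M) auto
  finally show ?thesis by (simp add: ip_ev power2_eq_square)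
qed

text \<open>The factor 4 is the parallelogram bound 2 + 2. What matters is continuity in
  \<open>c\<close>, which makes \<open>intertwined\<close> closed.\<close>

lemma ip_defect_le:
  assumes "c \<in> C"
  shows "ip (defect c x) (defect c x) \<le> 4 * ((norm c)\<^sup>2 * (norm x)\<^sup>2)"
proof -
  let ?t = "\<lambda>v. blinfun_apply (\<phi> c) (ev v x)" and ?u = "\<lambda>v. ev v (blinfun_apply (\<sigma> c) x)"
  have t: "?t \<in> dominated_vec" and u: "?u \<in> dominated_vec" by (intro dominated_vec_intros)+
  have "ip ?t ?t \<le> (norm c)\<^sup>2 * ip (\<lambda>v. ev v x) (\<lambda>v. ev v x)"
  proof (rule ip_mono[OF t dominated_vec_ev])
    show "norm (blinfun_apply (\<phi> c) (ev v x)) \<le> norm c * norm (ev v x)" for v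
      using norm_blinfun[of "\<phi> c" "ev v x"] mult_right_mono[OF \<phi>.contractive[OF assms] norm_ge_zero[of "ev v x"]]
      by linarith
  qed
  also have "\<dots> \<le> (norm c)\<^sup>2 * (norm x)\<^sup>2" by (intro mult_left_mono ip_ev_le) auto
  finally have 1: "ip ?t ?t \<le> (norm c)\<^sup>2 * (norm x)\<^sup>2" .
  have "norm (blinfun_apply (\<sigma> c) x) \<le> norm c * norm x"
    using norm_blinfun[of "\<sigma> c" x] mult_right_mono[OF \<sigma>.contractive[OF assms] norm_ge_zero[of x]] by linarith
  then have "(norm (blinfun_apply (\<sigma> c) x))\<^sup>2 \<le> (norm c * norm x)\<^sup>2" by (intro power_mono) auto
  then have 2: "ip ?u ?u \<le> (norm c)\<^sup>2 * (norm x)\<^sup>2"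
    using ip_ev_le[of "blinfun_apply (\<sigma> c) x"] by (simp add: power_mult_distrib)
  have "0 \<le> ip (\<lambda>v. ?t v + ?u v) (\<lambda>v. ?t v + ?u v)"
    by (intro ip_nonneg dominated_vec_intros)
  then have "0 \<le> ip ?t ?t + 2 * ip ?t ?u + ip ?u ?u" by (simp only: ip_add_sq[OF t u])
  moreover have "ip (defect c x) (defect c x) = ip ?t ?t - 2 * ip ?t ?u + ip ?u ?u"
    unfolding defect_def by (rule ip_diff_sq[OF t u])
  ultimately show ?thesis using 1 2 by linarith
qed

text \<open>The defect of \<open>c o\<^sub>L d\<close> at x is \<phi>(c) applied to the defect of
  \<open>d\<close>, plus the defect of \<open>c\<close> at \<sigma>(d)x, and operators preserve null
  vectors. For a limit l, the defects of l and of l - c n differ by a null vector, and the latter is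
  small.\<close>

lemma intertwined_algebra: "operator_algebra intertwined"
  unfolding operator_algebra_def
proof (intro conjI ballI)
  show "intertwined \<subseteq> bops UNIV" using \<phi>.in_bops by (auto simp: intertwined_def)
  have zero: "ip (\<lambda>v. 0) (\<lambda>v. 0) = 0"
    using ip_scaleR_left[OF dominated_vec_zero dominated_vec_zero, of 0] by simp
  have defect_add: "defect (c + d) x = (\<lambda>v. defect c x v + defect d x v)" if "c \<in> C" "d \<in> C" for c d x
    using that by (simp add: defect_def \<phi>.hom_simps \<sigma>.hom_simps blinfun.add_left ev_add fun_eq_iff)
  show "csubspace intertwined"
  proof (rule csubspaceI)
    show "0 \<in> intertwined"
      using \<phi>.closures(1) by (simp add: intertwined_def defect_def \<phi>.hom_simps \<sigma>.hom_simps zero)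
    show "c + d \<in> intertwined" if "c \<in> intertwined" "d \<in> intertwined" for c d
      using that \<phi>.closures by (simp add: intertwined_def defect_add null_add)
    show "r *\<^sub>C c \<in> intertwined" if "c \<in> intertwined" for r c
    proof -
      have c: "c \<in> C" using that by (simp add: intertwined_def)
      have "defect (r *\<^sub>C c) x = (\<lambda>v. r *\<^sub>C defect c x v)" for x
        using c by (simp add: defect_def \<phi>.hom_simps \<sigma>.hom_simps blinfun_apply_scaleC ev_scaleC scaleC_diff_right)
      then show ?thesis
        using that \<phi>.closures(3)[OF c] by (simp add: intertwined_def ip_scaleC_left ip_null dominated_vec_intros)
    qed
  qed
  show "c o\<^sub>L d \<in> intertwined" if "c \<in> intertwined" "d \<in> intertwined" for c d
  proof -
    have cd: "c \<in> C" "d \<in> C" using that by (auto simp: intertwined_def)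
    have "defect (c o\<^sub>L d) x = (\<lambda>v. blinfun_apply (\<phi> c) (defect d x v) + defect c (blinfun_apply (\<sigma> d) x) v)" for x
      using cd by (simp add: defect_def \<phi>.hom_simps \<sigma>.hom_simps blinfun.diff_right)
    then have "ip (defect (c o\<^sub>L d) x) (defect (c o\<^sub>L d) x) = 0" for x
      using that cd \<phi>.rep_bops by (simp add: intertwined_def null_add null_apply dominated_vec_intros)
    then show ?thesis using cd \<phi>.closures by (simp add: intertwined_def)
  qed
  show "closed intertwined"
    unfolding closed_sequential_limits
  proof (intro allI impI, elim conjE)
    fix c and l assume c: "\<forall>n. c n \<in> intertwined" and lim: "c \<longlonglongrightarrow> l"
    have cC: "c n \<in> C" for n using c by (simp add: intertwined_def)
    have l: "l \<in> C" using closed_sequentially[OF operator_algebra_closed[OF \<phi>.algebra] cC lim] .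
    have "ip (defect l x) (defect l x) = 0" for x
    proof (rule order_antisym)
      have "ip (defect l x) (defect l x) \<le> 4 * ((norm (l - c n))\<^sup>2 * (norm x)\<^sup>2)" for n
      proof -
        have d: "l - c n \<in> C" using l cC \<phi>.closures by blast
        have "defect l x = (\<lambda>v. defect (c n) x v + defect (l - c n) x v)"
          using defect_add[OF cC[of n] d] by simp
        moreover have "ip (defect (c n) x) (defect (c n) x) = 0" using c by (simp add: intertwined_def)
        ultimately have "ip (defect l x) (defect l x) = ip (defect (l - c n) x) (defect (l - c n) x)"
          by (simp add: ip_add_sq ip_null)
        then show ?thesis using ip_defect_le[OF d, of x] by simp
      qed
      moreover have "(\<lambda>n. 4 * ((norm (l - c n))\<^sup>2 * (norm x)\<^sup>2)) \<longlonglongrightarrow> 4 * ((norm (l - l))\<^sup>2 * (norm x)\<^sup>2)"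
        by (intro tendsto_intros lim)
      ultimately show "ip (defect l x) (defect l x) \<le> 0"
        by (intro LIMSEQ_le_const[of "\<lambda>n. 4 * ((norm (l - c n))\<^sup>2 * (norm x)\<^sup>2)" 0]) auto
    qed (simp add: ip_nonneg)
    then show "l \<in> intertwined" using l by (simp add: intertwined_def)
  qed
qed

text \<open>Intertwining is not evidently inherited by adjoints, hence the separate condition on
  \<open>adj c\<close>.\<close>

lemma intertwined_star_algebra: "cstar_algebra {c \<in> intertwined. adj c \<in> intertwined}"
proof -
  note Z = operator_algebra_closures[OF intertwined_algebra] 
  note Zb = operator_algebra_bops[OF intertwined_algebra]
  have "closed {c \<in> intertwined. adj c \<in> intertwined}"
    unfolding closed_sequential_limits
  proof (intro allI impI, elim conjE)
    fix c and l assume c: "\<forall>n. c n \<in> {c \<in> intertwined. adj c \<in> intertwined}" and lim: "c \<longlonglongrightarrow> l"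
    have l: "l \<in> intertwined"
      using closed_sequentially[OF operator_algebra_closed[OF intertwined_algebra] _ lim] c by auto
    have "(\<lambda>n. adj (c n)) \<longlonglongrightarrow> adj l"
      by (rule tendsto_adj[OF lim]) (use c l Zb in auto)
    then have "adj l \<in> intertwined"
      using closed_sequentially[OF operator_algebra_closed[OF intertwined_algebra] _ \<open>(\<lambda>n. adj (c n)) \<longlonglongrightarrow> adj l\<close>] c
      by auto
    then show "l \<in> {c \<in> intertwined. adj c \<in> intertwined}" using l by simp
  qed
  then show ?thesis
    unfolding cstar_algebra_def operator_algebra_def
    using Zb Z by (auto simp: adj_add adj_scaleC adj_compose adj_adj intro!: csubspaceI)
qed

text \<open>On the complement of \<open>M\<close> both halves of the defect vanish: \<sigma>(c)
  kills it, and \<open>ev\<close> maps it to null vectors. Maximality gives information on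
  \<open>M\<close> only.\<close>

lemma null_if_null_on_M:
  assumes c: "c \<in> C" and null: "\<And>x. x \<in> M \<Longrightarrow> ip (defect c x) (defect c x) = 0"
  shows "c \<in> intertwined"
proof -
  have "ip (defect c x) (defect c x) = 0" for x
  proof -
    let ?y = "x - proj M x"
    have Py: "proj M ?y = 0" by (rule proj_zero[OF M]) (simp add: proj_orth[OF M])
    have "blinfun_apply (\<sigma> c) ?y = 0" using \<sigma>_proj'[OF c, of ?y] Py by (simp add: blinfun.zero_right)
    then have "defect c ?y = (\<lambda>v. blinfun_apply (\<phi> c) (ev v ?y))" by (simp add: defect_def)
    moreover have "ip (\<lambda>v. ev v ?y) (\<lambda>v. ev v ?y) = 0" by (simp add: ip_ev Py)
    ultimately have 1: "ip (defect c ?y) (defect c ?y) = 0"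
      using null_apply[OF dominated_vec_ev \<phi>.rep_bops[OF c]] by simp
    have "defect c x = (\<lambda>v. defect c (proj M x) v + defect c ?y v)"
      by (simp add: defect_def ev_diff blinfun.diff_right fun_eq_iff)
    then show ?thesis using null_add[OF defect_dominated defect_dominated null[OF proj_in[OF M]] 1] by simp
  qed
  then show ?thesis using c by (simp add: intertwined_def)
qed

lemma normalize_vector:
  assumes "t \<in> dominated_vec"
  obtains r :: real where "r > 0" "ip (\<lambda>v. r *\<^sub>R t v) (\<lambda>v. r *\<^sub>R t v) \<le> 1"
proof
  define N where "N = ip t t"
  have N: "0 \<le> N" unfolding N_def by (rule ip_nonneg[OF assms])
  \<comment> \<open>The shift by 1 covers null vectors, where dividing by the norm would fail;
    \<open>maximal_orthogonal\<close> asks only for norm at most 1.\<close>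
  show "1 / (1 + N) > 0" using N by simp
  have "N \<le> (1 + N)\<^sup>2" using N by (simp add: power2_eq_square algebra_simps)
  then show "ip (\<lambda>v. (1 / (1 + N)) *\<^sub>R t v) (\<lambda>v. (1 / (1 + N)) *\<^sub>R t v) \<le> 1"
    using assms N by (simp add: ip_scaleR_left ip_scaleR_right dominated_vec_scaleR flip: N_def)
      (simp add: divide_simps power2_eq_square)
qed

lemma ip_adj_B:
  assumes b: "b \<in> B"
  shows "ip (\<lambda>v. blinfun_apply (\<phi> (adj b)) (ev v x)) (\<lambda>v. ev v y) = inner (blinfun_apply (\<sigma> (adj b)) x) y"
proof -
  have bC: "b \<in> C" using b BC by blast
  have "ip (\<lambda>v. blinfun_apply (\<phi> (adj b)) (ev v x)) (\<lambda>v. ev v y)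
      = ip (\<lambda>v. ev v x) (\<lambda>v. blinfun_apply (\<phi> b) (ev v y))"
    by (simp add: \<phi>.hom_adj[OF bC] ip_apply_right[OF \<phi>.rep_bops[OF bC]])
  also have "\<dots> = inner (blinfun_apply (\<sigma> b) y) x"
    using ip_k[OF b, of y x] \<phi>_k[OF b] by (simp add: ip_commute[of "\<lambda>v. ev v x"])
  also have "\<dots> = inner (blinfun_apply (\<sigma> (adj b)) x) y"
    unfolding \<sigma>.hom_adj[OF bC] inner_adj_left[OF \<sigma>.rep_bops[OF bC]] by (rule inner_commute)
  finally show ?thesis .
qed

text \<open>The defect t of \<theta>(a) is orthogonal to every \<open>ev\<close> vector, since
  \<Psi> extends \<sigma> on \<open>B\<close>. So \<open>maximal_orthogonal\<close> applies to it
  and makes it orthogonal to \<phi>(\<theta>(a)) applied to \<open>ev\<close> vectors from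
  \<open>M\<close> too; hence t is orthogonal to itself. The second half of
  \<open>maximal_orthogonal\<close> does the same for the adjoint.\<close>

lemma \<theta>_intertwined:
  assumes a: "a \<in> A"
  shows "\<theta> a \<in> intertwined" "adj (\<theta> a) \<in> intertwined"
proof -
  let ?c = "\<theta> a"
  have cB: "?c \<in> B" by (rule \<theta>_in[OF a])
  have c: "?c \<in> C" using cB BC by blast
  have kc: "k ?c = \<phi> ?c" using \<phi>_k[OF cB] by simp
  note dv = dominated_vec_intros defect_dominated
  show "?c \<in> intertwined"
  proof (rule null_if_null_on_M[OF c])
    fix x assume x: "x \<in> M"
    let ?t = "defect ?c x"
    have orth: "ip ?t (\<lambda>v. ev v y) = 0" for y
      unfolding defect_def using ip_k[OF cB, of x y] ip_ev_range[OF c, of x y]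
      by (simp add: ip_diff_left dominated_vec_intros kc)
    obtain r :: real where r: "r > 0" "ip (\<lambda>v. r *\<^sub>R ?t v) (\<lambda>v. r *\<^sub>R ?t v) \<le> 1"
      using normalize_vector[OF defect_dominated] by blast
    have "ip (\<lambda>v. blinfun_apply (k ?c) (ev v x)) (\<lambda>v. r *\<^sub>R ?t v) = 0"
      by (rule maximal_orthogonal(1)[OF _ _ r(2) a x]) (simp_all add: ip_scaleR_left orth dv)
    then have "ip (\<lambda>v. blinfun_apply (\<phi> ?c) (ev v x)) ?t = 0"
      using r(1) by (simp add: ip_scaleR_right dv kc)
    moreover have "ip ?t ?t = ip (\<lambda>v. blinfun_apply (\<phi> ?c) (ev v x)) ?t - ip (\<lambda>v. ev v (blinfun_apply (\<sigma> ?c) x)) ?t"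
      by (subst (1) defect_def) (rule ip_diff_left; intro dv)
    ultimately show "ip ?t ?t = 0" using orth by (simp add: ip_commute[of "\<lambda>v. ev v _"])
  qed
  have c': "adj ?c \<in> C" by (rule cstar_algebraD(2)[OF \<phi>.C c])
  show "adj ?c \<in> intertwined"
  proof (rule null_if_null_on_M[OF c'])
    fix x assume x: "x \<in> M"
    let ?t = "defect (adj ?c) x"
    have orth: "ip ?t (\<lambda>v. ev v y) = 0" for y
      unfolding defect_def using ip_ev_range[OF c', of x y] ip_adj_B[OF cB, of x y]
      by (simp add: ip_diff_left dominated_vec_intros)
    obtain r :: real where r: "r > 0" "ip (\<lambda>v. r *\<^sub>R ?t v) (\<lambda>v. r *\<^sub>R ?t v) \<le> 1"
      using normalize_vector[OF defect_dominated] by blast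
    have "ip (\<lambda>v. blinfun_apply (k ?c) (r *\<^sub>R ?t v)) (\<lambda>v. ev v x) = 0"
      by (rule maximal_orthogonal(2)[OF _ _ r(2) a x]) (simp_all add: ip_scaleR_left orth dv)
    then have "ip ?t (\<lambda>v. blinfun_apply (\<phi> (adj ?c)) (ev v x)) = 0"
      using r(1) by (simp add: blinfun.scaleR_right ip_scaleR_left dv kc ip_apply[OF \<phi>.rep_bops[OF c]] \<phi>.hom_adj[OF c])
    moreover have "ip ?t ?t = ip ?t (\<lambda>v. blinfun_apply (\<phi> (adj ?c)) (ev v x)) - ip ?t (\<lambda>v. ev v (blinfun_apply (\<sigma> (adj ?c)) x))"
      by (subst (2) defect_def) (rule ip_diff_right; intro dv)
    ultimately show "ip ?t ?t = 0" using orth by simp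
  qed
qed

lemma intertwined_generated: "cstar_generated (\<theta> ` A) \<subseteq> intertwined"
  using cstar_generated_subset[OF intertwined_star_algebra] \<theta>_intertwined by blast

text \<open>In the square of the defect, the first term is known because
  \<open>adj b o\<^sub>L b\<close> is already intertwined and the mixed term because the compression
  of \<phi>(b) is \<sigma>(b), so that it reads a - 2a + a = 0. For the adjoint the other square is
  used.\<close>

lemma S_intertwined:
  assumes b: "b \<in> S"
  shows "b \<in> intertwined" "adj b \<in> intertwined"
proof -
  have bB: "b \<in> B" using b SB by blast
  have bC: "b \<in> C" using bB BC by blast
  have bC': "adj b \<in> C" by (rule cstar_algebraD(2)[OF \<phi>.C bC])
  have kb: "k b = \<phi> b" using \<phi>_k[OF bB] by simp
  note dv = dominated_vec_intros
  have "ip (defect b x) (defect b x) = 0" for x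
  proof -
    have "ip (\<lambda>v. blinfun_apply (\<phi> b) (ev v x)) (\<lambda>v. blinfun_apply (\<phi> b) (ev v x))
        = ip (\<lambda>v. blinfun_apply (\<phi> (adj b o\<^sub>L b)) (ev v x)) (\<lambda>v. ev v x)"
      by (simp add: ip_apply_right[OF \<phi>.rep_bops[OF bC]] \<phi>.hom_simps bC bC' \<phi>.hom_adj)
    also have "\<dots> = inner (blinfun_apply (\<sigma> (adj b o\<^sub>L b)) x) x"
      by (rule ip_intertwined) (use S_sq(1)[OF b] intertwined_generated in blast)
    also have "\<dots> = inner (blinfun_apply (\<sigma> b) x) (blinfun_apply (\<sigma> b) x)"
      by (simp add: \<sigma>.hom_simps bC bC' \<sigma>.hom_adj inner_adj_left[OF \<sigma>.rep_bops[OF bC]])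
    finally show ?thesis
      unfolding defect_def using ip_k[OF bB, of x] ip_ev_range[OF bC, of x]
      by (simp add: ip_diff_sq dv kb)
  qed
  then show "b \<in> intertwined" using bC by (simp add: intertwined_def)
  have "ip (defect (adj b) x) (defect (adj b) x) = 0" for x
  proof -
    have "ip (\<lambda>v. blinfun_apply (\<phi> (adj b)) (ev v x)) (\<lambda>v. blinfun_apply (\<phi> (adj b)) (ev v x))
        = ip (\<lambda>v. blinfun_apply (\<phi> (b o\<^sub>L adj b)) (ev v x)) (\<lambda>v. ev v x)"
      unfolding ip_apply_right[OF \<phi>.rep_bops[OF bC']]
      by (simp add: \<phi>.hom_simps bC bC' \<phi>.hom_adj adj_adj[OF \<phi>.rep_bops[OF bC]])
    also have "\<dots> = inner (blinfun_apply (\<sigma> (b o\<^sub>L adj b)) x) x"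
      by (rule ip_intertwined) (use S_sq(2)[OF b] intertwined_generated in blast)
    also have "\<dots> = inner (blinfun_apply (\<sigma> (adj b)) x) (blinfun_apply (\<sigma> (adj b)) x)"
      by (simp add: \<sigma>.hom_simps bC bC' \<sigma>.hom_adj inner_adj_right[OF \<sigma>.rep_bops[OF bC]])
    finally have 1: "ip (\<lambda>v. blinfun_apply (\<phi> (adj b)) (ev v x)) (\<lambda>v. blinfun_apply (\<phi> (adj b)) (ev v x))
        = inner (blinfun_apply (\<sigma> (adj b)) x) (blinfun_apply (\<sigma> (adj b)) x)" .
    show ?thesis
      unfolding defect_def using 1 ip_adj_B[OF bB, of x] ip_ev_range[OF bC', of x] by (simp add: ip_diff_sq dv)
  qed
  then show "adj b \<in> intertwined" using bC' by (simp add: intertwined_def)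
qed

text \<open>Once all of \<open>C\<close> is intertwined, \<sigma>(c) is recovered from \<phi>(c) by
  compression; and \<open>C\<close> is generated by \<open>S\<close>.\<close>

theorem kernel_subset:
  assumes c: "c \<in> C" and z: "\<phi> c = 0"
  shows "\<sigma> c = 0"
proof (rule blinfun_eqI)
  fix x
  have "C \<subseteq> {c \<in> intertwined. adj c \<in> intertwined}"
    using gen cstar_generated_subset[OF intertwined_star_algebra, of S] S_intertwined by blast
  then have "c \<in> intertwined" using c by blast
  from ip_intertwined[OF this, of x "blinfun_apply (\<sigma> c) x"]
  have "inner (blinfun_apply (\<sigma> c) x) (blinfun_apply (\<sigma> c) x) = ip (\<lambda>v. 0) (\<lambda>v. ev v (blinfun_apply (\<sigma> c) x))"
    by (simp add: z)
  also have "\<dots> = 0"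
    using ip_scaleR_left[OF dominated_vec_zero dominated_vec_ev, of 0] by simp
  finally show "blinfun_apply (\<sigma> c) x = blinfun_apply 0 x" by simp
qed

end

subsection \<open>Direct sums of operators\<close>

lemma inj_Pair: "inj (Pair s)"
  by (simp add: inj_on_def)

lemma Rep_pull_Pair [simp]: "Rep_ell2 (pull (Pair s) \<psi>) i = Rep_ell2 \<psi> (s, i)"
  by (rule Rep_pull[OF inj_Pair])

lemma pull_Pair_ext: "(\<And>s. pull (Pair s) \<psi> = pull (Pair s) \<phi>) \<Longrightarrow> \<psi> = \<phi>"
  unfolding Rep_ell2_inject[symmetric] by (auto simp: fun_eq_iff)

lemma pull_push_Pair: "pull (Pair s) (push (Pair t) x) = (if s = t then x else 0)"
proof (cases "s = t")
  case False
  then show ?thesis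
    by (auto simp: Rep_ell2_inject[symmetric] fun_eq_iff Rep_push[OF inj_Pair] zero_ell2.rep_eq)
qed (simp add: pull_push[OF inj_Pair])

lemma sum_norm_pull_Pair:
  fixes \<psi> :: "('s \<times> 'i) ell2"
  assumes "finite F"
  shows "(\<Sum>s\<in>F. (norm (pull (Pair s) \<psi>))\<^sup>2) \<le> (norm \<psi>)\<^sup>2"
proof -
  let ?f = "\<lambda>j. (cmod (Rep_ell2 \<psi> j))\<^sup>2"
  have sm: "?f summable_on X" for X
    by (rule summable_on_subset_banach[of _ UNIV]) (use Rep_ell2[of \<psi>] in auto)
  have one: "(norm (pull (Pair s) \<psi>))\<^sup>2 = infsum ?f (Pair s ` UNIV)" for s
    unfolding norm_ell2_sq by (subst infsum_reindex[OF inj_Pair]) (simp add: comp_def)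
  have "(\<Sum>s\<in>F. (norm (pull (Pair s) \<psi>))\<^sup>2) = infsum ?f (F \<times> UNIV)"
    using assms
  proof (induction F rule: finite_induct)
    case (insert s F)
    have "insert s F \<times> (UNIV :: 'i set) = Pair s ` UNIV \<union> F \<times> UNIV" by auto
    moreover have "infsum ?f (Pair s ` UNIV \<union> F \<times> UNIV) = infsum ?f (Pair s ` UNIV) + infsum ?f (F \<times> UNIV)"
      by (rule infsum_Un_disjoint) (use sm insert in auto)
    ultimately show ?case using insert by (simp add: one)
  qed simp
  also have "\<dots> \<le> infsum ?f UNIV"
    by (rule infsum_mono_neutral) (use sm in auto)
  finally show ?thesis by (simp add: norm_ell2_sq)
qed

text \<open>Describes a direct sum by its action on components, so that later arguments need not
  unfold \<open>direct_sum_op\<close>.\<close>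

definition block_diagonal :: "'s set \<Rightarrow> ('s \<Rightarrow> 'u ell2 op) \<Rightarrow> ('s \<times> 'u) ell2 op \<Rightarrow> bool" where
  "block_diagonal S T X \<longleftrightarrow> X \<in> bops UNIV \<and> (\<forall>s \<psi>. pull (Pair s) (blinfun_apply X \<psi>)
     = (if s \<in> S then blinfun_apply (T s) (pull (Pair s) \<psi>) else 0))"

text \<open>The source of every identity between \<open>rep\<close> and \<open>unitary\<close>: it
  suffices to check it in each covariant representation.\<close>

lemma block_diagonal_unique:
  assumes "block_diagonal S T X" "block_diagonal S T' Y" "\<And>s. s \<in> S \<Longrightarrow> T s = T' s"
  shows "X = Y"
  by (rule blinfun_eqI, rule pull_Pair_ext) (use assms in \<open>simp add: block_diagonal_def\<close>)

lemma block_diagonal_direct_sum: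
  assumes T: "\<And>s. s \<in> S \<Longrightarrow> T s \<in> bops UNIV" "\<And>s. s \<in> S \<Longrightarrow> norm (T s) \<le> K"
  shows "block_diagonal S T (direct_sum_op S T)"
proof (cases "S = {}")
  case True
  have "direct_sum_op S T = Blinfun (\<lambda>_. 0)"
    using True by (simp add: direct_sum_op_def zero_ell2_def case_prod_unfold)
  also have "\<dots> = 0" by (simp add: zero_blinfun_def)
  finally show ?thesis
    using True csubspaceD(1)[OF csubspace_bops]
    by (simp add: block_diagonal_def Rep_ell2_inject[symmetric] fun_eq_iff zero_ell2.rep_eq)
next
  case False
  \<comment> \<open>Only a nonempty \<open>S\<close> forces this, hence the case split.\<close>
  then have K: "0 \<le> K" using T(2) norm_ge_zero order_trans by blast
  define f where "f \<psi> = (\<lambda>(s, i). if s \<in> S then Rep_ell2 (blinfun_apply (T s) (pull (Pair s) \<psi>)) i else 0)" for \<psi>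
  have fin: "(\<Sum>x\<in>F. (cmod (f \<psi> x))\<^sup>2) \<le> (K * norm \<psi>)\<^sup>2" if F: "finite F" for F \<psi>
  proof -
    \<comment> \<open>A finite set of index pairs is enlarged to a rectangle, so that the sum can be
      estimated one summand of the space at a time.\<close>
    let ?G = "fst ` F" and ?I = "snd ` F"
    have "(\<Sum>x\<in>F. (cmod (f \<psi> x))\<^sup>2) \<le> (\<Sum>x\<in>?G \<times> ?I. (cmod (f \<psi> x))\<^sup>2)"
      by (rule sum_mono2) (use F in \<open>force+\<close>)
    also have "\<dots> = (\<Sum>s\<in>?G. \<Sum>i\<in>?I. (cmod (f \<psi> (s, i)))\<^sup>2)"
      by (simp add: sum.cartesian_product)
    also have "\<dots> \<le> (\<Sum>s\<in>?G. (K * norm (pull (Pair s) \<psi>))\<^sup>2)"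
    proof (rule sum_mono)
      fix s assume "s \<in> ?G"
      show "(\<Sum>i\<in>?I. (cmod (f \<psi> (s, i)))\<^sup>2) \<le> (K * norm (pull (Pair s) \<psi>))\<^sup>2"
      proof (cases "s \<in> S")
        case True
        have "(\<Sum>i\<in>?I. (cmod (f \<psi> (s, i)))\<^sup>2) \<le> (norm (blinfun_apply (T s) (pull (Pair s) \<psi>)))\<^sup>2"
          using sum_le_norm_ell2_sq[of ?I "blinfun_apply (T s) (pull (Pair s) \<psi>)"] F True by (simp add: f_def)
        also have "\<dots> \<le> (K * norm (pull (Pair s) \<psi>))\<^sup>2"
          using norm_blinfun[of "T s" "pull (Pair s) \<psi>"] mult_right_mono[OF T(2)[OF True] norm_ge_zero[of "pull (Pair s) \<psi>"]]
          by (intro power_mono) auto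
        finally show ?thesis .
      qed (simp add: f_def)
    qed
    also have "\<dots> = K\<^sup>2 * (\<Sum>s\<in>?G. (norm (pull (Pair s) \<psi>))\<^sup>2)"
      by (simp add: power_mult_distrib sum_distrib_left)
    also have "\<dots> \<le> K\<^sup>2 * (norm \<psi>)\<^sup>2"
      by (intro mult_left_mono sum_norm_pull_Pair) (use F in auto)
    finally show ?thesis by (simp add: power_mult_distrib)
  qed
  have sm: "(\<lambda>x. (cmod (f \<psi> x))\<^sup>2) summable_on UNIV" for \<psi>
    by (rule nonneg_bdd_above_summable_on) (use fin in \<open>auto simp: bdd_above_def\<close>)
  define D where "D \<psi> = Abs_ell2 (f \<psi>)" for \<psi>
  have RD: "Rep_ell2 (D \<psi>) = f \<psi>" for \<psi> using sm by (simp add: D_def Abs_ell2_inverse)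
  have "(norm (D \<psi>))\<^sup>2 \<le> (K * norm \<psi>)\<^sup>2" for \<psi>
    unfolding norm_ell2_sq RD by (rule infsum_le_finite_sums[OF sm]) (use fin in auto)
  then have nD: "norm (D \<psi>) \<le> norm \<psi> * K" for \<psi>
    using K by (metis abs_le_square_iff abs_norm_cancel abs_of_nonneg mult.commute norm_ge_zero mult_nonneg_nonneg)
  have D_add: "D (\<psi> + \<phi>) = D \<psi> + D \<phi>" for \<psi> \<phi>
    by (auto simp: Rep_ell2_inject[symmetric] fun_eq_iff RD f_def plus_ell2.rep_eq pull_add[OF inj_Pair] blinfun.add_right)
  have D_scale: "D (c *\<^sub>C \<psi>) = c *\<^sub>C D \<psi>" for c \<psi>
    by (auto simp: Rep_ell2_inject[symmetric] fun_eq_iff RD f_def scaleC_ell2.rep_eq pull_scaleC[OF inj_Pair]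
        bops_scaleC[OF T(1)])
  have bl: "bounded_linear D"
    by (rule bounded_linear_intro[where K = K]) (auto simp: D_add D_scale scaleR_scaleC nD)
  have "D = (\<lambda>\<psi>. Abs_ell2 (\<lambda>(s, i).
     if s \<in> S then Rep_ell2 (blinfun_apply (T s) (Abs_ell2 (\<lambda>i. Rep_ell2 \<psi> (s, i)))) i else 0))"
    unfolding D_def f_def pull_def ..
  then have "direct_sum_op S T = Blinfun D"
    by (simp add: direct_sum_op_def)
  then have ap: "blinfun_apply (direct_sum_op S T) \<psi> = D \<psi>" for \<psi>
    by (simp add: bounded_linear_Blinfun_apply[OF bl])
  show ?thesis
    unfolding block_diagonal_def bops_UNIV ap
    by (auto simp: D_scale Rep_ell2_inject[symmetric] fun_eq_iff RD f_def zero_ell2.rep_eq)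
qed

lemma block_diagonal_add:
  "block_diagonal S T X \<Longrightarrow> block_diagonal S T' Y \<Longrightarrow> block_diagonal S (\<lambda>s. T s + T' s) (X + Y)"
  by (auto simp: block_diagonal_def csubspaceD[OF csubspace_bops] blinfun.add_left pull_add[OF inj_Pair])

lemma pull_zero [simp]: "pull (Pair s) 0 = 0"
  using pull_scaleC[OF inj_Pair, of s 0 0] by simp

lemma block_diagonal_scaleC:
  "block_diagonal S T X \<Longrightarrow> block_diagonal S (\<lambda>s. c *\<^sub>C T s) (c *\<^sub>C X)"
  by (auto simp: block_diagonal_def csubspaceD[OF csubspace_bops] blinfun_apply_scaleC pull_scaleC[OF inj_Pair])

lemma block_diagonal_compose:
  "block_diagonal S T X \<Longrightarrow> block_diagonal S T' Y \<Longrightarrow> block_diagonal S (\<lambda>s. T s o\<^sub>L T' s) (X o\<^sub>L Y)"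
  by (auto simp: block_diagonal_def bops_compose)

lemma block_diagonal_push:
  assumes "block_diagonal S T X"
  shows "blinfun_apply X (push (Pair s) x) = (if s \<in> S then push (Pair s) (blinfun_apply (T s) x) else 0)"
  by (rule pull_Pair_ext) (use assms in \<open>auto simp: block_diagonal_def pull_push_Pair blinfun.zero_right\<close>)

lemma block_diagonal_adj:
  assumes X: "block_diagonal S T X" and T: "\<And>s. s \<in> S \<Longrightarrow> T s \<in> bops UNIV"
  shows "block_diagonal S (\<lambda>s. adj (T s)) (adj X)"
proof -
  have b: "X \<in> bops UNIV" using X by (simp add: block_diagonal_def)
  have "pull (Pair s) (blinfun_apply (adj X) \<psi>) = (if s \<in> S then blinfun_apply (adj (T s)) (pull (Pair s) \<psi>) else 0)" for s \<psi>
  proof (rule cinner_ext')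
    fix y
    have "cinner y (pull (Pair s) (blinfun_apply (adj X) \<psi>)) = cinner (blinfun_apply X (push (Pair s) y)) \<psi>"
      by (simp add: cinner_adj_right[OF b] flip: cinner_push[OF inj_Pair])
    also have "\<dots> = cinner y (if s \<in> S then blinfun_apply (adj (T s)) (pull (Pair s) \<psi>) else 0)"
      by (simp add: block_diagonal_push[OF X] cinner_push[OF inj_Pair] cinner_adj_right T)
    finally show "cinner y (pull (Pair s) (blinfun_apply (adj X) \<psi>))
        = cinner y (if s \<in> S then blinfun_apply (adj (T s)) (pull (Pair s) \<psi>) else 0)" .
  qed
  then show ?thesis by (simp add: block_diagonal_def adj_in_bops[OF b])
qed

subsection \<open>Generated algebras\<close>

lemma operator_algebra_generated:
  assumes "X \<subseteq> bops UNIV"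
  shows "operator_algebra (opalg_generated X)"
proof -
  let ?F = "{A. operator_algebra A \<and> X \<subseteq> A}"
  \<comment> \<open>The family is nonempty; otherwise the intersection would be the whole
    type.\<close>
  have b: "bops UNIV \<in> ?F"
    using assms by (simp add: operator_algebra_def csubspace_bops closed_bops bops_compose)
  have F: "operator_algebra A" if "A \<in> ?F" for A using that by simp
  have "csubspace (\<Inter>?F)"
    by (rule csubspaceI) (auto intro: operator_algebra_closures)
  moreover have "closed (\<Inter>?F)"
    by (rule closed_Inter) (auto intro: operator_algebra_closed)
  ultimately show ?thesis
    unfolding opalg_generated_def operator_algebra_def[of "\<Inter>?F"]
    using b by (auto intro: operator_algebra_closures)
qed

lemma opalg_generated_subset: "operator_algebra D \<Longrightarrow> X \<subseteq> D \<Longrightarrow> opalg_generated X \<subseteq> D"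
  and opalg_generated_superset: "X \<subseteq> opalg_generated X"
  by (auto simp: opalg_generated_def)

lemma cstar_algebra_generated:
  assumes "X \<subseteq> bops UNIV"
  shows "cstar_algebra (cstar_generated X)"
proof -
  let ?F = "{A. cstar_algebra A \<and> X \<subseteq> A}"
  have b: "bops UNIV \<in> ?F"
    using assms by (simp add: cstar_algebra_def operator_algebra_def csubspace_bops closed_bops bops_compose adj_in_bops)
  have "csubspace (\<Inter>?F)"
    by (rule csubspaceI) (auto intro: operator_algebra_closures[OF cstar_algebraD(1)])
  moreover have "closed (\<Inter>?F)"
    by (rule closed_Inter) (auto dest!: cstar_algebraD(1) intro: operator_algebra_closed)
  ultimately show ?thesis
    unfolding cstar_generated_def cstar_algebra_def[of "\<Inter>?F"] operator_algebra_def[of "\<Inter>?F"]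
    using b by (auto intro: operator_algebra_compose[OF cstar_algebraD(1)] cstar_algebraD(2))
qed

lemma cstar_generated_superset: "X \<subseteq> cstar_generated X"
  by (auto simp: cstar_generated_def)

lemma cspan_induct_closed:
  assumes "csubspace V" "X \<subseteq> V"
  shows "cspan X \<subseteq> V"
  using complex_vector.span_minimal[OF assms(2,1)] .

lemma closure_cspan_algebra:
  fixes X :: "'h::chilbert_space op set"
  assumes b: "X \<subseteq> bops UNIV" and mult: "\<And>x y. x \<in> X \<Longrightarrow> y \<in> X \<Longrightarrow> x o\<^sub>L y \<in> cspan X"
    and star: "\<And>x. x \<in> X \<Longrightarrow> adj x \<in> cspan X"
  shows "cstar_algebra (closure (cspan X))"
proof -
  have sp: "csubspace (cspan X)" by (rule complex_vector.subspace_span)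
  have sb: "cspan X \<subseteq> bops UNIV" by (rule cspan_induct_closed[OF csubspace_bops b])
  have cb: "closure (cspan X) \<subseteq> bops UNIV" by (rule closure_minimal[OF sb closed_bops])
  have m1: "x o\<^sub>L y \<in> cspan X" if x: "x \<in> X" and y: "y \<in> cspan X" for x y
  proof -
    have "cspan X \<subseteq> {y. x o\<^sub>L y \<in> cspan X}"
    proof (rule cspan_induct_closed)
      have xb: "x \<in> bops UNIV" using x b by blast
      have "x o\<^sub>L (c *\<^sub>C y) = c *\<^sub>C (x o\<^sub>L y)" for c and y :: "'h op"
        by (rule blinfun_eqI) (simp add: blinfun_apply_scaleC bops_scaleC[OF xb])
      then show "csubspace {y. x o\<^sub>L y \<in> cspan X}"
        by (intro csubspaceI) (auto simp: csubspaceD[OF sp] bounded_bilinear.add_right[OF bounded_bilinear_blinfun_compose])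
    qed (use mult x in auto)
    then show ?thesis using y by blast
  qed
  have m2: "x o\<^sub>L y \<in> cspan X" if x: "x \<in> cspan X" and y: "y \<in> cspan X" for x y
  proof -
    have "cspan X \<subseteq> {x. x o\<^sub>L y \<in> cspan X}"
    proof (rule cspan_induct_closed)
      have "(c *\<^sub>C x) o\<^sub>L y = c *\<^sub>C (x o\<^sub>L y)" for c and x :: "'h op"
        by (rule blinfun_eqI) (simp add: blinfun_apply_scaleC)
      then show "csubspace {x. x o\<^sub>L y \<in> cspan X}"
        by (intro csubspaceI) (auto simp: csubspaceD[OF sp] bounded_bilinear.add_left[OF bounded_bilinear_blinfun_compose])
    qed (use m1 y in auto)
    then show ?thesis using x by blast
  qed
  have s: "adj x \<in> cspan X" if "x \<in> cspan X" for x
  proof -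
    have "cspan X \<subseteq> {x \<in> bops UNIV. adj x \<in> cspan X}"
      by (rule cspan_induct_closed, rule csubspaceI)
        (use b star in \<open>auto simp: csubspaceD[OF sp] csubspaceD[OF csubspace_bops] adj_add adj_scaleC\<close>)
    then show ?thesis using that by blast
  qed
  show ?thesis
    unfolding cstar_algebra_def operator_algebra_def
  proof (intro conjI ballI)
    have seq: "\<exists>f. (\<forall>n. f n \<in> cspan X) \<and> f \<longlonglongrightarrow> x" if "x \<in> closure (cspan X)" for x
      using that by (simp add: closure_sequential)
    show "closure (cspan X) \<subseteq> bops UNIV" by (rule cb)
    show "csubspace (closure (cspan X))"
    proof (rule csubspaceI)
      show "0 \<in> closure (cspan X)" using csubspaceD(1)[OF sp] closure_subset by blast
    next
      fix x y assume "x \<in> closure (cspan X)" "y \<in> closure (cspan X)"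
      then obtain f g where "\<And>n. f n \<in> cspan X" "f \<longlonglongrightarrow> x" "\<And>n. g n \<in> cspan X" "g \<longlonglongrightarrow> y"
        using seq by metis
      then show "x + y \<in> closure (cspan X)"
        unfolding closure_sequential by (intro exI[of _ "\<lambda>n. f n + g n"]) (auto intro: csubspaceD[OF sp] tendsto_add)
    next
      fix c x assume "x \<in> closure (cspan X)"
      then obtain f where "\<And>n. f n \<in> cspan X" "f \<longlonglongrightarrow> x" using seq by metis
      then show "c *\<^sub>C x \<in> closure (cspan X)"
        unfolding closure_sequential
        by (intro exI[of _ "\<lambda>n. c *\<^sub>C f n"]) (auto intro: csubspaceD[OF sp] tendsto_scaleC_blinfun)
    qed
    show "closed (closure (cspan X))" by simp
    show "x o\<^sub>L y \<in> closure (cspan X)" if xy: "x \<in> closure (cspan X)" "y \<in> closure (cspan X)" for x y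
    proof -
      obtain f g where "\<And>n. f n \<in> cspan X" "f \<longlonglongrightarrow> x" "\<And>n. g n \<in> cspan X" "g \<longlonglongrightarrow> y"
        using seq[OF xy(1)] seq[OF xy(2)] by metis
      then show ?thesis
        unfolding closure_sequential by (intro exI[of _ "\<lambda>n. f n o\<^sub>L g n"]) (auto intro: m2 tendsto_compose)
    qed
    show "adj x \<in> closure (cspan X)" if x: "x \<in> closure (cspan X)" for x
    proof -
      obtain f where f: "\<And>n. f n \<in> cspan X" "f \<longlonglongrightarrow> x" using seq[OF x] by metis
      have "(\<lambda>n. adj (f n)) \<longlonglongrightarrow> adj x"
        by (rule tendsto_adj[OF f(2)]) (use f(1) sb x cb in \<open>auto intro!: always_eventually\<close>)
      then show ?thesis
        unfolding closure_sequential using f(1) s by (intro exI[of _ "\<lambda>n. adj (f n)"]) auto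
    qed
  qed
qed

subsection \<open>The crossed product\<close>

lemma blinfun_compose_assoc: "(x o\<^sub>L y) o\<^sub>L z = x o\<^sub>L (y o\<^sub>L z)"
  by (rule blinfun_eqI) simp

lemma cinner_pull: "inj h \<Longrightarrow> cinner (pull h \<psi>) \<xi> = cinner \<psi> (push h \<xi>)"
  by (metis cinner_commute cinner_push)

locale crossed_product =
  fixes u :: "'u itself" and E :: "'k::chilbert_space op set" and G :: "('g, 'm) monoid_scheme" (structure)
    and \<beta> :: "'g \<Rightarrow> 'k op \<Rightarrow> 'k op"
  assumes E: "cstar_algebra E" and group_G: "group G" and action: "cstar_action E G \<beta>"
begin

interpretation G: group G by (rule group_G)

lemmas E_algebra = cstar_algebraD(1)[OF E]
lemmas E_closures = operator_algebra_closures[OF E_algebra] cstar_algebraD(2)[OF E]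
lemmas E_bops = operator_algebra_bops[OF E_algebra]

abbreviation Cov :: "('k, 'g, 'u) cov_pair set" where
  "Cov \<equiv> {p. covariant_rep E G \<beta> p}"

abbreviation rep :: "'k op \<Rightarrow> ('k, 'g, 'u) cov_space op" where
  "rep \<equiv> universal_rep u E G \<beta>"

abbreviation unitary :: "'g \<Rightarrow> ('k, 'g, 'u) cov_space op" where
  "unitary \<equiv> universal_unitary u E G \<beta>"

lemma action_in: "g \<in> carrier G \<Longrightarrow> a \<in> E \<Longrightarrow> \<beta> g a \<in> E"
  and action_mult: "g \<in> carrier G \<Longrightarrow> h \<in> carrier G \<Longrightarrow> a \<in> E \<Longrightarrow> \<beta> (g \<otimes> h) a = \<beta> g (\<beta> h a)"
  and action_star_hom: "g \<in> carrier G \<Longrightarrow> star_hom E (\<beta> g)"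
  using action by (auto simp: cstar_action_def bij_betw_def)

lemma action_rep: "g \<in> carrier G \<Longrightarrow> star_representation E (\<beta> g)"
  using action_in E_bops by unfold_locales (auto simp: E action_star_hom)

text \<open>\<open>cstar_action\<close> does not list this: \<beta> at the group unit is idempotent
  and injective.\<close>

lemma action_one: "a \<in> E \<Longrightarrow> \<beta> \<one> a = a"
proof -
  assume a: "a \<in> E"
  have "\<beta> \<one> (\<beta> \<one> a) = \<beta> \<one> a" using action_mult[of \<one> \<one> a] a by simp
  moreover have "inj_on (\<beta> \<one>) E" using action by (auto simp: cstar_action_def bij_betw_def)
  ultimately show "\<beta> \<one> a = a" using a action_in[of \<one> a] by (auto dest: inj_onD)
qed

lemma covariant_repD:
  assumes "covariant_rep E G \<beta> p"
  shows "star_representation E (fst p)"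
    and "g \<in> carrier G \<Longrightarrow> snd p g \<in> bops UNIV"
    and "g \<in> carrier G \<Longrightarrow> adj (snd p g) o\<^sub>L snd p g = id_blinfun"
    and "g \<in> carrier G \<Longrightarrow> snd p g o\<^sub>L adj (snd p g) = id_blinfun"
    and "g \<in> carrier G \<Longrightarrow> h \<in> carrier G \<Longrightarrow> snd p (g \<otimes> h) = snd p g o\<^sub>L snd p h"
    and "g \<in> carrier G \<Longrightarrow> a \<in> E \<Longrightarrow> snd p g o\<^sub>L fst p a o\<^sub>L adj (snd p g) = fst p (\<beta> g a)"
  using assms E by (auto simp: covariant_rep_def case_prod_unfold unitary_op_def star_representation_def)

lemma covariant_commute:
  assumes p: "covariant_rep E G \<beta> p" and g: "g \<in> carrier G" and a: "a \<in> E"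
  shows "snd p g o\<^sub>L fst p a = fst p (\<beta> g a) o\<^sub>L snd p g"
proof -
  have "fst p (\<beta> g a) o\<^sub>L snd p g = snd p g o\<^sub>L fst p a o\<^sub>L (adj (snd p g) o\<^sub>L snd p g)"
    unfolding covariant_repD(6)[OF p g a, symmetric] by (simp add: blinfun_compose_assoc)
  then show ?thesis unfolding covariant_repD(3)[OF p g] by (simp add: blinfun_eqI)
qed

lemma covariant_one:
  assumes p: "covariant_rep E G \<beta> p"
  shows "snd p \<one> = id_blinfun"
proof -
  have "snd p \<one> = (adj (snd p \<one>) o\<^sub>L snd p \<one>) o\<^sub>L snd p \<one>"
    using covariant_repD(3)[OF p, of \<one>] by (simp add: blinfun_eqI)
  also have "\<dots> = adj (snd p \<one>) o\<^sub>L (snd p (\<one> \<otimes> \<one>))"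
    unfolding covariant_repD(5)[OF p G.one_closed G.one_closed] by (rule blinfun_compose_assoc)
  also have "\<dots> = id_blinfun" using covariant_repD(3)[OF p, of \<one>] by simp
  finally show ?thesis .
qed

lemma covariant_inv:
  assumes p: "covariant_rep E G \<beta> p" and g: "g \<in> carrier G"
  shows "adj (snd p g) = snd p (inv g)"
proof -
  have "snd p (inv g) o\<^sub>L snd p g = id_blinfun"
    using covariant_repD(5)[OF p G.inv_closed[OF g] g] covariant_one[OF p] g by simp
  then have "adj (snd p g) = (snd p (inv g) o\<^sub>L snd p g) o\<^sub>L adj (snd p g)" by (simp add: blinfun_eqI)
  also have "\<dots> = snd p (inv g) o\<^sub>L (snd p g o\<^sub>L adj (snd p g))" by (rule blinfun_compose_assoc)
  also have "\<dots> = snd p (inv g)" unfolding covariant_repD(4)[OF p g] by (simp add: blinfun_eqI)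
  finally show ?thesis .
qed

lemma norm_covariant_unitary:
  assumes p: "covariant_rep E G \<beta> p" and g: "g \<in> carrier G"
  shows "norm (snd p g) \<le> 1"
proof (rule norm_blinfun_bound)
  fix x
  have "(norm (blinfun_apply (snd p g) x))\<^sup>2 = inner x (blinfun_apply (adj (snd p g) o\<^sub>L snd p g) x)"
    by (simp add: inner_adj_right[OF covariant_repD(2)[OF p g]] power2_norm_eq_inner)
  also have "\<dots> = (norm x)\<^sup>2" unfolding covariant_repD(3)[OF p g] by (simp add: power2_norm_eq_inner)
  finally show "norm (blinfun_apply (snd p g) x) \<le> 1 * norm x" by simp
qed simp

text \<open>Contractivity of star homomorphisms bounds all components by \<open>norm a\<close>, the
  uniform bound that a direct sum needs.\<close>

lemma block_rep:
  assumes a: "a \<in> E"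
  shows "block_diagonal Cov (\<lambda>p. fst p a) (rep a)"
proof -
  have "block_diagonal Cov (\<lambda>p. fst p a) (direct_sum_op Cov (\<lambda>p. fst p a))"
    by (rule block_diagonal_direct_sum)
      (use a covariant_repD(1) star_representation.rep_bops star_representation.contractive in blast)+
  then show ?thesis by (simp add: universal_rep_def case_prod_unfold)
qed

lemma block_unitary:
  assumes g: "g \<in> carrier G"
  shows "block_diagonal Cov (\<lambda>p. snd p g) (unitary g)"
proof -
  have "block_diagonal Cov (\<lambda>p. snd p g) (direct_sum_op Cov (\<lambda>p. snd p g))"
    by (rule block_diagonal_direct_sum) (use g covariant_repD(2) norm_covariant_unitary in blast)+
  then show ?thesis by (simp add: universal_unitary_def case_prod_unfold)
qed

lemma rep_bops: "a \<in> E \<Longrightarrow> rep a \<in> bops UNIV"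
  and unitary_bops: "g \<in> carrier G \<Longrightarrow> unitary g \<in> bops UNIV"
  using block_rep block_unitary by (auto simp: block_diagonal_def)

lemma rep_add: "a \<in> E \<Longrightarrow> b \<in> E \<Longrightarrow> rep (a + b) = rep a + rep b"
  by (rule block_diagonal_unique[OF block_rep block_diagonal_add[OF block_rep block_rep]])
    (use E_closures in \<open>auto simp: star_representation.hom_simps[OF covariant_repD(1)]\<close>)

lemma rep_scaleC: "a \<in> E \<Longrightarrow> rep (c *\<^sub>C a) = c *\<^sub>C rep a"
  by (rule block_diagonal_unique[OF block_rep block_diagonal_scaleC[OF block_rep]])
    (use E_closures in \<open>auto simp: star_representation.hom_simps[OF covariant_repD(1)]\<close>)

lemma rep_compose: "a \<in> E \<Longrightarrow> b \<in> E \<Longrightarrow> rep (a o\<^sub>L b) = rep a o\<^sub>L rep b"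
  by (rule block_diagonal_unique[OF block_rep block_diagonal_compose[OF block_rep block_rep]])
    (use E_closures in \<open>auto simp: star_representation.hom_simps[OF covariant_repD(1)]\<close>)

lemma rep_adj: "a \<in> E \<Longrightarrow> rep (adj a) = adj (rep a)"
  by (rule block_diagonal_unique[OF block_rep block_diagonal_adj[OF block_rep]])
    (use E_closures in \<open>auto simp: star_representation.hom_adj[OF covariant_repD(1)]
      star_representation.rep_bops[OF covariant_repD(1)]\<close>)

lemma rep_star_representation: "star_representation E rep"
  by unfold_locales (auto simp: E star_hom_def algebra_hom_def clinear_on_def rep_add rep_scaleC rep_compose
      rep_adj rep_bops)

lemma unitary_mult: "g \<in> carrier G \<Longrightarrow> h \<in> carrier G \<Longrightarrow> unitary g o\<^sub>L unitary h = unitary (g \<otimes> h)"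
  by (rule block_diagonal_unique[OF block_diagonal_compose[OF block_unitary block_unitary] block_unitary])
    (auto simp: covariant_repD(5))

lemma unitary_adj: "g \<in> carrier G \<Longrightarrow> adj (unitary g) = unitary (inv g)"
  by (rule block_diagonal_unique[OF block_diagonal_adj[OF block_unitary] block_unitary])
    (auto simp: covariant_repD(2) covariant_inv)

lemma rep_unitary_one: "a \<in> E \<Longrightarrow> rep a o\<^sub>L unitary \<one> = rep a"
  by (rule block_diagonal_unique[OF block_diagonal_compose[OF block_rep block_unitary] block_rep])
    (auto simp: covariant_one blinfun_eqI)

lemma unitary_rep: "g \<in> carrier G \<Longrightarrow> a \<in> E \<Longrightarrow> unitary g o\<^sub>L rep a = rep (\<beta> g a) o\<^sub>L unitary g"
  by (rule block_diagonal_unique[OF block_diagonal_compose[OF block_unitary block_rep]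
        block_diagonal_compose[OF block_rep block_unitary]])
    (auto simp: covariant_commute action_in)

section \<open>The full crossed product as a closed linear span\<close>

definition monomials :: "('k, 'g, 'u) cov_space op set" where
  "monomials = {rep a o\<^sub>L unitary g | a g. a \<in> E \<and> g \<in> carrier G}"

abbreviation full :: "('k, 'g, 'u) cov_space op set" where
  "full \<equiv> full_crossed_product u E G \<beta>"

lemma monomialsI: "a \<in> E \<Longrightarrow> g \<in> carrier G \<Longrightarrow> rep a o\<^sub>L unitary g \<in> monomials"
  by (auto simp: monomials_def)

lemma monomial_mult:
  assumes "a \<in> E" "b \<in> E" "g \<in> carrier G" "h \<in> carrier G"
  shows "(rep a o\<^sub>L unitary g) o\<^sub>L (rep b o\<^sub>L unitary h) = rep (a o\<^sub>L \<beta> g b) o\<^sub>L unitary (g \<otimes> h)"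
proof -
  have "(rep a o\<^sub>L unitary g) o\<^sub>L (rep b o\<^sub>L unitary h) = rep a o\<^sub>L ((unitary g o\<^sub>L rep b) o\<^sub>L unitary h)"
    by (simp only: blinfun_compose_assoc)
  also have "\<dots> = (rep a o\<^sub>L rep (\<beta> g b)) o\<^sub>L (unitary g o\<^sub>L unitary h)"
    unfolding unitary_rep[OF assms(3,2)] by (simp only: blinfun_compose_assoc)
  finally show ?thesis using assms by (simp add: rep_compose unitary_mult action_in)
qed

lemma monomial_adj:
  assumes "a \<in> E" "g \<in> carrier G"
  shows "adj (rep a o\<^sub>L unitary g) = rep (\<beta> (inv g) (adj a)) o\<^sub>L unitary (inv g)"
  using assms by (simp add: adj_compose rep_bops unitary_bops unitary_adj rep_adj[symmetric] unitary_rep E_closures)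

text \<open>The sums allow one coefficient per group element, so two of them are added over the
  union of their index sets, missing coefficients being read as 0.\<close>

lemma sums_eq_cspan:
  "{\<Sum>g\<in>F. rep (a g) o\<^sub>L unitary g | F a. finite F \<and> F \<subseteq> carrier G \<and> a ` F \<subseteq> E} = cspan monomials"
  (is "?X = _")
proof
  have X: "(\<Sum>g\<in>F. rep (a g) o\<^sub>L unitary g) \<in> ?X" if "finite F" "F \<subseteq> carrier G" "a ` F \<subseteq> E" for F a
    using that by blast
  have zero: "rep 0 o\<^sub>L unitary g = 0" for g
    using rep_scaleC[OF E_closures(1), of 0] by (simp add: blinfun_eqI)
  have scale: "c *\<^sub>C (rep a o\<^sub>L unitary g) = rep (c *\<^sub>C a) o\<^sub>L unitary g" if "a \<in> E" for c a g
    by (rule blinfun_eqI) (simp add: rep_scaleC that blinfun_apply_scaleC)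
  have sub: "csubspace ?X"
  proof (rule csubspaceI)
    show "0 \<in> ?X" using X[of "{}"] by simp
    show "x + y \<in> ?X" if xy: "x \<in> ?X" "y \<in> ?X" for x y
    proof -
      obtain F a where x: "x = (\<Sum>g\<in>F. rep (a g) o\<^sub>L unitary g)" and F: "finite F" "F \<subseteq> carrier G" "a ` F \<subseteq> E"
        using xy(1) by blast
      obtain F' a' where y: "y = (\<Sum>g\<in>F'. rep (a' g) o\<^sub>L unitary g)" and F': "finite F'" "F' \<subseteq> carrier G" "a' ` F' \<subseteq> E"
        using xy(2) by blast
      define e where "e g = (if g \<in> F then a g else 0)" for g
      define e' where "e' g = (if g \<in> F' then a' g else 0)" for g
      have eE: "e g \<in> E" "e' g \<in> E" for g using F F' E_closures(1) by (auto simp: e_def e'_def)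
      have "x = (\<Sum>g\<in>F \<union> F'. rep (e g) o\<^sub>L unitary g)"
        unfolding x by (rule sum.mono_neutral_cong_left) (use F F' in \<open>auto simp: e_def zero\<close>)
      moreover have "y = (\<Sum>g\<in>F \<union> F'. rep (e' g) o\<^sub>L unitary g)"
        unfolding y by (rule sum.mono_neutral_cong_left) (use F F' in \<open>auto simp: e'_def zero\<close>)
      ultimately have "x + y = (\<Sum>g\<in>F \<union> F'. rep (e g + e' g) o\<^sub>L unitary g)"
        by (simp add: rep_add eE bounded_bilinear.add_left[OF bounded_bilinear_blinfun_compose] sum.distrib)
      also have "\<dots> \<in> ?X" by (rule X) (use F F' eE E_closures(2) in auto)
      finally show ?thesis .
    qed
    show "c *\<^sub>C x \<in> ?X" if x: "x \<in> ?X" for c x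
    proof -
      obtain F a where x: "x = (\<Sum>g\<in>F. rep (a g) o\<^sub>L unitary g)" and F: "finite F" "F \<subseteq> carrier G" "a ` F \<subseteq> E"
        using x by blast
      have "c *\<^sub>C x = (\<Sum>g\<in>F. rep (c *\<^sub>C a g) o\<^sub>L unitary g)"
        unfolding x scaleC_sum_right using F by (intro sum.cong refl) (auto simp: scale)
      also have "\<dots> \<in> ?X" by (rule X) (use F E_closures(3) in auto)
      finally show ?thesis .
    qed
  qed
  show "cspan monomials \<subseteq> ?X"
  proof (rule cspan_induct_closed[OF sub])
    show "monomials \<subseteq> ?X"
    proof
      fix x assume "x \<in> monomials"
      then obtain a g where "x = rep a o\<^sub>L unitary g" "a \<in> E" "g \<in> carrier G" by (auto simp: monomials_def)
      then show "x \<in> ?X" using X[of "{g}" "\<lambda>_. a"] by simp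
    qed
  qed
  show "?X \<subseteq> cspan monomials"
  proof
    fix x assume "x \<in> ?X"
    then obtain F a where x: "x = (\<Sum>g\<in>F. rep (a g) o\<^sub>L unitary g)" and F: "F \<subseteq> carrier G" "a ` F \<subseteq> E"
      by blast
    show "x \<in> cspan monomials"
      unfolding x
      by (rule csubspace_sum[OF complex_vector.subspace_span], rule complex_vector.span_base, rule monomialsI)
        (use F in auto)
  qed
qed

lemma full_eq: "full = closure (cspan monomials)"
  unfolding full_crossed_product_def sums_eq_cspan ..

lemma cstar_full: "cstar_algebra full"
  unfolding full_eq
proof (rule closure_cspan_algebra)
  show "monomials \<subseteq> bops UNIV"
    by (auto simp: monomials_def intro: bops_compose rep_bops unitary_bops)
  show "x o\<^sub>L y \<in> cspan monomials" if xy: "x \<in> monomials" "y \<in> monomials" for x y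
  proof -
    obtain a b g h where "x = rep a o\<^sub>L unitary g" "y = rep b o\<^sub>L unitary h"
      and *: "a \<in> E" "b \<in> E" "g \<in> carrier G" "h \<in> carrier G"
      using xy unfolding monomials_def by blast
    then have "x o\<^sub>L y = rep (a o\<^sub>L \<beta> g b) o\<^sub>L unitary (g \<otimes> h)" by (simp add: monomial_mult)
    then show ?thesis
      using * by (simp add: complex_vector.span_base monomialsI E_closures(7) action_in)
  qed
  show "adj x \<in> cspan monomials" if x: "x \<in> monomials" for x
  proof -
    obtain a g where "x = rep a o\<^sub>L unitary g" and *: "a \<in> E" "g \<in> carrier G"
      using x unfolding monomials_def by blast
    then have "adj x = rep (\<beta> (inv g) (adj a)) o\<^sub>L unitary (inv g)" by (simp add: monomial_adj)
    then show ?thesis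
      using * by (simp add: complex_vector.span_base monomialsI E_closures(8) action_in)
  qed
qed

lemma full_subset:
  assumes "csubspace D" "closed D" "monomials \<subseteq> D"
  shows "full \<subseteq> D"
  unfolding full_eq using assms by (intro closure_minimal cspan_induct_closed)

lemma monomials_full: "monomials \<subseteq> full"
  unfolding full_eq using complex_vector.span_superset[of monomials] closure_subset by blast

section \<open>Compression to one covariant representation\<close>

definition block :: "('k, 'g, 'u) cov_pair \<Rightarrow> ('k, 'g, 'u) cov_space op \<Rightarrow> 'u ell2 op" where
  "block p c = Blinfun (pull (Pair p)) o\<^sub>L c o\<^sub>L Blinfun (push (Pair p))"

lemma block_apply: "blinfun_apply (block p c) x = pull (Pair p) (blinfun_apply c (push (Pair p) x))"
  by (simp add: block_def bounded_linear_Blinfun_apply bounded_linear_pull bounded_linear_push inj_Pair)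

text \<open>Being diagonal at \<open>p\<close>, and zero there when \<open>p\<close> is not
  covariant, is a closed linear condition on \<open>c\<close>; it has to be checked on monomials
  only.\<close>

lemma full_block:
  assumes c: "c \<in> full"
  shows "pull (Pair p) (blinfun_apply c \<psi>) = (if p \<in> Cov then blinfun_apply (block p c) (pull (Pair p) \<psi>) else 0)"
proof -
  define d where "d c \<psi> = pull (Pair p) (blinfun_apply c \<psi>)
    - (if p \<in> Cov then pull (Pair p) (blinfun_apply c (push (Pair p) (pull (Pair p) \<psi>))) else 0)"
    for c :: "('k, 'g, 'u) cov_space op" and \<psi>
  let ?D = "{c. \<forall>\<psi>. d c \<psi> = 0}"
  have d_add: "d (c + c') \<psi> = d c \<psi> + d c' \<psi>" for c c' \<psi>
    by (simp add: d_def blinfun.add_left pull_add[OF inj_Pair])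
  have d_scaleC: "d (r *\<^sub>C c) \<psi> = r *\<^sub>C d c \<psi>" for r c \<psi>
    by (simp add: d_def blinfun_apply_scaleC pull_scaleC[OF inj_Pair] scaleC_diff_right)
  have "full \<subseteq> ?D"
  proof (rule full_subset)
    show "csubspace ?D"
      using d_scaleC[of 0] by (intro csubspaceI) (auto simp: d_add d_scaleC)
    have cont: "continuous_on UNIV (\<lambda>c. pull (Pair p) (blinfun_apply c \<psi>))" for \<psi> :: "('k, 'g, 'u) cov_space"
      by (intro linear_continuous_on bounded_linear_compose[OF bounded_linear_pull[OF inj_Pair]]
          blinfun.bounded_linear_left)
    have "continuous_on UNIV (\<lambda>c. d c \<psi>)" for \<psi>
      unfolding d_def by (cases "p \<in> Cov") (simp_all only: if_True if_False, (intro continuous_on_diff cont continuous_on_const)+)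
    then have "closed (\<Inter>\<psi>. {c. d c \<psi> = 0})"
      by (intro closed_INT ballI closed_Collect_eq continuous_on_const)
    moreover have "?D = (\<Inter>\<psi>. {c. d c \<psi> = 0})" by blast
    ultimately show "closed ?D" by simp
    show "monomials \<subseteq> ?D"
    proof
      fix x assume "x \<in> monomials"
      then obtain a g where "x = rep a o\<^sub>L unitary g" "a \<in> E" "g \<in> carrier G" by (auto simp: monomials_def)
      then have x: "block_diagonal Cov (\<lambda>p. fst p a o\<^sub>L snd p g) x"
        using block_diagonal_compose[OF block_rep block_unitary] by blast
      have "pull (Pair p) (blinfun_apply x \<psi>) = (if p \<in> Cov then blinfun_apply (fst p a o\<^sub>L snd p g) (pull (Pair p) \<psi>) else 0)" for \<psi>
        using x unfolding block_diagonal_def by blast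
      then have "d x \<psi> = 0" for \<psi>
        unfolding d_def by (simp only: pull_push_Pair if_True refl split: if_split) simp
      then show "x \<in> ?D" by simp
    qed
  qed
  then have "d c \<psi> = 0" using c by blast
  then show ?thesis by (simp add: d_def block_apply)
qed

lemma block_monomial:
  assumes p: "p \<in> Cov" and a: "a \<in> E" and g: "g \<in> carrier G"
  shows "block p (rep a o\<^sub>L unitary g) = fst p a o\<^sub>L snd p g"
proof (rule blinfun_eqI)
  fix x
  have "block_diagonal Cov (\<lambda>p. fst p a o\<^sub>L snd p g) (rep a o\<^sub>L unitary g)"
    by (rule block_diagonal_compose[OF block_rep[OF a] block_unitary[OF g]])
  then show "blinfun_apply (block p (rep a o\<^sub>L unitary g)) x = blinfun_apply (fst p a o\<^sub>L snd p g) x"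
    using p by (simp only: block_apply block_diagonal_push if_True pull_push_Pair refl)
qed

lemma block_rep_apply:
  assumes "p \<in> Cov" "a \<in> E"
  shows "block p (rep a) = fst p a"
  using block_monomial[OF assms G.one_closed] rep_unitary_one[OF assms(2)] covariant_one[of p] assms(1)
  by (simp add: blinfun_eqI)

text \<open>This compression is multiplicative because elements of \<open>full\<close> leave the
  summand of \<open>p\<close> invariant.\<close>

lemma block_star_representation:
  assumes p: "p \<in> Cov"
  shows "star_representation full (block p)"
proof
  have bo: "c \<in> full \<Longrightarrow> c \<in> bops UNIV" for c
    using operator_algebra_bops[OF cstar_algebraD(1)[OF cstar_full]] .
  have bb: "block p c \<in> bops UNIV" if "c \<in> full" for c
    using bo[OF that] by (simp add: bops_UNIV block_apply push_scaleC[OF inj_Pair] pull_scaleC[OF inj_Pair])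
  show "cstar_algebra full" by (rule cstar_full)
  show "block p ` full \<subseteq> bops UNIV" using bb by blast
  show "star_hom full (block p)"
    unfolding star_hom_def algebra_hom_def clinear_on_def
  proof (intro conjI ballI allI)
    fix c assume c: "c \<in> full"
    show "block p (adj c) = adj (block p c)"
    proof (rule adj_unique[symmetric])
      fix x y
      have "cinner (blinfun_apply (block p c) x) y = cinner (blinfun_apply c (push (Pair p) x)) (push (Pair p) y)"
        by (simp add: block_apply cinner_pull[OF inj_Pair])
      also have "\<dots> = cinner (push (Pair p) x) (blinfun_apply (adj c) (push (Pair p) y))"
        by (simp add: cinner_adj_right[OF bo[OF c]])
      also have "\<dots> = cinner x (blinfun_apply (block p (adj c)) y)"
        by (simp add: block_apply cinner_push[OF inj_Pair])
      finally show "cinner (blinfun_apply (block p c) x) y = cinner x (blinfun_apply (block p (adj c)) y)" .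
    qed
    show "block p (r *\<^sub>C c) = r *\<^sub>C block p c" for r
      by (rule blinfun_eqI) (simp add: block_apply blinfun_apply_scaleC pull_scaleC[OF inj_Pair])
    fix d assume d: "d \<in> full"
    show "block p (c + d) = block p c + block p d"
      by (rule blinfun_eqI) (simp add: block_apply blinfun.add_left pull_add[OF inj_Pair])
    show "block p (c o\<^sub>L d) = block p c o\<^sub>L block p d"
      using full_block[OF c, of p] p by (intro blinfun_eqI) (simp add: block_apply)
  qed
qed

lemma block_mat_bound:
  assumes "mat_bound n x r"
  shows "mat_bound n (\<lambda>i j. block p (x i j)) r"
  unfolding mat_bound_def
proof
  fix \<xi> :: "nat \<Rightarrow> 'u ell2"
  have pull_sum: "pull (Pair p) (\<Sum>j\<in>J. f j) = (\<Sum>j\<in>J. pull (Pair p) (f j))" for J :: "nat set" and f :: "nat \<Rightarrow> ('k, 'g, 'u) cov_space"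
    by (rule linear_sum[OF bounded_linear.linear[OF bounded_linear_pull[OF inj_Pair]]])
  have "(\<Sum>i<n. (norm (\<Sum>j<n. blinfun_apply (block p (x i j)) (\<xi> j)))\<^sup>2)
      \<le> (\<Sum>i<n. (norm (\<Sum>j<n. blinfun_apply (x i j) (push (Pair p) (\<xi> j))))\<^sup>2)"
    unfolding block_apply pull_sum[symmetric]
    by (intro sum_mono power_mono norm_pull_le inj_Pair) auto
  also have "\<dots> \<le> r\<^sup>2 * (\<Sum>i<n. (norm (push (Pair p) (\<xi> i)))\<^sup>2)" by (rule mat_boundD[OF assms])
  finally show "(\<Sum>i<n. (norm (\<Sum>j<n. blinfun_apply (block p (x i j)) (\<xi> j)))\<^sup>2) \<le> r\<^sup>2 * (\<Sum>i<n. (norm (\<xi> i))\<^sup>2)"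
    by (simp add: norm_push[OF inj_Pair])
qed

end

subsection \<open>Approximate units and essential spaces\<close>

lemma csubspace_closure:
  fixes V :: "'h::chilbert_space set"
  assumes V: "csubspace V"
  shows "csubspace (closure V)"
proof (rule csubspaceI)
  show "0 \<in> closure V" using csubspaceD(1)[OF V] closure_subset by blast
next
  fix x y assume "x \<in> closure V" "y \<in> closure V"
  then obtain f g where "\<And>n. f n \<in> V" "f \<longlonglongrightarrow> x" "\<And>n. g n \<in> V" "g \<longlonglongrightarrow> y"
    unfolding closure_sequential by metis
  then show "x + y \<in> closure V"
    unfolding closure_sequential by (intro exI[of _ "\<lambda>n. f n + g n"]) (auto intro: csubspaceD[OF V] tendsto_add)
next
  fix c x assume "x \<in> closure V"
  then obtain f where "\<And>n. f n \<in> V" "f \<longlonglongrightarrow> x" unfolding closure_sequential by metis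
  then show "c *\<^sub>C x \<in> closure V"
    unfolding closure_sequential
    by (intro exI[of _ "\<lambda>n. c *\<^sub>C f n"]) (auto intro: csubspaceD[OF V] tendsto_scaleC_right)
qed

lemma closed_csubspace_essential: "closed_csubspace (essential_space A \<pi> H)"
  unfolding closed_csubspace_def essential_space_def
  by (simp add: csubspace_closure complex_vector.subspace_span)

lemma essential_space_minimal:
  assumes "closed_csubspace N" "\<And>a x. a \<in> A \<Longrightarrow> x \<in> H \<Longrightarrow> blinfun_apply (\<pi> a) x \<in> N"
  shows "essential_space A \<pi> H \<subseteq> N"
  unfolding essential_space_def
  by (rule closure_minimal, rule complex_vector.span_minimal) (use assms in \<open>auto simp: closed_csubspace_def\<close>)

lemma essential_spaceI: "a \<in> A \<Longrightarrow> x \<in> H \<Longrightarrow> blinfun_apply (\<pi> a) x \<in> essential_space A \<pi> H"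
  unfolding essential_space_def by (rule subsetD[OF closure_subset], rule complex_vector.span_base) blast

lemma double_orthogonal:
  assumes M: "closed_csubspace M" and x: "\<And>z. (\<And>y. y \<in> M \<Longrightarrow> cinner z y = 0) \<Longrightarrow> cinner x z = 0"
  shows "x \<in> M"
proof -
  let ?z = "x - proj M x"
  have o: "cinner ?z y = 0" if "y \<in> M" for y by (rule proj_orth[OF M that])
  then have "cinner x ?z = 0" by (rule x)
  moreover have "cinner (proj M x) ?z = 0" using o[OF proj_in[OF M]] cinner_commute[of "proj M x" ?z] by simp
  ultimately have "cinner ?z ?z = 0" by (simp add: cinner_diff_left)
  then have "x = proj M x" by (simp add: cinner_self)
  then show ?thesis using proj_in[OF M, of x] by simp
qed

context
  fixes A :: "'h::chilbert_space op set" and \<psi> :: "'h op \<Rightarrow> 'k::chilbert_space op" and \<E>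
  assumes A: "operator_algebra A" and hom: "algebra_hom A \<psi>" and \<psi>b: "\<psi> ` A \<subseteq> bops UNIV"
    and contr: "\<And>a. a \<in> A \<Longrightarrow> norm (\<psi> a) \<le> norm a" and unit: "contractive_approx_unit A \<E>"
begin

lemma eventually_unit: "\<forall>\<^sub>F e in \<E>. e \<in> A \<and> norm (\<psi> e) \<le> 1"
  using unit contr unfolding contractive_approx_unit_def by (auto elim!: eventually_mono intro: order_trans)

lemma unit_apply_le: "e \<in> A \<and> norm (\<psi> e) \<le> 1 \<Longrightarrow> norm (blinfun_apply (\<psi> e) x) \<le> norm x"
  using norm_blinfun[of "\<psi> e" x] mult_right_mono[of "norm (\<psi> e)" 1 "norm x"] by simp

lemma \<psi>_tendsto:
  assumes "(f \<longlongrightarrow> a) F" "\<forall>\<^sub>F x in F. f x \<in> A" "a \<in> A"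
  shows "((\<lambda>x. \<psi> (f x)) \<longlongrightarrow> \<psi> a) F"
proof (rule tendstoI)
  fix e :: real assume "e > 0"
  from tendstoD[OF assms(1) this] assms(2)
  show "\<forall>\<^sub>F x in F. dist (\<psi> (f x)) (\<psi> a) < e"
  proof eventually_elim
    case (elim x)
    have "norm (\<psi> (f x) - \<psi> a) \<le> norm (f x - a)"
      using contr[of "f x - a"] elim assms(3) operator_algebra_closures[OF A]
      by (simp add: algebra_hom_diff[OF hom operator_algebra_csubspace[OF A]])
    then show ?case using elim by (simp add: dist_norm)
  qed
qed

lemma unit_left:
  assumes a: "a \<in> A"
  shows "((\<lambda>e. blinfun_apply (\<psi> e) (blinfun_apply (\<psi> a) x)) \<longlongrightarrow> blinfun_apply (\<psi> a) x) \<E>"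
proof -
  have "((\<lambda>e. \<psi> (e o\<^sub>L a)) \<longlongrightarrow> \<psi> a) \<E>"
    by (rule \<psi>_tendsto) (use unit a operator_algebra_compose[OF A] in
        \<open>auto simp: contractive_approx_unit_def elim!: eventually_mono\<close>)
  then have "((\<lambda>e. blinfun_apply (\<psi> (e o\<^sub>L a)) x) \<longlongrightarrow> blinfun_apply (\<psi> a) x) \<E>"
    by (rule bounded_linear.tendsto[OF blinfun.bounded_linear_left])
  moreover have "\<forall>\<^sub>F e in \<E>. blinfun_apply (\<psi> (e o\<^sub>L a)) x = blinfun_apply (\<psi> e) (blinfun_apply (\<psi> a) x)"
    using eventually_unit
    by eventually_elim (simp add: algebra_hom_compose[OF hom operator_algebra_csubspace[OF A]] a)
  ultimately show ?thesis by (rule Lim_transform_eventually)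
qed

lemma unit_right:
  assumes a: "a \<in> A"
  shows "((\<lambda>e. blinfun_apply (\<psi> a) (blinfun_apply (\<psi> e) x)) \<longlongrightarrow> blinfun_apply (\<psi> a) x) \<E>"
proof -
  have "((\<lambda>e. \<psi> (a o\<^sub>L e)) \<longlongrightarrow> \<psi> a) \<E>"
    by (rule \<psi>_tendsto) (use unit a operator_algebra_compose[OF A] in
        \<open>auto simp: contractive_approx_unit_def elim!: eventually_mono\<close>)
  then have "((\<lambda>e. blinfun_apply (\<psi> (a o\<^sub>L e)) x) \<longlongrightarrow> blinfun_apply (\<psi> a) x) \<E>"
    by (rule bounded_linear.tendsto[OF blinfun.bounded_linear_left])
  moreover have "\<forall>\<^sub>F e in \<E>. blinfun_apply (\<psi> (a o\<^sub>L e)) x = blinfun_apply (\<psi> a) (blinfun_apply (\<psi> e) x)"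
    using eventually_unit
    by eventually_elim (simp add: algebra_hom_compose[OF hom operator_algebra_csubspace[OF A]] a)
  ultimately show ?thesis by (rule Lim_transform_eventually)
qed

text \<open>Convergence holds on vectors \<psi>(a)x by \<open>unit_left\<close>; the vectors on
  which it holds form a closed subspace because the \<psi>(e) are eventually contractions.\<close>

lemma unit_tendsto_essential:
  assumes y: "y \<in> essential_space A \<psi> UNIV"
  shows "((\<lambda>e. blinfun_apply (\<psi> e) y) \<longlongrightarrow> y) \<E>"
proof -
  let ?N = "{y. ((\<lambda>e. blinfun_apply (\<psi> e) y) \<longlongrightarrow> y) \<E>}"
  have sub: "csubspace ?N"
  proof (rule csubspaceI)
    show "0 \<in> ?N" by (simp add: blinfun.zero_right)
    show "x + y \<in> ?N" if "x \<in> ?N" "y \<in> ?N" for x y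
      using that by (auto simp: blinfun.add_right intro: tendsto_add)
    show "c *\<^sub>C x \<in> ?N" if x: "x \<in> ?N" for c x
    proof -
      have "((\<lambda>e. c *\<^sub>C blinfun_apply (\<psi> e) x) \<longlongrightarrow> c *\<^sub>C x) \<E>"
        using x by (auto intro: tendsto_scaleC_right)
      moreover have "\<forall>\<^sub>F e in \<E>. c *\<^sub>C blinfun_apply (\<psi> e) x = blinfun_apply (\<psi> e) (c *\<^sub>C x)"
        using eventually_unit \<psi>b by (auto elim!: eventually_mono simp: bops_scaleC image_subset_iff)
      ultimately show ?thesis by (auto intro: Lim_transform_eventually)
    qed
  qed
  moreover have "closed ?N"
    unfolding closed_sequential_limits
  proof (intro allI impI, elim conjE)
    fix f l assume f: "\<forall>n. f n \<in> ?N" and lim: "f \<longlonglongrightarrow> l"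
    have "((\<lambda>e. blinfun_apply (\<psi> e) l) \<longlongrightarrow> l) \<E>"
    proof (rule tendstoI)
      fix r :: real assume r: "r > 0"
      then obtain n where n: "dist (f n) l < r / 3"
        using tendstoD[OF lim, of "r / 3"] by (auto simp: eventually_sequentially)
      have "\<forall>\<^sub>F e in \<E>. dist (blinfun_apply (\<psi> e) (f n)) (f n) < r / 3"
        using tendstoD[of _ "f n" \<E> "r / 3"] f r by auto
      then show "\<forall>\<^sub>F e in \<E>. dist (blinfun_apply (\<psi> e) l) l < r"
        using eventually_unit
      proof eventually_elim
        case (elim e)
        have "norm (blinfun_apply (\<psi> e) (l - f n)) \<le> norm (l - f n)" by (rule unit_apply_le[OF elim(2)])
        then have "dist (blinfun_apply (\<psi> e) l) (blinfun_apply (\<psi> e) (f n)) < r / 3"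
          using n by (simp add: dist_norm blinfun.diff_right norm_minus_commute)
        then show ?case
          using dist_triangle_third[of "blinfun_apply (\<psi> e) l" "blinfun_apply (\<psi> e) (f n)" r "f n" l] elim(1) n
          by simp
      qed
    qed
    then show "l \<in> ?N" by simp
  qed
  ultimately have "essential_space A \<psi> UNIV \<subseteq> ?N"
    by (intro essential_space_minimal) (auto simp: closed_csubspace_def unit_left)
  then show ?thesis using y by blast
qed

text \<open>The images of the approximate unit are contractions that converge to the identity strongly on
  \<open>M = essential_space A \<psi> UNIV\<close>; comparing \<open>\<parallel>\<psi>(e) (\<zeta> + tm)\<parallel>\<^sup>2 \<le> \<parallel>\<zeta>\<parallel>\<^sup>2 + t\<^sup>2\<parallel>m\<parallel>\<^sup>2\<close> for large \<open>t\<close>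
  shows that \<open>\<psi>(e) \<zeta>\<close>, which lies in \<open>M\<close>, tends to zero weakly when \<open>\<zeta>\<close> is orthogonal to \<open>M\<close>.\<close>

lemma orthogonal_to_essential:
  assumes orth: "\<And>y. y \<in> essential_space A \<psi> UNIV \<Longrightarrow> cinner \<zeta> y = 0" and a: "a \<in> A"
  shows "blinfun_apply (\<psi> a) \<zeta> = 0"
proof -
  let ?M = "essential_space A \<psi> UNIV"
  note M = closed_csubspace_essential[of A \<psi> UNIV]
  note ab = subsetD[OF \<psi>b imageI[OF a]]
  have nE: "\<E> \<noteq> bot" using unit by (simp add: contractive_approx_unit_def)
  have weak: "\<forall>\<^sub>F e in \<E>. inner (blinfun_apply (\<psi> e) \<zeta>) m \<le> \<delta>" if m: "m \<in> ?M" and \<delta>: "\<delta> > 0" for m and \<delta> :: real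
  proof -
    \<comment> \<open>Large enough that the error (norm \<zeta>)^2 / (2t) is at most \<delta>/2; the
      added 1 keeps \<open>t\<close> positive when \<zeta> = 0.\<close>
    define t where "t = (norm \<zeta>)\<^sup>2 / \<delta> + 1"
    have t: "t > 0" using \<delta> by (simp add: t_def add_nonneg_pos)
    \<comment> \<open>The remaining errors: the defect of norm of \<psi>(e) on \<open>m\<close>, and
      the cost of replacing \<open>m\<close> by \<psi>(e)m in the inner product. Both vanish along
      \<E>.\<close>
    define r where "r e = (t / 2) * ((norm m)\<^sup>2 - (norm (blinfun_apply (\<psi> e) m))\<^sup>2) + norm \<zeta> * norm (m - blinfun_apply (\<psi> e) m)" for e
    have "(r \<longlongrightarrow> (t / 2) * ((norm m)\<^sup>2 - (norm m)\<^sup>2) + norm \<zeta> * norm (m - m)) \<E>"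
      unfolding r_def by (intro tendsto_intros unit_tendsto_essential[OF m])
    then have "(r \<longlongrightarrow> 0) \<E>" by simp
    then have "\<forall>\<^sub>F e in \<E>. r e < \<delta> / 2" using \<delta> by (intro order_tendstoD) auto
    then show ?thesis
      using eventually_unit
    proof eventually_elim
      case (elim e)
      let ?n = "blinfun_apply (\<psi> e) \<zeta>" and ?em = "blinfun_apply (\<psi> e) m"
      have "norm (blinfun_apply (\<psi> e) (\<zeta> + t *\<^sub>R m)) \<le> norm (\<zeta> + t *\<^sub>R m)" by (rule unit_apply_le[OF elim(2)])
      then have "(norm (blinfun_apply (\<psi> e) (\<zeta> + t *\<^sub>R m)))\<^sup>2 \<le> (norm (\<zeta> + t *\<^sub>R m))\<^sup>2" by (intro power_mono) auto
      moreover have "inner \<zeta> m = 0" using orth[OF m] by (metis Re_cinner zero_complex.sel(1))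
      ultimately have "(norm ?n)\<^sup>2 + 2 * t * inner ?n ?em + t\<^sup>2 * (norm ?em)\<^sup>2 \<le> (norm \<zeta>)\<^sup>2 + t\<^sup>2 * (norm m)\<^sup>2"
        by (simp add: norm_add_sq blinfun.add_right blinfun.scaleR_right power_mult_distrib)
      then have "2 * t * inner ?n ?em \<le> (norm \<zeta>)\<^sup>2 + t\<^sup>2 * ((norm m)\<^sup>2 - (norm ?em)\<^sup>2)"
        using zero_le_power2[of "norm ?n"] unfolding right_diff_distrib by linarith
      then have "inner ?n ?em \<le> ((norm \<zeta>)\<^sup>2 + t\<^sup>2 * ((norm m)\<^sup>2 - (norm ?em)\<^sup>2)) / (2 * t)"
        using t by (simp add: pos_le_divide_eq mult.commute)
      also have "\<dots> = (norm \<zeta>)\<^sup>2 / (2 * t) + (t / 2) * ((norm m)\<^sup>2 - (norm ?em)\<^sup>2)"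
        using t by (simp add: add_divide_distrib power2_eq_square)
      finally have 1: "inner ?n ?em \<le> (norm \<zeta>)\<^sup>2 / (2 * t) + (t / 2) * ((norm m)\<^sup>2 - (norm ?em)\<^sup>2)" .
      have "inner ?n (m - ?em) \<le> norm ?n * norm (m - ?em)" by (rule norm_cauchy_schwarz)
      also have "\<dots> \<le> norm \<zeta> * norm (m - ?em)" by (intro mult_right_mono unit_apply_le[OF elim(2)]) auto
      finally have 2: "inner ?n (m - ?em) \<le> norm \<zeta> * norm (m - ?em)" .
      have "(norm \<zeta>)\<^sup>2 \<le> t * \<delta>" using \<delta> by (simp add: t_def distrib_right)
      then have 3: "(norm \<zeta>)\<^sup>2 / (2 * t) \<le> \<delta> / 2" using t by (simp add: divide_simps mult.commute)
      have "inner ?n m = inner ?n ?em + inner ?n (m - ?em)" by (simp add: inner_diff_right)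
      also have "\<dots> \<le> \<delta> / 2 + r e" using 1 2 3 unfolding r_def by linarith
      also have "\<dots> \<le> \<delta>" using elim(1) by simp
      finally show ?case .
    qed
  qed
  \<comment> \<open>\<psi>(e)\<zeta> lies in the essential space, so the pairing of
    \<psi>(a)\<psi>(e)\<zeta> with \<psi>(a)\<zeta> involves only this component, to which
    \<open>weak\<close> applies.\<close>
  define m where "m = proj ?M (blinfun_apply (adj (\<psi> a)) (blinfun_apply (\<psi> a) \<zeta>))"
  have mM: "m \<in> ?M" by (simp add: m_def M)
  have nM: "blinfun_apply (\<psi> e) \<zeta> \<in> ?M" if "e \<in> A" for e by (rule essential_spaceI) (use that in auto)
  have lim: "((\<lambda>e. inner (blinfun_apply (\<psi> a) (blinfun_apply (\<psi> e) \<zeta>)) (blinfun_apply (\<psi> a) \<zeta>))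
      \<longlongrightarrow> inner (blinfun_apply (\<psi> a) \<zeta>) (blinfun_apply (\<psi> a) \<zeta>)) \<E>"
    by (intro tendsto_intros unit_right[OF a])
  have "inner (blinfun_apply (\<psi> a) \<zeta>) (blinfun_apply (\<psi> a) \<zeta>) \<le> \<delta>" if \<delta>: "\<delta> > 0" for \<delta>
  proof (rule tendsto_upperbound[OF lim _ nE])
    show "\<forall>\<^sub>F e in \<E>. inner (blinfun_apply (\<psi> a) (blinfun_apply (\<psi> e) \<zeta>)) (blinfun_apply (\<psi> a) \<zeta>) \<le> \<delta>"
      using weak[OF mM \<delta>] eventually_unit
    proof eventually_elim
      case (elim e)
      have "cinner (blinfun_apply (\<psi> a) (blinfun_apply (\<psi> e) \<zeta>)) (blinfun_apply (\<psi> a) \<zeta>)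
        = cinner (proj ?M (blinfun_apply (\<psi> e) \<zeta>)) (blinfun_apply (adj (\<psi> a)) (blinfun_apply (\<psi> a) \<zeta>))"
        using elim(2) by (simp add: proj_id[OF M nM] cinner_adj_right[OF ab])
      also have "\<dots> = cinner (blinfun_apply (\<psi> e) \<zeta>) m" by (simp add: m_def cinner_proj[OF M])
      finally show ?case using elim(1) by (metis Re_cinner)
    qed
  qed
  then have "inner (blinfun_apply (\<psi> a) \<zeta>) (blinfun_apply (\<psi> a) \<zeta>) \<le> 0" by (rule dense_ge)
  then show ?thesis using inner_ge_zero inner_eq_zero_iff order_antisym by metis
qed

end

subsection \<open>The relative crossed product\<close>

lemma opmat_norm_cong:
  assumes "\<And>i j. i < n \<Longrightarrow> j < n \<Longrightarrow> x i j = y i j"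
  shows "opmat_norm n x = opmat_norm n y"
  unfolding opmat_norm_def using assms by simp

text \<open>Hyperrigidity speaks of \<pi> after \<open>j\<close>, the reduction argument of
  \<open>block p\<close> after \<theta>; these are known to agree on \<open>A\<close> only.\<close>

lemma maximal_map_cong:
  assumes max: "maximal_map u A H \<pi>" and e: "\<And>a. a \<in> A \<Longrightarrow> \<pi> a = \<pi>' a" and A: "csubspace A"
  shows "maximal_map u A H \<pi>'"
proof -
  have "{blinfun_apply (\<pi> a) x | a x. a \<in> A \<and> x \<in> H} = {blinfun_apply (\<pi>' a) x | a x. a \<in> A \<and> x \<in> H}"
    using e by (auto; metis)
  then have ess: "essential_space A \<pi> H = essential_space A \<pi>' H"
    by (simp add: essential_space_def)
  have cc: "completely_contractive A \<pi>'"
  proof -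
    have cc: "completely_contractive A \<pi>" using max by (simp add: maximal_map_def)
    then have "clinear_on A \<pi>'"
      using e csubspaceD[OF A] by (simp add: completely_contractive_def clinear_on_def)
    moreover have "opmat_norm n (\<lambda>i j. \<pi>' (x i j)) \<le> opmat_norm n x" if "\<forall>i<n. \<forall>j<n. x i j \<in> A" for n x
      using cc that opmat_norm_cong[of n "\<lambda>i j. \<pi>' (x i j)" "\<lambda>i j. \<pi> (x i j)"] e
      by (simp add: completely_contractive_def)
    ultimately show ?thesis by (simp add: completely_contractive_def)
  qed
  have dil: "dilation A H \<pi>' K V \<rho> \<Longrightarrow> dilation A H \<pi> K V \<rho>" for K V \<rho>
    using e by (simp add: dilation_def)
  have im: "\<pi>' ` A = \<pi> ` A" using e by (intro image_cong) auto
  show ?thesis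
    using max dil cc unfolding maximal_map_def ess im by blast
qed

locale relative_system = crossed_product u E G \<beta>
  for u :: "'u itself" and E :: "'k::chilbert_space op set" and G :: "('g, 'm) monoid_scheme" (structure) and \<beta> +
  fixes A :: "'h::chilbert_space op set" and \<alpha> :: "'g \<Rightarrow> 'h op \<Rightarrow> 'h op" and j :: "'h op \<Rightarrow> 'k op"
  assumes A: "operator_algebra A" and cover: "cstar_cover A E j"
    and \<alpha>_in: "\<And>g a. g \<in> carrier G \<Longrightarrow> a \<in> A \<Longrightarrow> \<alpha> g a \<in> A"
    and extends: "\<And>g a. g \<in> carrier G \<Longrightarrow> a \<in> A \<Longrightarrow> \<beta> g (j a) = j (\<alpha> g a)"
begin

interpretation G: group G by (rule group_G)

lemma j_in: "a \<in> A \<Longrightarrow> j a \<in> E" and E_eq: "E = cstar_generated (j ` A)"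
  and j_hom: "algebra_hom A j" and j_iso: "completely_isometric A j"
  using cover by (auto simp: cstar_cover_def)

abbreviation relative :: "('k, 'g, 'u) cov_space op set" where
  "relative \<equiv> relative_crossed_product u A j E G \<beta>"

definition relative_monomials :: "('k, 'g, 'u) cov_space op set" where
  "relative_monomials = {rep (j a) o\<^sub>L unitary g | a g. a \<in> A \<and> g \<in> carrier G}"

abbreviation relative_sums :: "('k, 'g, 'u) cov_space op set" where
  "relative_sums \<equiv> {\<Sum>g\<in>F. rep (j (a g)) o\<^sub>L unitary g | F a. finite F \<and> F \<subseteq> carrier G \<and> a ` F \<subseteq> A}"

lemma relative_sums_full: "relative_sums \<subseteq> full"
proof
  fix x assume "x \<in> relative_sums"
  then obtain F a where x: "x = (\<Sum>g\<in>F. rep (j (a g)) o\<^sub>L unitary g)" and F: "F \<subseteq> carrier G" "a ` F \<subseteq> A"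
    by blast
  show "x \<in> full"
    unfolding x
    by (rule csubspace_sum[OF operator_algebra_csubspace[OF cstar_algebraD(1)[OF cstar_full]]],
        rule subsetD[OF monomials_full], rule monomialsI) (use F j_in in auto)
qed

lemma full_bops: "full \<subseteq> bops UNIV"
  using operator_algebra_bops[OF cstar_algebraD(1)[OF cstar_full]] by blast

lemma relative_algebra: "operator_algebra relative"
  unfolding relative_crossed_product_def
  by (rule operator_algebra_generated) (use relative_sums_full full_bops in blast)

lemma relative_full: "relative \<subseteq> full"
  unfolding relative_crossed_product_def
  by (rule opalg_generated_subset[OF cstar_algebraD(1)[OF cstar_full] relative_sums_full])

lemma relative_monomials_in: "relative_monomials \<subseteq> relative"
proof
  fix x assume "x \<in> relative_monomials"
  then obtain a g where "x = rep (j a) o\<^sub>L unitary g" "a \<in> A" "g \<in> carrier G"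
    by (auto simp: relative_monomials_def)
  then have "x \<in> relative_sums" by (intro CollectI exI[of _ "{g}"] exI[of _ "\<lambda>_. a"]) simp
  then show "x \<in> relative" unfolding relative_crossed_product_def by (rule subsetD[OF opalg_generated_superset])
qed

lemma rep_j_in: "a \<in> A \<Longrightarrow> rep (j a) \<in> relative"
proof -
  assume a: "a \<in> A"
  then have "rep (j a) o\<^sub>L unitary \<one> \<in> relative_monomials"
    unfolding relative_monomials_def by blast
  then show ?thesis using relative_monomials_in rep_unitary_one[OF j_in[OF a]] by auto
qed

lemma E_induct:
  assumes "cstar_algebra D" "\<And>a. a \<in> A \<Longrightarrow> j a \<in> D"
  shows "E \<subseteq> D"
  unfolding E_eq by (rule cstar_generated_subset) (use assms in auto)

text \<open>The elements of \<open>E\<close> whose image lies in the generated algebra form a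
  C*-algebra containing every \<open>j a\<close>; its closedness comes from contractivity of
  \<open>rep\<close>.\<close>

lemma rep_E_generated: "rep ` E \<subseteq> cstar_generated ((\<lambda>a. rep (j a)) ` A)"
proof -
  let ?D = "cstar_generated ((\<lambda>a. rep (j a)) ` A)"
  interpret rep: star_representation E rep by (rule rep_star_representation)
  have D: "cstar_algebra ?D" by (rule cstar_algebra_generated) (use rep_bops j_in in auto)
  note Dc = operator_algebra_closures[OF cstar_algebraD(1)[OF D]] cstar_algebraD(2)[OF D]
  have "cstar_algebra {c \<in> E. rep c \<in> ?D}"
    unfolding cstar_algebra_def operator_algebra_def
  proof (intro conjI ballI)
    show "{c \<in> E. rep c \<in> ?D} \<subseteq> bops UNIV" using E_bops by blast
    show "csubspace {c \<in> E. rep c \<in> ?D}"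
      by (rule csubspaceI) (auto simp: rep.hom_simps E_closures Dc)
    show "closed {c \<in> E. rep c \<in> ?D}"
      unfolding closed_sequential_limits
    proof (intro allI impI, elim conjE)
      fix f l assume f: "\<forall>n. f n \<in> {c \<in> E. rep c \<in> ?D}" and lim: "f \<longlonglongrightarrow> l"
      have l: "l \<in> E" using closed_sequentially[OF operator_algebra_closed[OF E_algebra] _ lim] f by auto
      have "(\<lambda>n. rep (f n)) \<longlonglongrightarrow> rep l" by (rule rep.tendsto_rep[OF lim l]) (use f in auto)
      then have "rep l \<in> ?D"
        by (rule closed_sequentially[OF operator_algebra_closed[OF cstar_algebraD(1)[OF D]], rotated]) (use f in auto)
      then show "l \<in> {c \<in> E. rep c \<in> ?D}" using l by simp
    qed
  qed (auto simp: rep.hom_simps rep.hom_adj E_closures Dc)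
  then have "E \<subseteq> {c \<in> E. rep c \<in> ?D}"
    by (rule E_induct) (auto simp: j_in cstar_generated_superset[THEN subsetD])
  then show ?thesis by blast
qed

text \<open>The group unitaries need not belong to the generated algebra, so coefficients from
  \<open>E\<close> have to be reached with a unitary attached throughout. The set \<open>?N\<close>
  asks for all translates by \<beta> and all unitaries at once, which makes it stable under adjoints
  and products.\<close>

lemma full_generated: "full \<subseteq> cstar_generated relative_monomials"
proof -
  let ?D = "cstar_generated relative_monomials"
  interpret rep: star_representation E rep by (rule rep_star_representation)
  have D: "cstar_algebra ?D"
    by (rule cstar_algebra_generated) (use relative_monomials_in relative_full full_bops in blast)
  note Dc = operator_algebra_closures[OF cstar_algebraD(1)[OF D]] cstar_algebraD(2)[OF D]
  let ?N = "{c \<in> E. \<forall>g\<in>carrier G. \<forall>h\<in>carrier G. rep (\<beta> h c) o\<^sub>L unitary g \<in> ?D}"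
  note \<beta> = star_representation.hom_simps[OF action_rep] star_representation.hom_adj[OF action_rep]
  have add: "(x + y) o\<^sub>L z = (x o\<^sub>L z) + (y o\<^sub>L z)" and scale: "(c *\<^sub>C x) o\<^sub>L z = c *\<^sub>C (x o\<^sub>L z)"
    for c and x y z :: "('k, 'g, 'u) cov_space op"
    by (rule blinfun_eqI, simp add: blinfun.add_left blinfun_apply_scaleC)+
  have "cstar_algebra ?N"
    unfolding cstar_algebra_def operator_algebra_def
  proof (intro conjI ballI)
    show "?N \<subseteq> bops UNIV" using E_bops by blast
    show "csubspace ?N"
    proof (rule csubspaceI)
      show "0 \<in> ?N" using Dc(1) by (simp add: E_closures \<beta> rep.hom_simps)
      show "x + y \<in> ?N" if "x \<in> ?N" "y \<in> ?N" for x y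
        using that by (auto simp: E_closures \<beta> rep.hom_simps action_in add Dc)
      show "c *\<^sub>C x \<in> ?N" if "x \<in> ?N" for c x
        using that by (auto simp: E_closures \<beta> rep.hom_simps action_in scale Dc)
    qed
    show "closed ?N"
      unfolding closed_sequential_limits
    proof (intro allI impI, elim conjE)
      fix f l assume f: "\<forall>n. f n \<in> ?N" and lim: "f \<longlonglongrightarrow> l"
      have l: "l \<in> E" using closed_sequentially[OF operator_algebra_closed[OF E_algebra] _ lim] f by auto
      have "rep (\<beta> h l) o\<^sub>L unitary g \<in> ?D" if gh: "g \<in> carrier G" "h \<in> carrier G" for g h
      proof -
        have 1: "(\<lambda>n. \<beta> h (f n)) \<longlonglongrightarrow> \<beta> h l"
          by (rule star_representation.tendsto_rep[OF action_rep[OF gh(2)] lim l]) (use f in auto)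
        have "(\<lambda>n. rep (\<beta> h (f n))) \<longlonglongrightarrow> rep (\<beta> h l)"
          by (rule rep.tendsto_rep[OF 1]) (use f l gh action_in in auto)
        then have "(\<lambda>n. rep (\<beta> h (f n)) o\<^sub>L unitary g) \<longlonglongrightarrow> (rep (\<beta> h l) o\<^sub>L unitary g)"
          by (rule tendsto_compose_left)
        then show ?thesis
          by (rule closed_sequentially[OF operator_algebra_closed[OF cstar_algebraD(1)[OF D]], rotated]) (use f gh in blast)
      qed
      then show "l \<in> ?N" using l by blast
    qed
    show "c o\<^sub>L d \<in> ?N" if cd: "c \<in> ?N" "d \<in> ?N" for c d
    proof -
      have "rep (\<beta> h (c o\<^sub>L d)) o\<^sub>L unitary g \<in> ?D" if gh: "g \<in> carrier G" "h \<in> carrier G" for g h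
      proof -
        have c: "c \<in> E" "d \<in> E" using cd by auto
        \<comment> \<open>The left factor takes the unitary of the group unit, so that both factors
          are instances of the condition defining \<open>?N\<close>.\<close>
        have "rep (\<beta> h (c o\<^sub>L d)) = (rep (\<beta> h c) o\<^sub>L unitary \<one>) o\<^sub>L rep (\<beta> h d)"
          using c gh by (simp add: \<beta> rep.hom_simps action_in rep_unitary_one)
        then have "rep (\<beta> h (c o\<^sub>L d)) o\<^sub>L unitary g = (rep (\<beta> h c) o\<^sub>L unitary \<one>) o\<^sub>L (rep (\<beta> h d) o\<^sub>L unitary g)"
          by (simp only: blinfun_compose_assoc)
        also have "\<dots> \<in> ?D" by (rule Dc(7)) (use cd gh G.one_closed in blast)+
        finally show ?thesis .
      qed
      then show ?thesis using cd E_closures(7) by simp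
    qed
    show "adj c \<in> ?N" if c: "c \<in> ?N" for c
    proof -
      have cE: "c \<in> E" using c by simp
      have "rep (\<beta> h (adj c)) o\<^sub>L unitary g \<in> ?D" if gh: "g \<in> carrier G" "h \<in> carrier G" for g h
      proof -
        \<comment> \<open>The translate by \<open>inv g \<otimes> h\<close> is chosen so that
          \<beta> h remains after the unitary has been moved past the adjoint coefficient.\<close>
        have "adj (rep (\<beta> (inv g \<otimes> h) c) o\<^sub>L unitary (inv g))
            = rep (\<beta> (inv (inv g)) (adj (\<beta> (inv g \<otimes> h) c))) o\<^sub>L unitary (inv (inv g))"
          by (rule monomial_adj) (use gh cE action_in in auto)
        also have "adj (\<beta> (inv g \<otimes> h) c) = \<beta> (inv g \<otimes> h) (adj c)"
          using gh cE by (simp add: \<beta>)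
        also have "\<beta> (inv (inv g)) (\<beta> (inv g \<otimes> h) (adj c)) = \<beta> (inv (inv g) \<otimes> (inv g \<otimes> h)) (adj c)"
          using gh cE E_closures(8) by (intro action_mult[symmetric]) auto
        also have "inv (inv g) \<otimes> (inv g \<otimes> h) = h"
          using gh by (simp add: G.m_assoc[symmetric])
        finally have "rep (\<beta> h (adj c)) o\<^sub>L unitary g = adj (rep (\<beta> (inv g \<otimes> h) c) o\<^sub>L unitary (inv g))"
          using gh by simp
        moreover have "rep (\<beta> (inv g \<otimes> h) c) o\<^sub>L unitary (inv g) \<in> ?D"
          using c gh G.inv_closed G.m_closed by blast
        ultimately show ?thesis using Dc(8) by simp
      qed
      then show ?thesis using cE E_closures(8) by simp
    qed
  qed
  moreover have "j a \<in> ?N" if a: "a \<in> A" for a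
  proof -
    have "rep (\<beta> h (j a)) o\<^sub>L unitary g \<in> relative_monomials" if "g \<in> carrier G" "h \<in> carrier G" for g h
      using that a \<alpha>_in by (auto simp: relative_monomials_def extends)
    then show ?thesis using cstar_generated_superset j_in[OF a] by blast
  qed
  ultimately have EN: "E \<subseteq> ?N" by (rule E_induct)
  have "monomials \<subseteq> ?D"
  proof
    fix x assume "x \<in> monomials"
    then obtain c g where x: "x = rep c o\<^sub>L unitary g" "c \<in> E" "g \<in> carrier G" by (auto simp: monomials_def)
    then have "rep (\<beta> \<one> c) o\<^sub>L unitary g \<in> ?D" using EN G.one_closed by blast
    then show "x \<in> ?D" using x by (simp add: action_one)
  qed
  then show ?thesis
    by (rule full_subset[OF operator_algebra_csubspace[OF cstar_algebraD(1)[OF D]]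
          operator_algebra_closed[OF cstar_algebraD(1)[OF D]]])
qed

text \<open>This makes the full crossed product a competitor in the universal property of the
  envelope of \<open>relative\<close>, which is the source of the epimorphism \<phi>.\<close>

lemma full_cover: "cstar_cover relative full (\<lambda>x. x)"
proof -
  have "cstar_generated relative = full"
  proof
    show "cstar_generated relative \<subseteq> full" by (rule cstar_generated_subset[OF cstar_full relative_full])
    have "relative_monomials \<subseteq> cstar_generated relative"
      using relative_monomials_in cstar_generated_superset by blast
    moreover have "cstar_algebra (cstar_generated relative)"
      by (rule cstar_algebra_generated) (use relative_full full_bops in blast)
    ultimately show "full \<subseteq> cstar_generated relative"
      using full_generated cstar_generated_subset by blast
  qed
  then show ?thesis
    using relative_full cstar_full
    by (auto simp: cstar_cover_def algebra_hom_def completely_isometric_def clinear_on_def)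
qed

text \<open>In both products the group elements cancel. What is left is the image under
  \<open>rep\<close> of an element of \<open>E\<close>, which \<open>rep_E_generated\<close> places
  in the algebra generated by \<open>A\<close>.\<close>

lemma monomial_squares:
  assumes "b \<in> relative_monomials"
  shows "adj b o\<^sub>L b \<in> cstar_generated ((\<lambda>a. rep (j a)) ` A)"
    and "b o\<^sub>L adj b \<in> cstar_generated ((\<lambda>a. rep (j a)) ` A)"
proof -
  obtain a g where b: "b = rep (j a) o\<^sub>L unitary g" and a: "a \<in> A" and g: "g \<in> carrier G"
    using assms by (auto simp: relative_monomials_def)
  have ja: "j a \<in> E" by (rule j_in[OF a])
  have ig: "inv g \<in> carrier G" using g by simp
  have aE: "adj (j a) \<in> E" using E_closures(8)[OF ja] .
  have ba: "\<beta> (inv g) (adj (j a)) \<in> E" "\<beta> (inv g) (j a) \<in> E" using action_in[OF ig] aE ja by auto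
  have "adj b o\<^sub>L b = rep (\<beta> (inv g) (adj (j a)) o\<^sub>L \<beta> (inv g) (j a)) o\<^sub>L unitary (inv g \<otimes> g)"
    unfolding b monomial_adj[OF ja g] by (rule monomial_mult[OF ba(1) ja ig g])
  also have "\<dots> = rep (\<beta> (inv g) (adj (j a)) o\<^sub>L \<beta> (inv g) (j a))"
    using g ba by (simp add: rep_unitary_one E_closures(7))
  finally show "adj b o\<^sub>L b \<in> cstar_generated ((\<lambda>a. rep (j a)) ` A)"
    using rep_E_generated E_closures(7)[OF ba] by auto
  have bb: "\<beta> g (\<beta> (inv g) (adj (j a))) \<in> E" using action_in[OF g ba(1)] .
  have "b o\<^sub>L adj b = rep (j a o\<^sub>L \<beta> g (\<beta> (inv g) (adj (j a)))) o\<^sub>L unitary (g \<otimes> inv g)"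
    unfolding b monomial_adj[OF ja g] by (rule monomial_mult[OF ja ba(1) g ig])
  also have "\<dots> = rep (j a o\<^sub>L \<beta> g (\<beta> (inv g) (adj (j a))))"
    using g bb ja by (simp add: rep_unitary_one E_closures(7))
  finally show "b o\<^sub>L adj b \<in> cstar_generated ((\<lambda>a. rep (j a)) ` A)"
    using rep_E_generated E_closures(7)[OF ja bb] by auto
qed

end

section \<open>Triviality of the kernel of the epimorphism\<close>

context relative_system
begin

context
  fixes k :: "('k, 'g, 'u) cov_space op \<Rightarrow> 'f::chilbert_space op" and \<phi> and \<E>
  assumes unit: "contractive_approx_unit A \<E>"
    and hyper: "hyperrigid TYPE('u ell2) A E j"
    and infinite_index: "infinite (UNIV :: 'u set)"
    and k_hom: "algebra_hom relative k" and k_iso: "completely_isometric relative k"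
    and k_bops: "k ` relative \<subseteq> bops UNIV"
    and \<phi>: "star_representation full \<phi>" and \<phi>_k: "\<And>b. b \<in> relative \<Longrightarrow> \<phi> b = k b"
begin

text \<open>A covariant representation may be degenerate, while hyperrigidity concerns nondegenerate
  ones. So everything is cut down to the essential space \<open>M\<close> of \<open>A\<close>, off
  which the representation of the whole crossed product vanishes.\<close>

lemma block_kernel:
  assumes p: "p \<in> Cov" and c: "c \<in> full" and z: "\<phi> c = 0"
  shows "block p c = 0"
proof -
  define \<pi> where "\<pi> = fst p"
  define \<psi> where "\<psi> a = \<pi> (j a)" for a
  define M where "M = essential_space A \<psi> UNIV"
  define \<theta> where "\<theta> a = rep (j a)" for a
  have M: "closed_csubspace M" unfolding M_def by (rule closed_csubspace_essential)
  have Ms: "csubspace M" and Mc: "closed M" using M by (auto simp: closed_csubspace_def)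
  have cov: "covariant_rep E G \<beta> p" using p by simp
  interpret \<pi>: star_representation E \<pi> unfolding \<pi>_def by (rule covariant_repD(1)[OF cov])
  interpret rep: star_representation E rep by (rule rep_star_representation)
  interpret \<sigma>: star_representation full "block p" by (rule block_star_representation[OF p])
  have As: "csubspace A" by (rule operator_algebra_csubspace[OF A])
  note j_simps = algebra_hom_add[OF j_hom As] algebra_hom_scaleC[OF j_hom As] algebra_hom_compose[OF j_hom As]
  have \<psi>_hom: "algebra_hom A \<psi>"
    by (auto simp: algebra_hom_def clinear_on_def \<psi>_def j_simps \<pi>.hom_simps j_in)
  have \<psi>_bops: "\<psi> ` A \<subseteq> bops UNIV" using \<pi>.rep_bops j_in by (auto simp: \<psi>_def)
  have \<psi>_norm: "norm (\<psi> a) \<le> norm a" if "a \<in> A" for a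
    using \<pi>.contractive[OF j_in[OF that]] completely_isometric_norm[OF j_iso that] by (simp add: \<psi>_def)
  have ess: "((\<lambda>e. blinfun_apply (\<psi> e) y) \<longlongrightarrow> y) \<E>" if "y \<in> M" for y
    by (rule unit_tendsto_essential[OF A \<psi>_hom \<psi>_bops _ unit]) (use \<psi>_norm that in \<open>auto simp: M_def\<close>)
  have orth: "blinfun_apply (\<psi> a) w = 0" if "\<And>y. y \<in> M \<Longrightarrow> cinner w y = 0" "a \<in> A" for a w
    by (rule orthogonal_to_essential[OF A \<psi>_hom \<psi>_bops _ unit]) (use \<psi>_norm that in \<open>auto simp: M_def\<close>)
  have \<psi>M: "a \<in> A \<Longrightarrow> blinfun_apply (\<psi> a) x \<in> M" for a x
    unfolding M_def by (rule essential_spaceI) auto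
  have \<psi>_proj: "blinfun_apply (\<psi> a) (proj M x) = blinfun_apply (\<psi> a) x" if a: "a \<in> A" for a x
  proof -
    have "blinfun_apply (\<psi> a) (x - proj M x) = 0" by (rule orth) (use a proj_orth[OF M] in auto)
    then show ?thesis by (simp add: blinfun.diff_right)
  qed

  \<comment> \<open>The condition is put on \<open>c\<close> and its adjoint together to be stable
    under adjoints. For a generator the adjoint half follows from \<open>orth\<close> by passing to
    the double orthogonal complement.\<close>
  let ?N = "{c \<in> E. \<forall>y. blinfun_apply (\<pi> c) y \<in> M \<and> blinfun_apply (\<pi> (adj c)) y \<in> M}"
  have "cstar_algebra ?N"
    unfolding cstar_algebra_def operator_algebra_def
  proof (intro conjI ballI)
    show "?N \<subseteq> bops UNIV" using E_bops by blast
    show "csubspace ?N"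
      by (rule csubspaceI)
        (auto simp: \<pi>.hom_simps E_closures adj_add adj_scaleC E_bops blinfun.add_left blinfun_apply_scaleC
          csubspaceD[OF Ms])
    show "c o\<^sub>L d \<in> ?N" if "c \<in> ?N" "d \<in> ?N" for c d
      using that by (auto simp: \<pi>.hom_simps E_closures adj_compose E_bops)
    show "adj c \<in> ?N" if "c \<in> ?N" for c
      using that by (auto simp: E_closures adj_adj E_bops)
    show "closed ?N"
      unfolding closed_sequential_limits
    proof (intro allI impI, elim conjE)
      fix f l assume f: "\<forall>n. f n \<in> ?N" and lim: "f \<longlonglongrightarrow> l"
      have l: "l \<in> E" using closed_sequentially[OF operator_algebra_closed[OF E_algebra] _ lim] f by auto
      have lim': "(\<lambda>n. adj (f n)) \<longlonglongrightarrow> adj l"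
        by (rule tendsto_adj[OF lim]) (use f l E_bops in \<open>auto intro!: always_eventually\<close>)
      have "(\<lambda>n. blinfun_apply (\<pi> (f n)) y) \<longlonglongrightarrow> blinfun_apply (\<pi> l) y" for y
        by (rule bounded_linear.tendsto[OF blinfun.bounded_linear_left], rule \<pi>.tendsto_rep[OF lim l])
          (use f in auto)
      then have "blinfun_apply (\<pi> l) y \<in> M" for y
        by (rule closed_sequentially[OF Mc, rotated]) (use f in auto)
      moreover have "(\<lambda>n. blinfun_apply (\<pi> (adj (f n))) y) \<longlonglongrightarrow> blinfun_apply (\<pi> (adj l)) y" for y
        by (rule bounded_linear.tendsto[OF blinfun.bounded_linear_left], rule \<pi>.tendsto_rep[OF lim'])
          (use f l E_closures(8) in auto)
      then have "blinfun_apply (\<pi> (adj l)) y \<in> M" for y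
        by (rule closed_sequentially[OF Mc, rotated]) (use f in auto)
      ultimately show "l \<in> ?N" using l by blast
    qed
  qed
  moreover have "j a \<in> ?N" if a: "a \<in> A" for a
  proof -
    have "blinfun_apply (\<pi> (adj (j a))) y \<in> M" for y
    proof (rule double_orthogonal[OF M])
      fix w assume "\<And>y. y \<in> M \<Longrightarrow> cinner w y = 0"
      then have "blinfun_apply (\<psi> a) w = 0" by (intro orth[OF _ a])
      then show "cinner (blinfun_apply (\<pi> (adj (j a))) y) w = 0"
        by (simp add: \<pi>.hom_adj j_in[OF a] cinner_adj_left[OF \<pi>.rep_bops] \<psi>_def)
    qed
    then show ?thesis using \<psi>M[OF a] j_in[OF a] by (simp add: \<psi>_def)
  qed
  ultimately have "E \<subseteq> ?N" by (rule E_induct)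
  then have \<pi>M: "blinfun_apply (\<pi> b) y \<in> M" if "b \<in> E" for b y using that by blast

  have block_M: "blinfun_apply (block p c) x \<in> M" if "c \<in> full" for c x
  proof -
    have "full \<subseteq> {c. \<forall>x. blinfun_apply (block p c) x \<in> M}"
    proof (rule full_subset)
      show "csubspace {c. \<forall>x. blinfun_apply (block p c) x \<in> M}"
        by (rule csubspaceI)
          (auto simp: block_apply blinfun.add_left blinfun_apply_scaleC pull_add[OF inj_Pair]
            pull_scaleC[OF inj_Pair] csubspaceD[OF Ms])
      show "closed {c. \<forall>x. blinfun_apply (block p c) x \<in> M}"
        unfolding closed_sequential_limits
      proof (intro allI impI CollectI, elim conjE)
        fix f l x assume f: "\<forall>n. f n \<in> {c. \<forall>x. blinfun_apply (block p c) x \<in> M}" and lim: "f \<longlonglongrightarrow> l"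
        have "(\<lambda>n. blinfun_apply (block p (f n)) x) \<longlonglongrightarrow> blinfun_apply (block p l) x"
          unfolding block_apply
          by (intro bounded_linear.tendsto[OF bounded_linear_pull[OF inj_Pair]]
              bounded_linear.tendsto[OF blinfun.bounded_linear_left] lim)
        then show "blinfun_apply (block p l) x \<in> M"
          by (rule closed_sequentially[OF Mc, rotated]) (use f in auto)
      qed
      show "monomials \<subseteq> {c. \<forall>x. blinfun_apply (block p c) x \<in> M}"
        using \<pi>M by (auto simp: monomials_def block_monomial[OF p] \<pi>_def[symmetric])
    qed
    then show ?thesis using that by blast
  qed
  have block_proj: "blinfun_apply (block p c) (proj M x) = blinfun_apply (block p c) x" if c: "c \<in> full" for c x
  proof -
    have ac: "adj c \<in> full" by (rule cstar_algebraD(2)[OF cstar_full c])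
    have "cinner (blinfun_apply (block p c) (x - proj M x)) y = cinner 0 y" for y
      using proj_orth[OF M block_M[OF ac, of y], of x]
      by (simp add: \<sigma>.hom_adj[OF c] cinner_adj_right[OF \<sigma>.rep_bops[OF c]])
    then have "blinfun_apply (block p c) (x - proj M x) = 0" by (rule cinner_ext)
    then show ?thesis by (simp add: blinfun.diff_right)
  qed
  have \<theta>_in: "a \<in> A \<Longrightarrow> \<theta> a \<in> relative" for a by (simp add: \<theta>_def rep_j_in)
  have \<sigma>\<theta>: "block p (\<theta> a) = \<psi> a" if "a \<in> A" for a
    by (simp add: \<theta>_def \<psi>_def \<pi>_def block_rep_apply[OF p j_in[OF that]])

  \<comment> \<open>\<theta> carries the approximate unit of \<open>A\<close> into
    \<open>relative\<close>; only its strong convergence on \<open>M\<close> is asked of it.\<close>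
  interpret compression relative k "block p" M "filtermap \<theta> \<E>"
  proof
    show "operator_algebra relative" by (rule relative_algebra)
    show "algebra_hom relative k" "completely_isometric relative k" "k ` relative \<subseteq> bops UNIV"
      by (rule k_hom k_iso k_bops)+
    show "algebra_hom relative (block p)"
      using \<sigma>.hom relative_full by (auto simp: algebra_hom_def clinear_on_def subset_iff)
    show "block p ` relative \<subseteq> bops UNIV" using \<sigma>.rep_bops relative_full by blast
    show "mat_bound n (\<lambda>i j. block p (x i j)) r" if "mat_bound n x r" for n x r
      by (rule block_mat_bound[OF that])
    show "closed_csubspace M" by (rule M)
    show "blinfun_apply (block p b) x \<in> M" "blinfun_apply (block p b) (proj M x) = blinfun_apply (block p b) x"
      if "b \<in> relative" for b x using that relative_full block_M block_proj by blast+
    show "filtermap \<theta> \<E> \<noteq> bot" using unit by (simp add: contractive_approx_unit_def filtermap_bot_iff)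
    have "\<forall>\<^sub>F e in \<E>. e \<in> A \<and> norm e \<le> 1" using unit by (simp add: contractive_approx_unit_def)
    then show "\<forall>\<^sub>F e in filtermap \<theta> \<E>. e \<in> relative \<and> norm e \<le> 1"
      unfolding eventually_filtermap
    proof eventually_elim
      case (elim e)
      then have "norm (\<theta> e) \<le> norm e"
        using rep.contractive[OF j_in[of e]] completely_isometric_norm[OF j_iso, of e] by (simp add: \<theta>_def)
      then show ?case using elim \<theta>_in by simp
    qed
    show "((\<lambda>e. blinfun_apply (block p e) y) \<longlongrightarrow> y) (filtermap \<theta> \<E>)" if y: "y \<in> M" for y
      unfolding filterlim_filtermap
    proof (rule Lim_transform_eventually[OF ess[OF y]])
      show "\<forall>\<^sub>F e in \<E>. blinfun_apply (\<psi> e) y = blinfun_apply (block p (\<theta> e)) y"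
        using \<open>\<forall>\<^sub>F e in \<E>. e \<in> A \<and> norm e \<le> 1\<close> by eventually_elim (simp add: \<sigma>\<theta>)
    qed
  qed

  obtain s :: "('u set \<times> ('u \<Rightarrow> 'f) \<Rightarrow> real) \<Rightarrow> real" where s:
    "\<And>f g. f \<in> dominated \<Longrightarrow> g \<in> dominated \<Longrightarrow> s (f + g) = s f + s g"
    "\<And>c f. f \<in> dominated \<Longrightarrow> s (c *\<^sub>R f) = c * s f"
    "\<And>f. f \<in> dominated \<Longrightarrow> (\<And>v. 0 \<le> f v) \<Longrightarrow> 0 \<le> s f"
    "\<And>b \<xi> \<eta>. b \<in> relative \<Longrightarrow> s (\<lambda>v. inner (blinfun_apply (k b) (ev v \<xi>)) (ev v \<eta>)) = inner (blinfun_apply (block p b) \<xi>) \<eta>"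
    "\<And>\<xi> \<eta>. s (\<lambda>v. inner (ev v \<xi>) (ev v \<eta>)) = inner (proj M \<xi>) \<eta>"
    by (rule exists_positive_extension) blast

  \<comment> \<open>Restricting to \<open>M\<close> loses nothing, as \<psi>(a) factors through the
    projection onto \<open>M\<close>.\<close>
  have essM: "essential_space A \<psi> M = M"
  proof
    show "essential_space A \<psi> M \<subseteq> M" by (rule essential_space_minimal[OF M \<psi>M])
    have "M \<subseteq> essential_space A \<psi> M"
      unfolding M_def by (rule essential_space_minimal[OF closed_csubspace_essential])
        (metis M_def \<psi>_proj essential_spaceI proj_in[OF M])
    then show "M \<subseteq> essential_space A \<psi> M" .
  qed
  have essE: "essential_space E \<pi> M = M"
  proof
    show "essential_space E \<pi> M \<subseteq> M" by (rule essential_space_minimal[OF M \<pi>M])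
    have "essential_space A \<psi> M \<subseteq> essential_space E \<pi> M"
      by (rule essential_space_minimal[OF closed_csubspace_essential])
        (simp add: \<psi>_def j_in essential_spaceI)
    then show "M \<subseteq> essential_space E \<pi> M" unfolding essM .
  qed
  have "\<pi> ` E \<subseteq> bops M"
  proof (rule image_subsetI)
    fix b assume b: "b \<in> E"
    have "blinfun_apply (\<pi> b) x = 0" if x: "\<forall>y\<in>M. cinner x y = 0" for x
    proof (rule cinner_ext)
      fix y
      have "cinner x (blinfun_apply (\<pi> (adj b)) y) = 0" using x \<pi>M[OF E_closures(8)[OF b]] by blast
      then show "cinner (blinfun_apply (\<pi> b) x) y = cinner 0 y"
        by (simp add: \<pi>.hom_adj[OF b] cinner_adj_right[OF \<pi>.rep_bops[OF b]])
    qed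
    then show "\<pi> b \<in> bops M"
      using \<pi>M[OF b] bops_scaleC[OF \<pi>.rep_bops[OF b]] unfolding bops_def by blast
  qed
  then have "nondegenerate_star_rep E M \<pi>"
    using M \<pi>.star_hom essE by (simp add: nondegenerate_star_rep_def)
  then have max: "maximal_map TYPE('u ell2) A M (\<lambda>a. \<pi> (j a))"
    using hyper by (simp add: hyperrigid_def)

  interpret crossed_extension relative k "block p" M "filtermap \<theta> \<E>" s A \<theta> full \<phi> relative_monomials
  proof (intro crossed_extension.intro maximal_extension.intro positive_extension.intro
      crossed_extension_axioms.intro maximal_extension_axioms.intro positive_extension_axioms.intro)
    show "compression relative k (block p) M (filtermap \<theta> \<E>)" by (rule compression_axioms)
    show "csubspace A" by (rule As)
    show "clinear_on A \<theta>" by (auto simp: clinear_on_def \<theta>_def j_simps rep.hom_simps j_in)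
    show "mat_bound n (\<lambda>i j. \<theta> (x i j)) r"
      if "\<And>i j. i < n \<Longrightarrow> j < n \<Longrightarrow> x i j \<in> A" "0 \<le> r" "mat_bound n x r" for n x r
    proof -
      have "mat_bound n (\<lambda>i l. j (x i l)) r" using completely_isometric_mat_bound[OF j_iso that(1,2)] that(3) by simp
      then show ?thesis unfolding \<theta>_def by (intro rep.completely_contractive_mat) (use that j_in in auto)
    qed
    show "maximal_map TYPE('u ell2) A M (\<lambda>a. block p (\<theta> a))"
      by (rule maximal_map_cong[OF max _ As]) (simp add: \<sigma>\<theta> \<psi>_def)
    have "{blinfun_apply (block p (\<theta> a)) x | a x. a \<in> A \<and> x \<in> M} = {blinfun_apply (\<psi> a) x | a x. a \<in> A \<and> x \<in> M}"
      using \<sigma>\<theta> by (auto; metis)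
    then show "essential_space A (\<lambda>a. block p (\<theta> a)) M = M"
      using essM by (simp add: essential_space_def)
    show "infinite (UNIV :: 'u set)" by (rule infinite_index)
    show "star_representation full \<phi>" "star_representation full (block p)" by (rule \<phi> \<sigma>.star_representation_axioms)+
    show "adj b o\<^sub>L b \<in> cstar_generated (\<theta> ` A)" "b o\<^sub>L adj b \<in> cstar_generated (\<theta> ` A)"
      if "b \<in> relative_monomials" for b
      using monomial_squares[OF that] by (simp_all add: \<theta>_def[abs_def])
  qed (use s \<theta>_in relative_full \<phi>_k relative_monomials_in full_generated block_M block_proj in auto)
  show ?thesis by (rule kernel_subset[OF c z])
qed

text \<open>By \<open>full_block\<close> an element of \<open>full\<close> is determined by its
  blocks at the covariant representations.\<close>

lemma kernel_trivial:
  assumes c: "c \<in> full" and z: "\<phi> c = 0"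
  shows "c = 0"
proof (rule blinfun_eqI, rule pull_Pair_ext)
  fix x p
  show "pull (Pair p) (blinfun_apply c x) = pull (Pair p) (blinfun_apply 0 x)"
    unfolding full_block[OF c] using block_kernel[OF _ c z] by simp
qed

end

end

theorem theorem2p7:
  fixes A :: "'h::chilbert_space op set"
    and G :: "('g, 'm) monoid_scheme"
    and \<alpha> :: "'g \<Rightarrow> 'h op \<Rightarrow> 'h op"
    and E :: "'k::chilbert_space op set"
    and j :: "'h op \<Rightarrow> 'k op"
    and \<beta> :: "'g \<Rightarrow> 'k op \<Rightarrow> 'k op"
    and F :: "'f::chilbert_space op set"
    and k :: "('k, 'g, 'u) cov_space op \<Rightarrow> 'f op"
  assumes universe_large: "\<exists>\<iota> :: 'k op \<times> 'g \<times> nat \<Rightarrow> 'u. inj \<iota>"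
    and system: "dynamical_system A G \<alpha>"
    and selfadjoint_cai: "\<exists>\<E>. contractive_approx_unit A \<E> \<and> (\<forall>\<^sub>F e in \<E>. adj e = e)"
    and env_A: "cstar_envelope TYPE('u ell2) A E j"
    and action_E: "cstar_action E G \<beta>"
    and extends: "\<And>s a. s \<in> carrier G \<Longrightarrow> a \<in> A \<Longrightarrow> \<beta> s (j a) = j (\<alpha> s a)"
    and hyperrigid: "hyperrigid TYPE('u ell2) A E j"
    and env_crossed: "cstar_envelope TYPE(('k, 'g, 'u) cov_space)
                        (relative_crossed_product TYPE('u) A j E G \<beta>) F k"
  shows "star_isomorphic F (full_crossed_product TYPE('u) E G \<beta>)"
proof -
  obtain \<iota> :: "'k op \<times> 'g \<times> nat \<Rightarrow> 'u" where \<iota>: "inj \<iota>" using universe_large by blast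
  \<comment> \<open>The factor \<open>nat\<close> in the universe hypothesis makes \<open>'u\<close>
    infinite, which gives the room for the one-dimensional dilation.\<close>
  have "inj (\<lambda>n. \<iota> (undefined, undefined, n))" using \<iota> by (auto simp: inj_def)
  then have infinite_index: "infinite (UNIV :: 'u set)"
    by (metis finite_imageD finite_subset infinite_UNIV_nat subset_UNIV)
  interpret relative_system "TYPE('u)" E G \<beta> A \<alpha> j
  proof (intro relative_system.intro crossed_product.intro relative_system_axioms.intro)
    have cover: "cstar_cover A E j" using env_A by (simp add: cstar_envelope_def)
    then show "cstar_cover A E j" .
    show "cstar_algebra E" using cover unfolding cstar_cover_def by blast
    show "group G" "operator_algebra A" using system by (simp_all add: dynamical_system_def)
    show "cstar_action E G \<beta>" by (rule action_E)
    show "\<alpha> g a \<in> A" if "g \<in> carrier G" "a \<in> A" for g a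
      using system that by (auto simp: dynamical_system_def completely_isometric_automorphism_def bij_betw_def)
    show "\<beta> g (j a) = j (\<alpha> g a)" if "g \<in> carrier G" "a \<in> A" for g a using that by (rule extends)
  qed
  have cover_F: "cstar_cover relative F k" using env_crossed by (simp add: cstar_envelope_def)
  then have F: "cstar_algebra F" and k_in: "k ` relative \<subseteq> F" by (auto simp: cstar_cover_def)
  have F_bops: "F \<subseteq> bops UNIV" using operator_algebra_bops[OF cstar_algebraD(1)[OF F]] by blast
  obtain \<phi> where \<phi>: "star_hom full \<phi>" "\<phi> ` full = F" "\<And>b. b \<in> relative \<Longrightarrow> \<phi> b = k b"
    using env_crossed full_cover unfolding cstar_envelope_def by blast
  interpret \<phi>: star_representation full \<phi>
    by unfold_locales (use \<phi> F_bops cstar_full in auto)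
  obtain \<E> where unit: "contractive_approx_unit A \<E>" using selfadjoint_cai by blast
  have kernel: "c = 0" if "c \<in> full" "\<phi> c = 0" for c
    by (rule kernel_trivial[OF unit hyperrigid infinite_index _ _ _ \<phi>.star_representation_axioms \<phi>(3) that])
      (use cover_F k_in F_bops in \<open>auto simp: cstar_cover_def\<close>)
  have inj: "inj_on \<phi> full"
  proof (rule inj_onI)
    fix c d assume cd: "c \<in> full" "d \<in> full" "\<phi> c = \<phi> d"
    then have "c - d = 0" by (intro kernel) (simp_all add: \<phi>.closures \<phi>.hom_simps)
    then show "c = d" by simp
  qed
  \<comment> \<open>The isomorphism is to go out of \<open>F\<close>, so \<phi> is inverted.\<close>
  define \<psi> where "\<psi> = inv_into full \<phi>"
  have \<psi>: "\<psi> (\<phi> c) = c" if "c \<in> full" for c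
    unfolding \<psi>_def using inv_into_f_f[OF inj that] .
  have "star_hom F \<psi>"
    unfolding star_hom_def algebra_hom_def clinear_on_def \<phi>(2)[symmetric]
    by (auto simp: \<psi> \<phi>.closures \<phi>.hom_simps[symmetric] \<phi>.hom_adj[symmetric])
  moreover have "bij_betw \<psi> F full"
    unfolding \<psi>_def by (rule bij_betw_inv_into) (simp add: bij_betw_def inj \<phi>(2))
  ultimately show ?thesis unfolding star_isomorphic_def by blast
qed

end
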